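(* There exist absolute constants $C,c_1,c_2>0$ such that the following holds. Let $\mathbf{X}^0\in\mathbb{R}^{d_1\times d_2}$ be a matrix of rank $r$ that is $\mu_0$-incoherent, let $d=\min(d_1,d_2)$, $D=\max(d_1,d_2)$, $\kappa=\sigma_1(\mathbf{X}^0)/\sigma_r(\mathbf{X}^0)$, and let $P_\Omega:\mathbb{R}^{d_1\times d_2}\to\mathbb{R}^m$ be the subsampling operator corresponding to an index set $\Omega=(i_\ell,j_\ell)_{\ell=1}^m\subset[d_1]\times[d_2]$ drawn uniformly at random without replacement. If $$m\ge C\,\mu_0\,r\,(d_1+d_2)\log(d_1+d_2),$$ then with probability at least $1-2D^{-2}$ the following holds: If the output matrix $\mathbf{X}^{(k)}\in\mathbb{R}^{d_1\times d_2}$ of the $k$-th iteration of MatrixIRLS with inputs $P_\Omega$, $\mathbf{y}=P_\Omega(\mathbf{X}^0)$ and $\widetilde r=r$ updates the smoothing parameter such that $\epsilon_k=\sigma_{r+1}(\mathbf{X}^{(k)})$ and fulfills $$\|\mathbf{X}^{(k)}-\mathbf{X}^0\|_{S_\infty}\le c_1\min\left(\sqrt{\frac{\mu_0r}{d}},\ \frac{\mu_0}{d\log(D)\,\kappa}\right)\sigma_r(\mathbf{X}^0),$$ then the local convergence rate is quadratic in the sense that $$\|\mathbf{X}^{(k+1)}-\mathbf{X}^0\|_{S_\infty}\le\min\left(\mu\,\|\mathbf{X}^{(k)}-\mathbf{X}^0\|_{S_\infty}^2,\ \|\mathbf{X}^{(k)}-\mathbf{X}^0\|_{S_\infty}\right)$$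 for some $\mu\le\frac{d\log(D)}{\mu_0\,\sigma_r(\mathbf{X}^0)}\kappa$; and furthermore $\mathbf{X}^{(k+\ell)}\to\mathbf{X}^0$ as $\ell\to\infty$ if additionally $$\|\mathbf{X}^{(k)}-\mathbf{X}^0\|_{S_\infty}\le c_2\min\left(\sqrt{\frac{\mu_0r}{d}},\ \frac{\mu_0^{3/2}r^{1/2}}{d^2\log(D)^{3/2}\,\kappa}\right)\sigma_r(\mathbf{X}^0).$$
   Context: Notation: $\sigma_i(\mathbf{X})$ is the $i$-th largest singular value (with $\sigma_i(\mathbf{X})=0$ for $i>d$); $\|\mathbf{X}\|_{S_\infty}=\sigma_1(\mathbf{X})$ is the spectral norm; $\|\cdot\|_F$ is the Frobenius norm and $\langle\cdot,\cdot\rangle$ the Frobenius inner product; $P_\Omega(\mathbf{X})_\ell=\mathbf{X}_{i_\ell j_\ell}$; $\circ$ is the entrywise product; $e_i$ are standard basis vectors. Incoherence: a rank-$r$ matrix $\mathbf{X}\in\mathbb{R}^{d_1\times d_2}$ with compact singular value decomposition $\mathbf{X}=\mathbf{U}\,\mathrm{diag}(\sigma)\mathbf{V}^*$, $\mathbf{U}\in\mathbb{R}^{d_1\times r}$, $\mathbf{V}\in\mathbb{R}^{d_2\times r}$, is $\mu_0$-incoherent, for a constant $\mu_0\ge1$, if $\max_{1\le i\le d_1,1\le j\le d_2}\|\mathcal{P}_T(e_ie_j^* )\|_F\le\sqrt{\mu_0r\frac{d_1+d_2}{d_1d_2}}$, where $T=\{\mathbf{U}\mathbf{M}^*+\widetilde{\mathbf{M}}\mathbf{V}^*:\mathbf{M}\in\mathbb{R}^{d_2\times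 r},\widetilde{\mathbf{M}}\in\mathbb{R}^{d_1\times r}\}$ is the tangent space of the rank-$r$ matrix manifold at $\mathbf{X}$ and $\mathcal{P}_T$ is the orthogonal projection onto $T$. Weight operator: given $\epsilon_k>0$ and $\mathbf{X}^{(k)}$ with full singular value decomposition $\mathbf{X}^{(k)}=\mathbf{U}_k\,\mathrm{dg}(\sigma^{(k)})\mathbf{V}_k^*$ ($\mathbf{U}_k\in\mathbb{R}^{d_1\times d_1}$, $\mathbf{V}_k\in\mathbb{R}^{d_2\times d_2}$ orthogonal, $\mathrm{dg}(\sigma)$ the $d_1\times d_2$ matrix with $\sigma$ on its diagonal), set $(\mathbf{H}_k)_{ij}=\big(\max(\sigma_i^{(k)},\epsilon_k)\max(\sigma_j^{(k)},\epsilon_k)\big)^{-1}$ and $W^{(k)}(\mathbf{Z})=\mathbf{U}_k[\mathbf{H}_k\circ(\mathbf{U}_k^*\mathbf{Z}\mathbf{V}_k)]\mathbf{V}_k^*$ for $\mathbf{Z}\in\mathbb{R}^{d_1\times d_2}$. MatrixIRLS with inputs $P_\Omega$, $\mathbf{y}\in\mathbb{R}^m$ and rank estimate $\widetilde r$: start with $\epsilon_0=\infty$, $W^{(0)}=\mathrm{Id}$. For $k=1,2,\dots$: (1) $\mathbf{X}^{(k)}=\arg\min_{\mathbf{X}:P_\Omega(\mathbf{X})=\mathbf{y}}\langle\mathbf{X},W^{(k-1)}(\mathbf{X})\rangle$; (2) $\epsilon_k=\min(\epsilon_{k-1},\sigma_{\widetilde r+1}(\mathbf{X}^{(k)}))$;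 (3) $W^{(k)}$ is the weight operator defined by $\mathbf{X}^{(k)}$ and $\epsilon_k$. It is presupposed that $\epsilon_k>0$ whenever $W^{(k)}$ is used. *)

theory Defs
  imports "HOL-Probability.Probability" "Jordan_Normal_Form.DL_Rank"
begin

text \<open>
  Matrices are those of Jordan\_Normal\_Form, since the constants of the theorem have to be
  chosen before the dimensions. Matrix entries and lists are indexed from 0.
\<close>

definition rect_diag :: "nat \<Rightarrow> nat \<Rightarrow> real list \<Rightarrow> real mat" where
  "rect_diag n1 n2 s = Matrix.mat n1 n2 (\<lambda>(i, j). if i = j then nth_default 0 s i else 0)"

definition full_svd :: "real mat \<Rightarrow> real mat \<Rightarrow> real list \<Rightarrow> real mat \<Rightarrow> bool" where
  "full_svd X U s V \<longleftrightarrow>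
     (let d1 = dim_row X; d2 = dim_col X in
      U \<in> carrier_mat d1 d1 \<and> transpose_mat U * U = 1\<^sub>m d1 \<and>
      V \<in> carrier_mat d2 d2 \<and> transpose_mat V * V = 1\<^sub>m d2 \<and>
      length s = min d1 d2 \<and> sorted_wrt (\<ge>) s \<and> (\<forall>x\<in>set s. 0 \<le> x) \<and>
      X = U * rect_diag d1 d2 s * transpose_mat V)"

definition compact_svd :: "real mat \<Rightarrow> real mat \<Rightarrow> real list \<Rightarrow> real mat \<Rightarrow> bool" where
  "compact_svd X U s V \<longleftrightarrow>
     (let d1 = dim_row X; d2 = dim_col X; r = vec_space.rank d1 X in
      U \<in> carrier_mat d1 r \<and> transpose_mat U * U = 1\<^sub>m r \<and>
      V \<in> carrier_mat d2 r \<and> transpose_mat V * V = 1\<^sub>m r \<and>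
      length s = r \<and> sorted_wrt (\<ge>) s \<and> (\<forall>x\<in>set s. 0 < x) \<and>
      X = U * rect_diag r r s * transpose_mat V)"

text \<open>
  Every real matrix has a full singular value decomposition and its list of singular values is
  unique, so the description below is proper.
\<close>

definition singular_values :: "real mat \<Rightarrow> real list" where
  "singular_values X = (THE s. \<exists>U V. full_svd X U s V)"

text \<open>The index \<open>i \<ge> 1\<close> counts from 1; the value is 0 for \<open>i > min d\<^sub>1 d\<^sub>2\<close>.\<close>

definition singular_value :: "nat \<Rightarrow> real mat \<Rightarrow> real" where
  "singular_value i X = nth_default 0 (singular_values X) (i - 1)"

definition spectral_norm :: "real mat \<Rightarrow> real" where
  "spectral_norm X = singular_value 1 X"

definition frob_inner :: "real mat \<Rightarrow> real mat \<Rightarrow> real" where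
  "frob_inner A B = (\<Sum>i<dim_row A. \<Sum>j<dim_col A. A $$ (i, j) * B $$ (i, j))"

definition frob_norm :: "real mat \<Rightarrow> real" where
  "frob_norm A = sqrt (frob_inner A A)"

definition tangent_space :: "real mat \<Rightarrow> real mat \<Rightarrow> real mat set" where
  "tangent_space U V =
     {U * transpose_mat M + M' * transpose_mat V | M M'.
        M \<in> carrier_mat (dim_row V) (dim_col V) \<and> M' \<in> carrier_mat (dim_row U) (dim_col U)}"

definition orth_proj :: "real mat set \<Rightarrow> real mat \<Rightarrow> real mat" where
  "orth_proj T Z = (THE P. P \<in> T \<and> (\<forall>Y\<in>T. frob_inner (Z - P) Y = 0))"

definition basis_mat :: "nat \<Rightarrow> nat \<Rightarrow> nat \<Rightarrow> nat \<Rightarrow> real mat" where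
  "basis_mat d1 d2 i j = Matrix.mat d1 d2 (\<lambda>(a, b). if a = i \<and> b = j then 1 else 0)"

text \<open>The tangent space does not depend on the choice of the compact decomposition.\<close>

definition incoherent :: "real \<Rightarrow> real mat \<Rightarrow> bool" where
  "incoherent \<mu>0 X \<longleftrightarrow>
     (let d1 = dim_row X; d2 = dim_col X; r = vec_space.rank d1 X in
      1 \<le> \<mu>0 \<and>
      (\<exists>U s V. compact_svd X U s V \<and>
         (\<forall>i<d1. \<forall>j<d2.
            frob_norm (orth_proj (tangent_space U V) (basis_mat d1 d2 i j))
              \<le> sqrt (\<mu>0 * real r * (real (d1 + d2) / (real d1 * real d2))))))"

text \<open>
  The index set is an ordered sequence of \<open>m\<close> distinct positions; the set of these is
  nonempty exactly if \<open>m \<le> d\<^sub>1 d\<^sub>2\<close>.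
\<close>

definition uniform_sampling :: "nat \<Rightarrow> nat \<Rightarrow> nat \<Rightarrow> (nat \<times> nat) list pmf" where
  "uniform_sampling d1 d2 m =
     pmf_of_set {\<Omega>. length \<Omega> = m \<and> distinct \<Omega> \<and> set \<Omega> \<subseteq> {..<d1} \<times> {..<d2}}"

definition subsample :: "(nat \<times> nat) list \<Rightarrow> real mat \<Rightarrow> real Matrix.vec" where
  "subsample \<Omega> X = Matrix.vec (length \<Omega>) (\<lambda>l. X $$ (\<Omega> ! l))"

text \<open>
  In \<open>H\<close> the indices run up to \<open>d\<^sub>1\<close> and \<open>d\<^sub>2\<close>, so the singular values are padded by 0.
\<close>

definition weight_operator ::
    "real mat \<Rightarrow> real list \<Rightarrow> real mat \<Rightarrow> real \<Rightarrow> real mat \<Rightarrow> real mat" where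
  "weight_operator U s V \<epsilon> Z =
     (let H = (\<lambda>i j. inverse (max (nth_default 0 s i) \<epsilon> * max (nth_default 0 s j) \<epsilon>));
          Y = transpose_mat U * Z * V
      in U * Matrix.mat (dim_row Z) (dim_col Z) (\<lambda>(i, j). H i j * Y $$ (i, j))
           * transpose_mat V)"

definition is_weight_operator :: "real mat \<Rightarrow> real \<Rightarrow> (real mat \<Rightarrow> real mat) \<Rightarrow> bool" where
  "is_weight_operator X \<epsilon> W \<longleftrightarrow> (\<exists>U s V. full_svd X U s V \<and> W = weight_operator U s V \<epsilon>)"

text \<open>
  \<open>matrix_irls d1 d2 \<Omega> y rt X eps W n\<close>: the sequences \<open>X\<close>, \<open>eps\<close>, \<open>W\<close> record a run of MatrixIRLS
  in which the first \<open>n\<close> iterations are carried out. Iteration \<open>k\<close> uses \<open>W (k - 1)\<close> and hence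
  requires \<open>eps (k - 1) > 0\<close>. The value \<open>X 0\<close> and all values beyond index \<open>n\<close> are irrelevant.
\<close>

definition matrix_irls ::
    "nat \<Rightarrow> nat \<Rightarrow> (nat \<times> nat) list \<Rightarrow> real Matrix.vec \<Rightarrow> nat \<Rightarrow>
     (nat \<Rightarrow> real mat) \<Rightarrow> (nat \<Rightarrow> ereal) \<Rightarrow> (nat \<Rightarrow> real mat \<Rightarrow> real mat) \<Rightarrow> nat \<Rightarrow> bool" where
  "matrix_irls d1 d2 \<Omega> y rt X eps W n \<longleftrightarrow>
     eps 0 = \<infinity> \<and> W 0 = id \<and>
     (\<forall>k\<in>{1..n}.
        0 < eps (k - 1) \<and>
        is_arg_min (\<lambda>Z. frob_inner Z (W (k - 1) Z))
          (\<lambda>Z. Z \<in> carrier_mat d1 d2 \<and> subsample \<Omega> Z = y) (X k) \<and>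
        eps k = min (eps (k - 1)) (ereal (singular_value (rt + 1) (X k))) \<and>
        (0 < eps k \<longrightarrow> is_weight_operator (X k) (real_of_ereal (eps k)) (W k)))"

end

theory Submission
  imports Defs
begin

text \<open>
  Let \<open>T\<close> be the tangent space at \<open>X\<^sub>0\<close> and let \<open>p\<^sub>l\<close> be the projection of the basis matrix at
  position \<open>l\<close> to \<open>T\<close>. No matrix concentration inequality is needed to control the sampling on
  \<open>T\<close>: for independent positions, the randomised Kaczmarz iteration
  \<open>f \<mapsto> f - \<eta> f\<^sub>l p\<^sub>l\<close> contracts the expected squared norm of every \<open>f \<in> T\<close> by the factor
  \<open>1 - \<eta> / (d\<^sub>1 d\<^sub>2)\<close>. Summing over the \<open>p\<^sub>l\<close> bounds the Hilbert--Schmidt norm of the composed map,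
  so with high probability it is a contraction of \<open>T\<close>, and this is impossible unless the sampled
  entries of each \<open>f \<in> T\<close> carry a fixed part of its norm. The null space property that
  follows is monotone in the set of positions, hence sampling without replacement is only better;
  repeated positions cost one factor \<open>log D\<close>.

  For one step, write everything in the singular bases of \<open>X\<^sub>k\<close>, where the weights are entrywise
  and equal to \<open>\<epsilon>\<^sub>k\<^sup>-\<^sup>2\<close> on the block of indices beyond \<open>r\<close>. The null space property, moved from \<open>T\<close>
  to the tangent space at \<open>X\<^sub>k\<close>, bounds the error \<open>X\<^sub>k\<^sub>+\<^sub>1 - X\<^sub>0\<close> by its tail block, and the
  optimality condition bounds this block by \<open>\<epsilon>\<^sub>k\<^sup>2\<close>, \<open>\<epsilon>\<^sub>k \<parallel>X\<^sub>k - X\<^sub>0\<parallel>\<close> and the tail block of \<open>X\<^sub>0\<close>, which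
  are all of second order. Applied to \<open>X\<^sub>k - X\<^sub>0\<close> itself, the null space property bounds the error
  by a multiple of \<open>\<epsilon>\<^sub>k\<close>; under the stronger assumption the next error is therefore below \<open>\<epsilon>\<^sub>k\<close>, so
  the smoothing parameter keeps following \<open>\<sigma>\<^sub>r\<^sub>+\<^sub>1\<close> and the bound can be iterated.
\<close>

text \<open>The Kaczmarz argument controls a Hilbert-Schmidt norm and thereby loses a factor up to
  \<open>d1 * d2\<close>; the logarithm in the lower bound on \<open>m\<close> pays for it, since it
  makes the expected contraction at most \<open>1 / D ^ 5\<close>. The null space constant is
  \<open>q = d * ln D / (100 * \<mu>0 * r)\<close>. One step uses the null space property twice, to
  recover the error from its tail block and again inside the bound of that block, so the rate is a
  multiple of \<open>q * sqrt r / \<sigma>r\<close>. This is below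
  \<open>d * ln D / (\<mu>0 * \<sigma>r)\<close>; the condition number enters only as slack, through
  \<open>\<kappa> \<ge> 1\<close>. The obstacle in a step is that the previous error is known in
  spectral norm, whereas the null space property speaks of Frobenius norms. A conversion for the
  whole error would cost \<open>sqrt d\<close>; therefore only blocks with \<open>r\<close> rows or
  columns, or products through dimension \<open>r\<close>, are converted, at the cost of
  \<open>sqrt r\<close>. The good event depends only on the positions and on the tangent space at
  \<open>X0\<close>, so it serves all runs and all \<open>k\<close> at once. The constants are C =
  10000, c1 = 1/2 and c2 = 1.\<close>

subsection \<open>Sampling with and without replacement\<close>

text \<open>Expectation over \<open>k\<close> independent uniform draws, written as iterated finite
  averages so that conditioning on the first draw is the recursion itself.\<close>

primrec iid_avg :: "'a set \<Rightarrow> nat \<Rightarrow> ('a list \<Rightarrow> real) \<Rightarrow> real" where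
  "iid_avg A 0 F = F []"
| "iid_avg A (Suc k) F = (\<Sum>a\<in>A. iid_avg A k (\<lambda>ls. F (a # ls))) / real (card A)"

text \<open>The corresponding expectation for \<open>k\<close> further draws without replacement
  after \<open>S\<close>. Only the set of draws is kept, since the event of interest depends on
  nothing else.\<close>

primrec wor_avg :: "'a set \<Rightarrow> nat \<Rightarrow> ('a set \<Rightarrow> real) \<Rightarrow> 'a set \<Rightarrow> real" where
  "wor_avg A 0 B S = B S"
| "wor_avg A (Suc k) B S = (\<Sum>a\<in>A - S. wor_avg A k B (insert a S)) / real (card (A - S))"

lemma iid_avg_mono:
  assumes "\<And>ls. set ls \<subseteq> A \<Longrightarrow> F ls \<le> G ls"
  shows "iid_avg A k F \<le> iid_avg A k G"
  using assms
proof (induction k arbitrary: F G)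
  case (Suc k)
  have "iid_avg A k (\<lambda>ls. F (a # ls)) \<le> iid_avg A k (\<lambda>ls. G (a # ls))" if "a \<in> A" for a
    by (rule Suc.IH) (use Suc.prems that in auto)
  then show ?case by (auto intro!: divide_right_mono sum_mono)
qed auto

lemma iid_avg_add: "iid_avg A k (\<lambda>ls. F ls + G ls) = iid_avg A k F + iid_avg A k G"
  by (induction k arbitrary: F G) (auto simp: sum.distrib add_divide_distrib)

lemma iid_avg_cmult: "iid_avg A k (\<lambda>ls. c * F ls) = c * iid_avg A k F"
  by (induction k arbitrary: F) (auto simp: sum_distrib_left)

lemma iid_avg_sum: "iid_avg A k (\<lambda>ls. \<Sum>b\<in>I. F b ls) = (\<Sum>b\<in>I. iid_avg A k (F b))"
proof (induction k arbitrary: F)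
  case (Suc k)
  have "(\<Sum>a\<in>A. iid_avg A k (\<lambda>ls. \<Sum>b\<in>I. F b (a # ls))) 
      = (\<Sum>a\<in>A. \<Sum>b\<in>I. iid_avg A k (\<lambda>ls. F b (a # ls)))"
    using Suc by simp
  also have "\<dots> = (\<Sum>b\<in>I. \<Sum>a\<in>A. iid_avg A k (\<lambda>ls. F b (a # ls)))" by (rule sum.swap)
  finally show ?case by (simp add: sum_divide_distrib)
qed auto

text \<open>An additional draw can only enlarge the drawn set, and \<open>B\<close> is
  antitone.\<close>

lemma wor_avg_Suc_le:
  assumes "finite A" "S \<subseteq> A" "card S + Suc k \<le> card A"
    and anti: "\<And>S S'. S \<subseteq> S' \<Longrightarrow> B S' \<le> B S"
  shows "wor_avg A (Suc k) B S \<le> wor_avg A k B S"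
  using assms(2,3)
proof (induction k arbitrary: S)
  case 0
  have c: "card (A - S) > 0"
    using 0 assms(1) by (simp add: card_Diff_subset finite_subset)
  have "(\<Sum>a\<in>A - S. B (insert a S)) \<le> (\<Sum>a\<in>A - S. B S)"
    by (intro sum_mono anti) auto
  then show ?case using c by (simp add: divide_le_eq field_simps)
next
  case (Suc k)
  have "wor_avg A (Suc k) B (insert a S) \<le> wor_avg A k B (insert a S)" if "a \<in> A - S" for a
    using that Suc.prems assms(1) by (intro Suc.IH) (auto simp: card_insert_if finite_subset)
  then have "(\<Sum>a\<in>A - S. wor_avg A (Suc k) B (insert a S)) / real (card (A - S)) 
     \<le> (\<Sum>a\<in>A - S. wor_avg A k B (insert a S)) / real (card (A - S))"
    by (intro divide_right_mono sum_mono) auto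
  then show ?case by (simp only: wor_avg.simps)
qed

text \<open>An independent draw hits \<open>S\<close> with probability
  \<open>card S / card A\<close> and then changes nothing, which amounts to doing one draw fewer;
  otherwise it is a fresh draw. Losing draws can only increase the average of the antitone
  \<open>B\<close>.\<close>

lemma wor_avg_le_iid_avg:
  assumes fin: "finite A" and "S \<subseteq> A" "card S + k \<le> card A"
    and anti: "\<And>S S'. S \<subseteq> S' \<Longrightarrow> B S' \<le> B S"
  shows "wor_avg A k B S \<le> iid_avg A k (\<lambda>ls. B (S \<union> set ls))"
  using assms(2,3)
proof (induction k arbitrary: S)
  case (Suc k)
  have finS: "finite S" using Suc.prems fin finite_subset by blast
  have c: "card (A - S) > 0" and cA: "card (A - S) = card A - card S" "card S \<le> card A"
    using Suc.prems fin finS by (auto simp: card_Diff_subset)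
  have ins: "wor_avg A k B (insert a S) \<le> iid_avg A k (\<lambda>ls. B (insert a S \<union> set ls))"
    if "a \<in> A" for a
  proof (cases "a \<in> S")
    case True
    then show ?thesis using Suc.IH[of S] Suc.prems by (simp add: insert_absorb)
  next
    case False
    then show ?thesis using that Suc.prems finS by (intro Suc.IH) auto
  qed
  define V where "V = wor_avg A (Suc k) B S"
  have V1: "(\<Sum>a\<in>A - S. wor_avg A k B (insert a S)) = real (card (A - S)) * V"
    using c by (simp add: V_def)
  have V2: "V \<le> wor_avg A k B S"
    unfolding V_def using Suc.prems fin anti by (intro wor_avg_Suc_le) auto
  \<comment> \<open>The two outcomes of the next independent draw are weighed here:
    \<open>V2\<close> treats a repetition, \<open>V1\<close> a fresh position.\<close>
  have "real (card A) * V = real (card S) * V + real (card (A - S)) * V"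
    using cA by (simp add: of_nat_diff algebra_simps)
  also have "\<dots> \<le> real (card S) * wor_avg A k B S + (\<Sum>a\<in>A - S. wor_avg A k B (insert a S))"
    using V1 V2 by (simp add: mult_left_mono)
  also have "\<dots> = (\<Sum>a\<in>S. wor_avg A k B (insert a S)) + (\<Sum>a\<in>A - S. wor_avg A k B (insert a S))"
    by (simp add: insert_absorb)
  also have "\<dots> = (\<Sum>a\<in>A. wor_avg A k B (insert a S))"
    using Suc.prems fin by (subst sum.subset_diff[of S A]) auto
  also have "\<dots> \<le> (\<Sum>a\<in>A. iid_avg A k (\<lambda>ls. B (insert a S \<union> set ls)))"
    using ins by (rule sum_mono)
  finally have "real (card A) * V \<le> (\<Sum>a\<in>A. iid_avg A k (\<lambda>ls. B (S \<union> set (a # ls))))"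
    by (simp)
  moreover have "card A > 0" using Suc.prems by auto
  ultimately show ?case unfolding V_def[symmetric] by (simp add: field_simps)
qed auto

text \<open>Every admissible first position has the same number of completions, so choosing a
  distinct list uniformly is the same as drawing one position after the other.\<close>

lemma sum_distinct_lists_wor_avg:
  assumes fin: "finite A" and "S \<subseteq> A" "card S + k \<le> card A"
  shows "(\<Sum>ls\<in>{ls. length ls = k \<and> distinct ls \<and> set ls \<subseteq> A - S}. B (S \<union> set ls)) =
    real (card {ls. length ls = k \<and> distinct ls \<and> set ls \<subseteq> A - S}) * wor_avg A k B S"
  using assms(2,3)
proof (induction k arbitrary: S)
  case 0
  have "{ls. length ls = 0 \<and> distinct ls \<and> set ls \<subseteq> A - S} = {[]}" by auto
  then show ?case by simp
next
  case (Suc k)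
  let ?L = "\<lambda>k S. {ls. length ls = k \<and> distinct ls \<and> set ls \<subseteq> A - S}"
  have finS: "finite S" using Suc.prems fin finite_subset by blast
  have finL: "finite (?L k S)" for k S
    by (rule finite_subset[OF _ finite_lists_length_eq[of A k]]) (use fin in auto)
  have split: "?L (Suc k) S = (\<Union>a\<in>A - S. (#) a ` ?L k (insert a S))"
  proof (rule Set.set_eqI, rule iffI)
    fix ls assume "ls \<in> ?L (Suc k) S"
    then show "ls \<in> (\<Union>a\<in>A - S. (#) a ` ?L k (insert a S))" by (cases ls) auto
  qed auto
  have sumsplit: "(\<Sum>ls\<in>?L (Suc k) S. F ls) = (\<Sum>a\<in>A - S. \<Sum>ls\<in>?L k (insert a S). F (a # ls))"
    for F :: "'a list \<Rightarrow> real"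
    unfolding split using fin finL
    by (subst sum.UNION_disjoint) (auto intro!: sum.cong simp: sum.reindex inj_on_def)
  \<comment> \<open>\<open>n\<close> counts the distinct lists of length \<open>k\<close> that avoid
    \<open>S\<close> and one further position; it does not depend on that position.\<close>
  define n where "n = real (\<Prod>{card A - card S - Suc k + 1..card A - card S - 1})"
  have cn: "real (card (?L k (insert a S))) = n" if "a \<in> A - S" for a
  proof -
    have "card (A - insert a S) = card A - card S - 1"
      using that Suc.prems finS fin by (subst card_Diff_subset) auto
    then show ?thesis using Suc.prems fin unfolding n_def
      by (subst card_lists_distinct_length_eq) auto
  qed
  have cA: "card (A - S) > 0" using Suc.prems fin finS by (auto simp: card_Diff_subset)
  have cL: "real (card (?L (Suc k) S)) = real (card (A - S)) * n"
    using sumsplit[of "\<lambda>_. 1"] cn by simp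
  have "(\<Sum>ls\<in>?L (Suc k) S. B (S \<union> set ls)) 
     = (\<Sum>a\<in>A - S. \<Sum>ls\<in>?L k (insert a S). B (insert a S \<union> set ls))"
    unfolding sumsplit by simp
  also have "\<dots> = (\<Sum>a\<in>A - S. n * wor_avg A k B (insert a S))"
  proof (rule sum.cong)
    fix a assume a: "a \<in> A - S"
    show "(\<Sum>ls\<in>?L k (insert a S). B (insert a S \<union> set ls)) = n * wor_avg A k B (insert a S)"
      using Suc.IH[of "insert a S"] a Suc.prems finS cn[OF a] by simp
  qed simp
  also have "\<dots> = n * (\<Sum>a\<in>A - S. wor_avg A k B (insert a S))" by (simp add: sum_distrib_left)
  also have "\<dots> = real (card (?L (Suc k) S)) * wor_avg A (Suc k) B S"
    using cL cA by simp
  finally show ?case .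
qed

text \<open>By \<open>anti\<close>, enlarging a good set of positions keeps it good; hence the
  repetitions in independent draws can only do harm.\<close>

lemma prob_distinct_lists_le_iid_avg:
  assumes fin: "finite A" and m: "m \<le> card A"
    and anti: "\<And>S S'. S \<subseteq> S' \<Longrightarrow> bad S' \<Longrightarrow> bad S"
  shows "measure_pmf.prob (pmf_of_set {ls. length ls = m \<and> distinct ls \<and> set ls \<subseteq> A})
      {ls. bad (set ls)} \<le> iid_avg A m (\<lambda>ls. of_bool (bad (set ls)))"
proof -
  let ?L = "{ls. length ls = m \<and> distinct ls \<and> set ls \<subseteq> A}"
  have finL: "finite ?L"
    by (rule finite_subset[OF _ finite_lists_length_eq[of A m]]) (use fin in auto)
  have cL: "card ?L > 0"
    using fin m by (subst card_lists_distinct_length_eq) auto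
  then have ne: "?L \<noteq> {}" by force
  have "real (card (?L \<inter> {ls. bad (set ls)})) = (\<Sum>ls\<in>?L. of_bool (bad (set ls)))"
    using finL by (simp add: Int_def)
  also have "\<dots> = real (card ?L) * wor_avg A m (\<lambda>S. of_bool (bad S)) {}"
    using sum_distinct_lists_wor_avg[OF fin, of "{}" m "\<lambda>S. of_bool (bad S)"] m by simp
  finally have "measure_pmf.prob (pmf_of_set ?L) {ls. bad (set ls)} 
      = wor_avg A m (\<lambda>S. of_bool (bad S)) {}"
    using measure_pmf_of_set[OF ne finL] cL by simp
  also have "\<dots> \<le> iid_avg A m (\<lambda>ls. of_bool (bad ({} \<union> set ls)))"
    using fin m by (intro wor_avg_le_iid_avg) (auto dest: anti)
  finally show ?thesis by simp
qed

subsection \<open>The randomised Kaczmarz iteration\<close>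

lemma sum_list_eq_sum_count:
  fixes g :: "'a \<Rightarrow> real"
  assumes "finite X" "set ls \<subseteq> X"
  shows "(\<Sum>l\<leftarrow>ls. g l) = (\<Sum>l\<in>X. real (count_list ls l) * g l)"
  using assms(2)
proof (induction ls)
  case (Cons a ls)
  have "(\<Sum>l\<in>X. real (count_list (a # ls) l) * g l)
      = (\<Sum>l\<in>X. real (count_list ls l) * g l + (if l = a then g l else 0))"
    by (intro sum.cong) (auto simp: algebra_simps)
  then show ?case using Cons assms(1) by (simp add: sum.distrib)
qed simp

text \<open>\<open>p\<close> is the matrix of an orthogonal projection on the functions on
  \<open>A\<close>. In the application \<open>A\<close> is the set of matrix positions and
  \<open>p a\<close> is the basis matrix at \<open>a\<close>, projected to the tangent
  space.\<close>

locale projection_kernel =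
  fixes A :: "'a set" and p :: "'a \<Rightarrow> 'a \<Rightarrow> real"
  assumes fin: "finite A" and ne: "A \<noteq> {}"
    and sym: "\<And>a b. a \<in> A \<Longrightarrow> b \<in> A \<Longrightarrow> p a b = p b a"
    and idem: "\<And>a b. a \<in> A \<Longrightarrow> b \<in> A \<Longrightarrow> (\<Sum>c\<in>A. p a c * p c b) = p a b"
begin

definition fixed :: "('a \<Rightarrow> real) \<Rightarrow> bool" where
  "fixed f \<longleftrightarrow> (\<forall>a\<in>A. (\<Sum>b\<in>A. p a b * f b) = f a)"

definition nsq :: "('a \<Rightarrow> real) \<Rightarrow> real" where
  "nsq f = (\<Sum>a\<in>A. (f a)\<^sup>2)"

text \<open>On the range of the projection, \<open>f l\<close> is the inner product of
  \<open>f\<close> with \<open>p l\<close>. The step is therefore gradient descent for half the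
  square of the entry at \<open>l\<close>, carried out within the range.\<close>

definition kz_step :: "real \<Rightarrow> 'a \<Rightarrow> ('a \<Rightarrow> real) \<Rightarrow> 'a \<Rightarrow> real" where
  "kz_step \<eta> l f = (\<lambda>b. f b - \<eta> * f l * p l b)"

primrec kz :: "real \<Rightarrow> 'a list \<Rightarrow> ('a \<Rightarrow> real) \<Rightarrow> 'a \<Rightarrow> real" where
  "kz \<eta> [] f = f"
| "kz \<eta> (l # ls) f = kz \<eta> ls (kz_step \<eta> l f)"

text \<open>Up to the factor \<open>\<eta>\<close>, this is what the iteration started at
  \<open>f\<close> takes away from the inner product with a fixed \<open>g\<close>: each sampled
  entry of \<open>g\<close> is paired with that entry of the current iterate.\<close>

primrec kz_cross :: "real \<Rightarrow> 'a list \<Rightarrow> ('a \<Rightarrow> real) \<Rightarrow> ('a \<Rightarrow> real) \<Rightarrow> real" where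
  "kz_cross \<eta> [] g f = 0"
| "kz_cross \<eta> (l # ls) g f = g l * f l + kz_cross \<eta> ls g (kz_step \<eta> l f)"

text \<open>Up to the factor \<open>\<eta>\<close>, a lower bound for the total decrease of
  \<open>nsq\<close> along the iteration.\<close>

primrec kz_energy :: "real \<Rightarrow> 'a list \<Rightarrow> ('a \<Rightarrow> real) \<Rightarrow> real" where
  "kz_energy \<eta> [] f = 0"
| "kz_energy \<eta> (l # ls) f = (f l)\<^sup>2 + kz_energy \<eta> ls (kz_step \<eta> l f)"

lemma nsq_nonneg: "nsq f \<ge> 0"
  by (auto simp: nsq_def sum_nonneg)

lemma fixed_inner:
  assumes "fixed f" "l \<in> A"
  shows "(\<Sum>b\<in>A. f b * p l b) = f l"
  using assms by (simp add: fixed_def mult.commute)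

lemma fixed_kernel:
  assumes "a \<in> A"
  shows "fixed (p a)"
  unfolding fixed_def
proof
  fix b assume b: "b \<in> A"
  have "(\<Sum>c\<in>A. p b c * p a c) = (\<Sum>c\<in>A. p b c * p c a)"
    using assms sym by (intro sum.cong) auto
  then show "(\<Sum>c\<in>A. p b c * p a c) = p a b" by (metis assms b sym idem)
qed

lemma fixed_kz_step:
  assumes "fixed f" "l \<in> A"
  shows "fixed (kz_step \<eta> l f)"
proof -
  have "(\<Sum>b\<in>A. p a b * kz_step \<eta> l f b) = kz_step \<eta> l f a" if "a \<in> A" for a
  proof -
    have "(\<Sum>b\<in>A. p a b * kz_step \<eta> l f b) 
       = (\<Sum>b\<in>A. p a b * f b) - \<eta> * f l * (\<Sum>b\<in>A. p a b * p l b)"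
      by (simp add: kz_step_def algebra_simps sum_subtractf sum_distrib_left)
    also have "(\<Sum>b\<in>A. p a b * f b) = f a" using assms that by (auto simp: fixed_def)
    also have "(\<Sum>b\<in>A. p a b * p l b) = p l a"
      using fixed_kernel[OF assms(2)] that unfolding fixed_def by auto
    finally show ?thesis by (simp add: kz_step_def)
  qed
  then show ?thesis by (auto simp: fixed_def)
qed

lemma kernel_diag: "a \<in> A \<Longrightarrow> nsq (p a) = p a a"
  unfolding nsq_def using idem[of a a] sym by (simp add: power2_eq_square cong: sum.cong)

text \<open>The diagonal entry is the squared norm of its own row and hence bounds its own
  square.\<close>

lemma kernel_diag_le_1:
  assumes "a \<in> A"
  shows "0 \<le> p a a" "p a a \<le> 1"
proof -
  have "(p a a)\<^sup>2 \<le> nsq (p a)"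
    unfolding nsq_def using assms fin by (intro member_le_sum) auto
  then have *: "(p a a)\<^sup>2 \<le> p a a" using kernel_diag[OF assms] by simp
  then show "0 \<le> p a a" by (smt (verit) zero_le_power2)
  show "p a a \<le> 1"
  proof (rule ccontr)
    assume "\<not> p a a \<le> 1"
    then have "p a a * 1 < p a a * p a a" by (intro mult_strict_left_mono) auto
    then show False using * by (simp add: power2_eq_square)
  qed
qed

text \<open>Since \<open>nsq (p l)\<close> is \<open>p l l\<close>, the condition on
  \<open>\<eta>\<close> makes the second order term of the expanded square at most half of the first
  order gain.\<close>

lemma nsq_kz_step_le:
  assumes "fixed f" "l \<in> A" "0 \<le> \<eta>" "\<eta> * p l l \<le> 1"
  shows "nsq (kz_step \<eta> l f) \<le> nsq f - \<eta> * (f l)\<^sup>2"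
proof -
  have "nsq (kz_step \<eta> l f) 
     = nsq f - 2 * \<eta> * f l * (\<Sum>b\<in>A. f b * p l b) + (\<eta> * f l)\<^sup>2 * nsq (p l)"
    unfolding nsq_def kz_step_def
    by (simp add: power2_diff sum.distrib sum_subtractf sum_distrib_left power_mult_distrib algebra_simps)
  also have "\<dots> = nsq f - 2 * \<eta> * (f l)\<^sup>2 + \<eta> * (f l)\<^sup>2 * (\<eta> * p l l)"
    using assms by (simp add: fixed_inner kernel_diag power2_eq_square algebra_simps)
  also have "\<eta> * (f l)\<^sup>2 * (\<eta> * p l l) \<le> \<eta> * (f l)\<^sup>2 * 1"
    using assms by (intro mult_left_mono) auto
  finally show ?thesis by simp
qed

lemma nsq_kz_le:
  assumes "fixed f" "set ls \<subseteq> A" "0 \<le> \<eta>" "\<And>l. l \<in> A \<Longrightarrow> \<eta> * p l l \<le> 1"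
  shows "nsq (kz \<eta> ls f) + \<eta> * kz_energy \<eta> ls f \<le> nsq f"
  using assms(1,2)
proof (induction ls arbitrary: f)
  case (Cons l ls)
  have "nsq (kz \<eta> ls (kz_step \<eta> l f)) + \<eta> * kz_energy \<eta> ls (kz_step \<eta> l f) \<le> nsq (kz_step \<eta> l f)"
    using Cons by (intro Cons.IH fixed_kz_step) auto
  also have "\<dots> \<le> nsq f - \<eta> * (f l)\<^sup>2"
    using Cons.prems assms(3,4) by (intro nsq_kz_step_le) auto
  finally show ?case by (simp add: algebra_simps)
qed simp

lemma inner_kz:
  assumes "fixed g" "set ls \<subseteq> A"
  shows "(\<Sum>b\<in>A. g b * kz \<eta> ls f b) = (\<Sum>b\<in>A. g b * f b) - \<eta> * kz_cross \<eta> ls g f"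
  using assms(2)
proof (induction ls arbitrary: f)
  case (Cons l ls)
  have "(\<Sum>b\<in>A. g b * kz_step \<eta> l f b) = (\<Sum>b\<in>A. g b * f b) - \<eta> * f l * (\<Sum>b\<in>A. g b * p l b)"
    by (simp add: kz_step_def algebra_simps sum_subtractf sum_distrib_left)
  also have "(\<Sum>b\<in>A. g b * p l b) = g l" using assms Cons.prems by (intro fixed_inner) auto
  finally show ?case using Cons by (simp add: algebra_simps)
qed simp

lemma kz_energy_nonneg: "kz_energy \<eta> ls f \<ge> 0"
  by (induction ls arbitrary: f) auto

text \<open>Cauchy-Schwarz along the sampled list. Induction is used because the second sequence of
  entries comes from a changing iterate.\<close>

lemma kz_cross_le: "(kz_cross \<eta> ls g f)\<^sup>2 \<le> (\<Sum>l\<leftarrow>ls. (g l)\<^sup>2) * kz_energy \<eta> ls f"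
proof (induction ls arbitrary: f)
  case (Cons l ls)
  define c a b where "c = kz_cross \<eta> ls g (kz_step \<eta> l f)" and "a = (\<Sum>l\<leftarrow>ls. (g l)\<^sup>2)"
    and "b = kz_energy \<eta> ls (kz_step \<eta> l f)"
  have c: "c\<^sup>2 \<le> a * b" using Cons unfolding c_def a_def b_def .
  have ab: "a \<ge> 0" "b \<ge> 0" unfolding a_def b_def by (auto intro!: sum_list_nonneg kz_energy_nonneg)
  have "\<bar>c\<bar> \<le> sqrt a * sqrt b" using real_sqrt_le_mono[OF c] by (simp add: real_sqrt_mult)
  then have "2 * (\<bar>g l\<bar> * \<bar>f l\<bar> * \<bar>c\<bar>) \<le> 2 * (\<bar>g l\<bar> * \<bar>f l\<bar> * (sqrt a * sqrt b))"
    by (intro mult_left_mono) auto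
  also have "\<dots> \<le> (\<bar>g l\<bar> * sqrt b)\<^sup>2 + (\<bar>f l\<bar> * sqrt a)\<^sup>2"
    using sum_squares_bound[of "\<bar>g l\<bar> * sqrt b" "\<bar>f l\<bar> * sqrt a"] by (simp add: algebra_simps)
  also have "\<dots> = (g l)\<^sup>2 * b + (f l)\<^sup>2 * a" using ab by (simp add: power_mult_distrib)
  finally have "2 * (g l * f l * c) \<le> (g l)\<^sup>2 * b + (f l)\<^sup>2 * a"
    using abs_ge_self[of "g l * f l * c"] by (simp add: abs_mult)
  then have "(g l * f l + c)\<^sup>2 \<le> ((g l)\<^sup>2 + a) * ((f l)\<^sup>2 + b)"
    using c by (simp add: power2_sum power_mult_distrib algebra_simps)
  then show ?case by (simp add: a_def b_def c_def)
qed simp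

lemma kz_cong:
  assumes "\<And>b. b \<in> A \<Longrightarrow> f b = g b" "set ls \<subseteq> A" "b \<in> A"
  shows "kz \<eta> ls f b = kz \<eta> ls g b"
  using assms
proof (induction ls arbitrary: f g)
  case (Cons l ls)
  show ?case unfolding kz.simps by (rule Cons.IH) (use Cons.prems in \<open>auto simp: kz_step_def\<close>)
qed auto

lemma kz_linear:
  "kz \<eta> ls (\<lambda>b. \<Sum>a\<in>I. w a * F a b) = (\<lambda>b. \<Sum>a\<in>I. w a * kz \<eta> ls (F a) b)"
proof (induction ls arbitrary: F)
  case (Cons l ls)
  have "kz_step \<eta> l (\<lambda>b. \<Sum>a\<in>I. w a * F a b) = (\<lambda>b. \<Sum>a\<in>I. w a * kz_step \<eta> l (F a) b)"
    by (auto simp: kz_step_def algebra_simps sum_subtractf sum_distrib_left)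
  then show ?case using Cons by simp
qed simp

text \<open>The operator norm is bounded by the Hilbert-Schmidt norm: \<open>f\<close> is its own
  expansion in the kernels \<open>p a\<close>, and the iteration is linear. Unlike the operator
  norm, the sum on the right can be averaged term by term.\<close>

lemma nsq_kz_le_trace:
  assumes "fixed f" "set ls \<subseteq> A"
  shows "nsq (kz \<eta> ls f) \<le> nsq f * (\<Sum>a\<in>A. nsq (kz \<eta> ls (p a)))"
proof -
  have "kz \<eta> ls f b = (\<Sum>a\<in>A. f a * kz \<eta> ls (p a) b)" if "b \<in> A" for b
  proof -
    have "kz \<eta> ls f b = kz \<eta> ls (\<lambda>b. \<Sum>a\<in>A. f a * p a b) b"
      using assms that fixed_inner sym by (intro kz_cong) (auto cong: sum.cong)
    then show ?thesis by (simp add: kz_linear)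
  qed
  then have "nsq (kz \<eta> ls f) = (\<Sum>b\<in>A. (\<Sum>a\<in>A. f a * kz \<eta> ls (p a) b)\<^sup>2)"
    by (simp add: nsq_def)
  also have "\<dots> \<le> (\<Sum>b\<in>A. nsq f * (\<Sum>a\<in>A. (kz \<eta> ls (p a) b)\<^sup>2))"
    unfolding nsq_def by (intro sum_mono Cauchy_Schwarz_ineq_sum)
  also have "\<dots> = nsq f * (\<Sum>a\<in>A. nsq (kz \<eta> ls (p a)))"
    unfolding nsq_def sum_distrib_left[symmetric] by (subst sum.swap) simp
  finally show ?thesis .
qed

text \<open>If the iteration has contracted the whole range of the projection, then
  \<open>\<langle>f, kz f\<rangle>\<close> is small, so the sampled entries of \<open>f\<close> must have accounted for \<open>\<parallel>f\<parallel>\<^sup>2\<close>.\<close>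

lemma fixed_le_sampled:
  assumes f: "fixed f" and ls: "set ls \<subseteq> A" and \<eta>: "0 < \<eta>" "\<And>l. l \<in> A \<Longrightarrow> \<eta> * p l l \<le> 1"
    and tr: "(\<Sum>a\<in>A. nsq (kz \<eta> ls (p a))) \<le> 1 / 4"
    and K: "\<And>l. l \<in> A \<Longrightarrow> real (count_list ls l) \<le> K"
  shows "nsq f \<le> 4 * \<eta> * K * (\<Sum>l\<in>set ls. (f l)\<^sup>2)"
proof -
  define F where "F = (\<Sum>l\<leftarrow>ls. (f l)\<^sup>2)"
  define n where "n = sqrt (nsq f)"
  have n: "n \<ge> 0" "n\<^sup>2 = nsq f" using nsq_nonneg by (auto simp: n_def)
  have F0: "F \<ge> 0" unfolding F_def by (auto intro!: sum_list_nonneg)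
  have "F = (\<Sum>l\<in>set ls. real (count_list ls l) * (f l)\<^sup>2)"
    unfolding F_def by (rule sum_list_eq_sum_count) auto
  also have "\<dots> \<le> (\<Sum>l\<in>set ls. K * (f l)\<^sup>2)"
    using ls K by (intro sum_mono mult_right_mono) auto
  finally have FK: "F \<le> K * (\<Sum>l\<in>set ls. (f l)\<^sup>2)" by (simp add: sum_distrib_left)
  \<comment> \<open>The trace bound \<open>1 / 4\<close> makes the iteration a contraction by
    \<open>1 / 2\<close> in norm, so at most half of the squared norm survives in the inner product
    with \<open>f\<close>.\<close>
  have "nsq (kz \<eta> ls f) \<le> nsq f * (1 / 4)"
    using nsq_kz_le_trace[OF f ls, of \<eta>] mult_left_mono[OF tr nsq_nonneg[of f]] by simp
  moreover have "(\<Sum>b\<in>A. f b * kz \<eta> ls f b)\<^sup>2 \<le> nsq f * nsq (kz \<eta> ls f)"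
    unfolding nsq_def by (rule Cauchy_Schwarz_ineq_sum)
  ultimately have "(\<Sum>b\<in>A. f b * kz \<eta> ls f b)\<^sup>2 \<le> nsq f * (nsq f * (1 / 4))"
    by (meson mult_left_mono nsq_nonneg order_trans)
  also have "\<dots> = (n\<^sup>2 / 2)\<^sup>2" using n by (simp add: power2_eq_square)
  finally have 1: "(\<Sum>b\<in>A. f b * kz \<eta> ls f b) \<le> n\<^sup>2 / 2"
    using power2_le_imp_le[of _ "n\<^sup>2 / 2"] by auto
  have "(\<Sum>b\<in>A. f b * kz \<eta> ls f b) = n\<^sup>2 - \<eta> * kz_cross \<eta> ls f f"
    using inner_kz[OF f ls, of \<eta> f] n by (simp add: nsq_def power2_eq_square)
  with 1 have 2: "n\<^sup>2 / 2 \<le> \<eta> * kz_cross \<eta> ls f f" by linarith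
  have "\<eta> * kz_energy \<eta> ls f \<le> nsq f"
    using nsq_kz_le[OF f ls _ \<eta>(2)] \<eta>(1) nsq_nonneg[of "kz \<eta> ls f"] by simp
  then have e: "\<eta> * kz_energy \<eta> ls f \<le> n\<^sup>2" using n by simp
  \<comment> \<open>Cauchy-Schwarz separates the sampled entries of \<open>f\<close> from the energy
    of the iterates. The energy is already limited by the initial norm, and one factor
    \<open>nsq f\<close> cancels.\<close>
  have "(n\<^sup>2 / 2)\<^sup>2 \<le> (\<eta> * kz_cross \<eta> ls f f)\<^sup>2" using 2 by (intro power_mono) auto
  also have "\<dots> \<le> \<eta>\<^sup>2 * (F * kz_energy \<eta> ls f)"
    unfolding power_mult_distrib F_def by (intro mult_left_mono kz_cross_le) auto
  also have "\<dots> = (\<eta> * F) * (\<eta> * kz_energy \<eta> ls f)" by (simp add: power2_eq_square)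
  also have "\<dots> \<le> (\<eta> * F) * n\<^sup>2" using e F0 \<eta>(1) by (intro mult_left_mono) auto
  finally have *: "n\<^sup>2 * n\<^sup>2 \<le> (4 * \<eta> * F) * n\<^sup>2" by (simp add: power2_eq_square field_simps)
  have "n\<^sup>2 \<le> 4 * \<eta> * F"
  proof (cases "n = 0")
    case False
    then show ?thesis using mult_right_le_imp_le[OF *] by simp
  qed (use F0 \<eta>(1) in auto)
  also have "\<dots> \<le> 4 * \<eta> * (K * (\<Sum>l\<in>set ls. (f l)\<^sup>2))" using FK \<eta>(1) by (intro mult_left_mono) auto
  finally show ?thesis using n by (simp add: algebra_simps)
qed

text \<open>A quantitative form of the statement that no nonzero element of the range vanishes on
  \<open>S\<close>. With \<open>P\<close> the projection, \<open>q\<close> bounds the ratio of the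
  squared norms of \<open>P h\<close> and \<open>h - P h\<close>; adding the latter gives
  \<open>1 + q\<close>.\<close>

definition null_space_bound :: "real \<Rightarrow> 'a set \<Rightarrow> bool" where
  "null_space_bound q S \<longleftrightarrow> (\<forall>h. (\<forall>a\<in>S. h a = 0) \<longrightarrow>
     nsq h \<le> (1 + q) * nsq (\<lambda>a. h a - (\<Sum>b\<in>A. p a b * h b)))"

lemma null_space_bound_mono: "S \<subseteq> S' \<Longrightarrow> null_space_bound q S \<Longrightarrow> null_space_bound q S'"
  by (auto simp: null_space_bound_def)

text \<open>On the sampled positions \<open>h\<close> vanishes, so there its component in the range
  is the negative of its orthogonal component. The sampled entries that control the former are thus
  entries of the latter.\<close>

lemma null_space_boundI:
  assumes ls: "set ls \<subseteq> A" and \<eta>: "0 < \<eta>" "\<And>l. l \<in> A \<Longrightarrow> \<eta> * p l l \<le> 1" and K0: "K \<ge> 0"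
    and tr: "(\<Sum>a\<in>A. nsq (kz \<eta> ls (p a))) \<le> 1 / 4"
    and K: "\<And>l. l \<in> A \<Longrightarrow> real (count_list ls l) \<le> K"
  shows "null_space_bound (4 * \<eta> * K) (set ls)"
  unfolding null_space_bound_def
proof (intro allI impI)
  fix h :: "'a \<Rightarrow> real" assume h: "\<forall>a\<in>set ls. h a = 0"
  define f where "f = (\<lambda>a. \<Sum>b\<in>A. p a b * h b)"
  define g where "g = (\<lambda>a. h a - f a)"
  have f: "fixed f"
    unfolding fixed_def
  proof
    fix a assume a: "a \<in> A"
    have "(\<Sum>b\<in>A. p a b * f b) = (\<Sum>b\<in>A. \<Sum>c\<in>A. p a b * p b c * h c)"
      by (simp add: f_def sum_distrib_left mult.assoc)
    also have "\<dots> = (\<Sum>c\<in>A. (\<Sum>b\<in>A. p a b * p b c) * h c)"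
      by (subst sum.swap) (simp add: sum_distrib_right)
    finally show "(\<Sum>b\<in>A. p a b * f b) = f a" using idem a by (simp add: f_def)
  qed
  have orth: "(\<Sum>a\<in>A. f a * g a) = 0"
  proof -
    have "(\<Sum>a\<in>A. f a * h a) = (\<Sum>a\<in>A. (\<Sum>b\<in>A. f b * p a b) * h a)"
      using f by (simp add: fixed_inner)
    also have "\<dots> = (\<Sum>a\<in>A. \<Sum>b\<in>A. f b * p a b * h a)" by (simp add: sum_distrib_right)
    also have "\<dots> = (\<Sum>b\<in>A. \<Sum>a\<in>A. f b * p a b * h a)" by (rule sum.swap)
    also have "\<dots> = (\<Sum>b\<in>A. f b * f b)"
      unfolding f_def by (auto simp: sum_distrib_left sym mult.assoc intro!: sum.cong)
    finally show ?thesis by (simp add: g_def algebra_simps sum_subtractf)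
  qed
  have hfg: "nsq h = nsq f + nsq g"
  proof -
    have "nsq h = (\<Sum>a\<in>A. (f a + g a)\<^sup>2)" by (simp add: nsq_def g_def)
    also have "\<dots> = nsq f + nsq g + 2 * (\<Sum>a\<in>A. f a * g a)"
      by (simp add: nsq_def power2_sum sum.distrib sum_distrib_left mult.assoc)
    finally show ?thesis using orth by simp
  qed
  have "nsq f \<le> 4 * \<eta> * K * (\<Sum>l\<in>set ls. (f l)\<^sup>2)"
    using f ls \<eta> tr K by (rule fixed_le_sampled)
  also have "(\<Sum>l\<in>set ls. (f l)\<^sup>2) = (\<Sum>l\<in>set ls. (g l)\<^sup>2)"
    using h by (auto simp: g_def)
  also have "4 * \<eta> * K * (\<Sum>l\<in>set ls. (g l)\<^sup>2) \<le> 4 * \<eta> * K * nsq g"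
    unfolding nsq_def using ls fin \<eta> K0 by (intro mult_left_mono sum_mono2) auto
  finally show "nsq h \<le> (1 + 4 * \<eta> * K) * nsq (\<lambda>a. h a - (\<Sum>b\<in>A. p a b * h b))"
    using hfg by (simp add: algebra_simps g_def f_def)
qed

text \<open>Over a uniform \<open>l\<close> the decrease \<open>\<eta> * (f l)^2\<close> averages to
  \<open>\<eta> / card A\<close> times the whole squared norm, whatever the current iterate
  is.\<close>

lemma iid_avg_nsq_kz:
  assumes f: "fixed f" and \<eta>: "0 \<le> \<eta>" "\<And>l. l \<in> A \<Longrightarrow> \<eta> * p l l \<le> 1" "\<eta> \<le> real (card A)"
  shows "iid_avg A k (\<lambda>ls. nsq (kz \<eta> ls f)) \<le> (1 - \<eta> / real (card A)) ^ k * nsq f"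
  using f
proof (induction k arbitrary: f)
  case (Suc k)
  let ?N = "real (card A)" and ?c = "1 - \<eta> / real (card A)"
  have N: "?N > 0" using fin ne by (simp add: card_gt_0_iff)
  have c: "?c \<ge> 0" using \<eta> N by simp
  have "(\<Sum>a\<in>A. iid_avg A k (\<lambda>ls. nsq (kz \<eta> ls (kz_step \<eta> a f))))
     \<le> (\<Sum>a\<in>A. ?c ^ k * (nsq f - \<eta> * (f a)\<^sup>2))"
  proof (rule sum_mono)
    fix a assume a: "a \<in> A"
    have "iid_avg A k (\<lambda>ls. nsq (kz \<eta> ls (kz_step \<eta> a f))) \<le> ?c ^ k * nsq (kz_step \<eta> a f)"
      using Suc.prems a by (intro Suc.IH fixed_kz_step)
    also have "\<dots> \<le> ?c ^ k * (nsq f - \<eta> * (f a)\<^sup>2)"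
      using Suc.prems a \<eta> c by (intro mult_left_mono nsq_kz_step_le) auto
    finally show "iid_avg A k (\<lambda>ls. nsq (kz \<eta> ls (kz_step \<eta> a f))) \<le> ?c ^ k * (nsq f - \<eta> * (f a)\<^sup>2)" .
  qed
  also have "\<dots> = ?c ^ k * (?N * nsq f - \<eta> * nsq f)"
    by (simp add: nsq_def sum_distrib_left[symmetric] sum_subtractf)
  also have "\<dots> = ?N * (?c ^ Suc k * nsq f)" using N by (simp add: field_simps)
  finally show ?case using N by (simp add: pos_divide_le_eq mult.commute)
qed simp

text \<open>The moment generating function at 1 of the multiplicity of \<open>l\<close>, a binomial
  variable; it feeds a Chernoff bound for repeated positions.\<close>

lemma iid_avg_exp_count:
  assumes "l \<in> A"
  shows "iid_avg A k (\<lambda>ls. exp (real (count_list ls l))) = (1 + (exp 1 - 1) / real (card A)) ^ k"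
proof (induction k)
  case (Suc k)
  let ?N = "real (card A)" and ?c = "1 + (exp 1 - 1) / real (card A)"
  have N: "?N > 0" using fin ne by (simp add: card_gt_0_iff)
  have "iid_avg A k (\<lambda>ls. exp (real (count_list (a # ls) l))) = (if a = l then exp 1 else 1) * ?c ^ k"
    for a
    using Suc by (auto simp: exp_add iid_avg_cmult)
  then have "iid_avg A (Suc k) (\<lambda>ls. exp (real (count_list ls l)))
      = (\<Sum>a\<in>A. (if a = l then exp 1 else 1)) * ?c ^ k / ?N"
    by (simp add: sum_distrib_right)
  also have "(\<Sum>a\<in>A. (if a = l then exp 1 else 1 :: real)) = (\<Sum>a\<in>A. 1 + (if a = l then exp 1 - 1 else 0))"
    by (intro sum.cong) auto
  also have "\<dots> = ?N * ?c" using fin ne assms N by (simp only: sum.distrib) (simp add: distrib_left)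
  finally show ?case using N by simp
qed simp

theorem prob_null_space_bound:
  assumes m: "m \<le> card A" and \<eta>: "0 < \<eta>" "\<And>l. l \<in> A \<Longrightarrow> \<eta> * p l l \<le> 1" "\<eta> \<le> real (card A)"
    and K0: "K \<ge> 0"
  shows "measure_pmf.prob (pmf_of_set {ls. length ls = m \<and> distinct ls \<and> set ls \<subseteq> A})
      {ls. \<not> null_space_bound (4 * \<eta> * K) (set ls)}
    \<le> 4 * real (card A) * exp (- (\<eta> * real m / real (card A))) + real (card A) * exp (2 - K)"
proof -
  let ?N = "real (card A)" and ?bad = "\<lambda>S. \<not> null_space_bound (4 * \<eta> * K) S"
  have N: "?N > 0" using fin ne by (simp add: card_gt_0_iff)
  \<comment> \<open>Markov bounds for the two ways to fail: \<open>?F\<close> exceeds 1 when the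
    iteration has not contracted enough, \<open>?G\<close> when some position occurs more than
    \<open>K\<close> times.\<close>
  let ?F = "\<lambda>ls. 4 * (\<Sum>a\<in>A. nsq (kz \<eta> ls (p a)))"
  let ?G = "\<lambda>ls. exp (- K) * (\<Sum>l\<in>A. exp (real (count_list ls l)))"
  have "measure_pmf.prob (pmf_of_set {ls. length ls = m \<and> distinct ls \<and> set ls \<subseteq> A}) {ls. ?bad (set ls)}
     \<le> iid_avg A m (\<lambda>ls. of_bool (?bad (set ls)))"
    using fin m null_space_bound_mono by (intro prob_distinct_lists_le_iid_avg) blast+
  also have "\<dots> \<le> iid_avg A m (\<lambda>ls. ?F ls + ?G ls)"
  proof (rule iid_avg_mono)
    fix ls assume ls: "set ls \<subseteq> A"
    have F: "?F ls \<ge> 0" by (simp add: sum_nonneg nsq_nonneg)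
    have G: "?G ls \<ge> 0" by (simp add: sum_nonneg)
    consider "(\<Sum>a\<in>A. nsq (kz \<eta> ls (p a))) > 1 / 4" | l where "l \<in> A" "real (count_list ls l) > K"
      | "null_space_bound (4 * \<eta> * K) (set ls)"
      using null_space_boundI[OF ls \<eta>(1,2) K0] by force
    then show "of_bool (?bad (set ls)) \<le> ?F ls + ?G ls"
    proof cases
      case 1
      then show ?thesis using G by (auto simp: of_bool_def)
    next
      case 2
      have "1 \<le> exp (- K) * exp (real (count_list ls l))" using 2 by (simp flip: exp_add)
      also have "\<dots> \<le> ?G ls"
        using 2 fin by (intro mult_left_mono member_le_sum) auto
      finally show ?thesis using F by (auto simp: of_bool_def)
    qed (use F G in auto)
  qed
  also have "\<dots> = 4 * (\<Sum>a\<in>A. iid_avg A m (\<lambda>ls. nsq (kz \<eta> ls (p a)))) 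
     + exp (- K) * (\<Sum>l\<in>A. iid_avg A m (\<lambda>ls. exp (real (count_list ls l))))"
    by (simp add: iid_avg_add iid_avg_cmult iid_avg_sum)
  also have "(\<Sum>a\<in>A. iid_avg A m (\<lambda>ls. nsq (kz \<eta> ls (p a)))) 
      \<le> (\<Sum>a\<in>A. exp (- (\<eta> * real m / ?N)))"
  proof (rule sum_mono)
    fix a assume a: "a \<in> A"
    have "iid_avg A m (\<lambda>ls. nsq (kz \<eta> ls (p a))) \<le> (1 - \<eta> / ?N) ^ m * nsq (p a)"
      using \<eta> a fixed_kernel by (intro iid_avg_nsq_kz) auto
    also have "\<dots> \<le> (1 - \<eta> / ?N) ^ m * 1"
      using \<eta> N a kernel_diag_le_1 by (intro mult_left_mono) (auto simp: kernel_diag)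
    also have "(1 - \<eta> / ?N) ^ m \<le> exp (- (\<eta> / ?N)) ^ m"
      using \<eta> N exp_ge_add_one_self[of "- (\<eta> / ?N)"] by (intro power_mono) auto
    also have "exp (- (\<eta> / ?N)) ^ m = exp (- (\<eta> * real m / ?N))"
      by (simp flip: exp_of_nat_mult add: mult.commute)
    finally show "iid_avg A m (\<lambda>ls. nsq (kz \<eta> ls (p a))) \<le> exp (- (\<eta> * real m / ?N))" by simp
  qed
  also have "(\<Sum>l\<in>A. iid_avg A m (\<lambda>ls. exp (real (count_list ls l)))) \<le> (\<Sum>l\<in>A. exp 2)"
  proof (rule sum_mono)
    fix l assume l: "l \<in> A"
    have e: "exp 1 \<le> (3 :: real)" by (rule exp_le)
    have "iid_avg A m (\<lambda>ls. exp (real (count_list ls l))) = (1 + (exp 1 - 1) / ?N) ^ m"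
      by (rule iid_avg_exp_count[OF l])
    also have "\<dots> \<le> exp ((exp 1 - 1) / ?N) ^ m"
      using exp_ge_add_one_self[of "(exp 1 - 1) / ?N"] N by (intro power_mono) (auto intro!: add_nonneg_nonneg divide_nonneg_nonneg)
    also have "\<dots> = exp (real m / ?N * (exp 1 - 1))" by (simp flip: exp_of_nat_mult add: mult.commute)
    also have "\<dots> \<le> exp 2"
    proof -
      \<comment> \<open>There are at most \<open>card A\<close> draws, so the mean multiplicity of a
        position is at most 1.\<close>
      have "real m / ?N * (exp 1 - 1) \<le> 1 * 2" using m N e by (intro mult_mono) auto
      then show ?thesis by simp
    qed
    finally show "iid_avg A m (\<lambda>ls. exp (real (count_list ls l))) \<le> exp 2" .
  qed
  finally show ?thesis by (simp add: exp_diff exp_minus field_simps)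
qed

end

text \<open>Column vectors are matrices with one column, and that dimension is to stay
  \<open>1\<close>.\<close>

declare One_nat_def [simp del]

subsection \<open>Frobenius norm and operator bounds\<close>

lemma mult_index:
  assumes "A \<in> carrier_mat n k" "B \<in> carrier_mat k m" "i < n" "j < m"
  shows "(A * B) $$ (i, j) = (\<Sum>l<k. A $$ (i, l) * B $$ (l, j))"
  using assms by (auto simp: scalar_prod_def atLeast0LessThan intro!: sum.cong)

lemma assoc_mult_dim:
  fixes A :: "'a :: semiring_0 mat"
  shows "dim_col A = dim_row B \<Longrightarrow> dim_col B = dim_row C \<Longrightarrow> A * B * C = A * (B * C)"
  by (rule assoc_mult_mat[of _ "dim_row A" "dim_col A" _ "dim_col B" _ "dim_col C"])
    (intro carrier_matI; simp)+

lemma sum_lessThan_1 [simp]: "(\<Sum>j<1::nat. f j) = f 0"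
  by (simp add: One_nat_def)

lemma add_minus_cancel_mat:
  fixes A :: "real mat"
  shows "A \<in> carrier_mat n m \<Longrightarrow> B \<in> carrier_mat n m \<Longrightarrow> B + (A - B) = A"
  by (intro eq_matI) auto

lemma frob_inner_carrier:
  "A \<in> carrier_mat n m \<Longrightarrow> frob_inner A B = (\<Sum>i<n. \<Sum>j<m. A $$ (i, j) * B $$ (i, j))"
  by (auto simp: frob_inner_def)

lemma frob_norm_L2:
  assumes "A \<in> carrier_mat n m"
  shows "frob_norm A = L2_set (\<lambda>p. A $$ p) ({..<n} \<times> {..<m})"
  using assms unfolding frob_norm_def L2_set_def frob_inner_carrier[OF assms]
  by (simp add: sum.cartesian_product power2_eq_square)

lemma frob_norm_sq:
  assumes "A \<in> carrier_mat n m"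
  shows "(frob_norm A)\<^sup>2 = (\<Sum>i<n. \<Sum>j<m. (A $$ (i, j))\<^sup>2)"
proof -
  have "frob_inner A A \<ge> 0" by (simp add: frob_inner_def sum_nonneg)
  then show ?thesis using assms by (simp add: frob_norm_def frob_inner_carrier power2_eq_square)
qed

lemma frob_norm_sq_inner: "(frob_norm A)\<^sup>2 = frob_inner A A"
proof -
  have "frob_inner A A \<ge> 0" by (simp add: frob_inner_def sum_nonneg)
  then show ?thesis by (simp add: frob_norm_def)
qed

lemma frob_norm_nonneg [simp]: "0 \<le> frob_norm A"
  by (simp add: frob_norm_def frob_inner_def sum_nonneg)

lemma frob_norm_triangle:
  assumes "A \<in> carrier_mat n m" "B \<in> carrier_mat n m"
  shows "frob_norm (A + B) \<le> frob_norm A + frob_norm B"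
proof -
  have "frob_norm (A + B) = L2_set (\<lambda>p. A $$ p + B $$ p) ({..<n} \<times> {..<m})"
    using assms by (subst frob_norm_L2[of _ n m]) (auto intro!: L2_set_cong)
  also have "\<dots> \<le> frob_norm A + frob_norm B"
    using assms by (simp add: frob_norm_L2 L2_set_triangle_ineq)
  finally show ?thesis .
qed

lemma frob_norm_smult:
  assumes "A \<in> carrier_mat n m"
  shows "frob_norm (c \<cdot>\<^sub>m A) = \<bar>c\<bar> * frob_norm A"
proof -
  have "frob_inner (c \<cdot>\<^sub>m A) (c \<cdot>\<^sub>m A) = c\<^sup>2 * frob_inner A A"
    using assms by (auto simp: frob_inner_def sum_distrib_left power2_eq_square mult_ac intro!: sum.cong)
  then show ?thesis by (simp add: frob_norm_def real_sqrt_mult)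
qed

lemma frob_norm_le:
  assumes "A \<in> carrier_mat n m" "B \<in> carrier_mat n m" "0 \<le> c"
    and "\<And>i j. i < n \<Longrightarrow> j < m \<Longrightarrow> \<bar>A $$ (i, j)\<bar> \<le> c * \<bar>B $$ (i, j)\<bar>"
  shows "frob_norm A \<le> c * frob_norm B"
proof -
  have "(frob_norm A)\<^sup>2 \<le> (\<Sum>i<n. \<Sum>j<m. (c * \<bar>B $$ (i, j)\<bar>)\<^sup>2)"
    unfolding frob_norm_sq[OF assms(1)]
  proof (intro sum_mono)
    fix i j assume "i \<in> {..<n}" "j \<in> {..<m}"
    then show "(A $$ (i, j))\<^sup>2 \<le> (c * \<bar>B $$ (i, j)\<bar>)\<^sup>2"
      using power_mono[OF assms(4)[of i j], of 2] by simp
  qed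
  also have "\<dots> = (c * frob_norm B)\<^sup>2"
    by (simp add: power_mult_distrib frob_norm_sq[OF assms(2)] sum_distrib_left)
  finally show ?thesis by (rule power2_le_imp_le) (use assms(3) in simp)
qed

lemma frob_norm_ge:
  assumes "A \<in> carrier_mat n m" "B \<in> carrier_mat n m" "0 \<le> c"
    and "\<And>i j. i < n \<Longrightarrow> j < m \<Longrightarrow> c * \<bar>B $$ (i, j)\<bar> \<le> \<bar>A $$ (i, j)\<bar>"
  shows "c * frob_norm B \<le> frob_norm A"
proof -
  have "frob_norm (c \<cdot>\<^sub>m B) \<le> 1 * frob_norm A"
    using assms by (intro frob_norm_le[of _ n m]) (auto simp: abs_mult)
  then show ?thesis using assms by (simp add: frob_norm_smult)
qed

lemma frob_norm_uminus:
  "A \<in> carrier_mat n m \<Longrightarrow> frob_norm (- A) = frob_norm (A :: real mat)"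
  by (auto simp: frob_norm_def frob_inner_def intro!: sum.cong)

lemma frob_norm_triangle_minus:
  assumes "A \<in> carrier_mat n m" "B \<in> carrier_mat n m"
  shows "frob_norm (A - B) \<le> frob_norm A + frob_norm B"
proof -
  have "A - B = A + - B" using assms by auto
  then show ?thesis using frob_norm_triangle[of A n m "- B"] assms by (simp add: frob_norm_uminus)
qed

lemma frob_inner_le:
  assumes "A \<in> carrier_mat n m" "B \<in> carrier_mat n m"
  shows "\<bar>frob_inner A B\<bar> \<le> frob_norm A * frob_norm B"
proof -
  have "\<bar>frob_inner A B\<bar> \<le> (\<Sum>p\<in>{..<n} \<times> {..<m}. \<bar>A $$ p\<bar> * \<bar>B $$ p\<bar>)"
    unfolding frob_inner_carrier[OF assms(1)]
    by (simp add: sum.cartesian_product abs_mult[symmetric] split_def sum_abs)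
  also have "\<dots> \<le> frob_norm A * frob_norm B"
    using assms by (simp add: frob_norm_L2 L2_set_mult_ineq)
  finally show ?thesis .
qed

lemma frob_norm_transpose: "frob_norm (transpose_mat A) = frob_norm A"
proof -
  have "frob_inner (transpose_mat A) (transpose_mat A) = frob_inner A A"
    unfolding frob_inner_def by (subst sum.swap) auto
  then show ?thesis by (simp add: frob_norm_def)
qed

lemma frob_inner_adjoint:
  assumes A: "A \<in> carrier_mat n k" and B: "B \<in> carrier_mat k m" and C: "C \<in> carrier_mat n m"
  shows "frob_inner (A * B) C = frob_inner B (transpose_mat A * C)"
proof -
  have "frob_inner (A * B) C = (\<Sum>i<n. \<Sum>j<m. \<Sum>l<k. A $$ (i, l) * B $$ (l, j) * C $$ (i, j))"
    using assms by (subst frob_inner_carrier[of _ n m])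
      (auto simp: mult_index[OF A B] sum_distrib_right simp del: index_mult_mat(1))
  also have "\<dots> = (\<Sum>i<n. \<Sum>l<k. \<Sum>j<m. A $$ (i, l) * B $$ (l, j) * C $$ (i, j))"
    by (intro sum.cong refl sum.swap)
  also have "\<dots> = (\<Sum>l<k. \<Sum>i<n. \<Sum>j<m. A $$ (i, l) * B $$ (l, j) * C $$ (i, j))"
    by (rule sum.swap)
  also have "\<dots> = (\<Sum>l<k. \<Sum>j<m. \<Sum>i<n. A $$ (i, l) * B $$ (l, j) * C $$ (i, j))"
    by (intro sum.cong refl sum.swap)
  also have "\<dots> = (\<Sum>l<k. \<Sum>j<m. B $$ (l, j) * (transpose_mat A * C) $$ (l, j))"
    using A C by (intro sum.cong refl)
      (auto simp: mult_index[of "transpose_mat A" k n C m] sum_distrib_left mult_ac simp del: index_mult_mat(1)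
        intro!: sum.cong)
  also have "\<dots> = frob_inner B (transpose_mat A * C)" using B by (simp add: frob_inner_carrier)
  finally show ?thesis .
qed

text \<open>This says that the spectral norm of \<open>A\<close> is at most \<open>c\<close>,
  without reference to singular values. Testing on matrices \<open>Z\<close> with any number of
  columns directly yields the bounds of products that mix spectral and Frobenius norms.\<close>

definition op_bound :: "real mat \<Rightarrow> real \<Rightarrow> bool" where
  "op_bound A c \<longleftrightarrow> 0 \<le> c \<and>
     (\<forall>k. \<forall>Z\<in>carrier_mat (dim_col A) k. frob_norm (A * Z) \<le> c * frob_norm Z)"

lemma op_boundD:
  "op_bound A c \<Longrightarrow> A \<in> carrier_mat n m \<Longrightarrow> Z \<in> carrier_mat m k \<Longrightarrow> frob_norm (A * Z) \<le> c * frob_norm Z"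
  by (auto simp: op_bound_def)

lemma op_bound_nonneg: "op_bound A c \<Longrightarrow> 0 \<le> c"
  by (simp add: op_bound_def)

lemma op_boundI:
  assumes "A \<in> carrier_mat n m" "0 \<le> c"
    and "\<And>k Z. Z \<in> carrier_mat m k \<Longrightarrow> frob_norm (A * Z) \<le> c * frob_norm Z"
  shows "op_bound A c"
  using assms by (auto simp: op_bound_def)

lemma op_bound_mono: "op_bound A c \<Longrightarrow> c \<le> c' \<Longrightarrow> op_bound A c'"
  unfolding op_bound_def by (meson frob_norm_nonneg mult_right_mono order_trans)

text \<open>The squared norm of \<open>A^T Z\<close> is the inner product of \<open>Z\<close> with
  \<open>A A^T Z\<close>, which the bound for \<open>A\<close> estimates by \<open>c\<close> times
  the product of the norms of \<open>Z\<close> and \<open>A^T Z\<close>; one factor cancels.\<close>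

lemma op_bound_transpose:
  assumes "op_bound A c"
  shows "op_bound (transpose_mat A) c"
proof -
  define n m where "n = dim_row A" and "m = dim_col A"
  have A: "A \<in> carrier_mat n m" by (auto simp: n_def m_def)
  have c: "0 \<le> c" using assms by (rule op_bound_nonneg)
  show ?thesis
  proof (rule op_boundI[of _ m n])
    fix k and Z :: "real mat" assume Z: "Z \<in> carrier_mat n k"
    let ?Y = "transpose_mat A * Z"
    have Y: "?Y \<in> carrier_mat m k" using A Z by auto
    have "(frob_norm ?Y)\<^sup>2 = frob_inner Z (A * ?Y)"
      unfolding frob_norm_sq_inner using frob_inner_adjoint[of "transpose_mat A" m n Z k ?Y] A Z Y by simp
    also have "\<dots> \<le> frob_norm Z * frob_norm (A * ?Y)"
      using frob_inner_le[of Z n k "A * ?Y"] A Z Y by auto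
    also have "\<dots> \<le> frob_norm Z * (c * frob_norm ?Y)"
      using op_boundD[OF assms A Y] by (intro mult_left_mono) auto
    finally have *: "frob_norm ?Y * frob_norm ?Y \<le> (c * frob_norm Z) * frob_norm ?Y"
      by (simp add: power2_eq_square mult_ac)
    show "frob_norm ?Y \<le> c * frob_norm Z"
    proof (cases "frob_norm ?Y = 0")
      case False
      then have "frob_norm ?Y > 0" using frob_norm_nonneg[of ?Y] by linarith
      then show ?thesis using mult_right_le_imp_le[OF *] by simp
    qed (use c in auto)
  qed (use A c in auto)
qed

lemma op_bound_uminus:
  assumes "op_bound A c"
  shows "op_bound (- A) c"
proof (rule op_boundI[of _ "dim_row A" "dim_col A"])
  fix k and Z :: "real mat" assume Z: "Z \<in> carrier_mat (dim_col A) k"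
  have "- A * Z = - (A * Z)" using Z by simp
  moreover have "A * Z \<in> carrier_mat (dim_row A) k" using Z by (intro carrier_matI) auto
  ultimately show "frob_norm (- A * Z) \<le> c * frob_norm Z"
    using assms Z frob_norm_uminus[of "A * Z" "dim_row A" k] by (auto simp: op_bound_def)
qed (use assms op_bound_nonneg in auto)

lemma op_bound_minus_commute:
  assumes "A \<in> carrier_mat n m" "B \<in> carrier_mat n m" "op_bound (A - B) c"
  shows "op_bound (B - A) c"
proof -
  have "B - A = - (A - B)" using assms by auto
  then show ?thesis using op_bound_uminus[OF assms(3)] by simp
qed

lemma op_bound_right:
  assumes "op_bound A c" "A \<in> carrier_mat n m" "Z \<in> carrier_mat k n"
  shows "frob_norm (Z * A) \<le> c * frob_norm Z"
proof -
  have "frob_norm (Z * A) = frob_norm (transpose_mat A * transpose_mat Z)"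
    using assms by (subst frob_norm_transpose[symmetric]) (simp add: transpose_mult[of Z k n A m])
  also have "\<dots> \<le> c * frob_norm (transpose_mat Z)"
    using assms by (intro op_boundD[OF op_bound_transpose]) auto
  finally show ?thesis by (simp add: frob_norm_transpose)
qed

lemma op_bound_mult:
  assumes "op_bound A a" "op_bound B b" "A \<in> carrier_mat n m" "B \<in> carrier_mat m l"
  shows "op_bound (A * B) (a * b)"
proof (rule op_boundI[of _ n l])
  fix k and Z :: "real mat" assume Z: "Z \<in> carrier_mat l k"
  have "frob_norm (A * B * Z) = frob_norm (A * (B * Z))" using assms Z by (simp add: assoc_mult_mat[of A n m B l Z k])
  also have "\<dots> \<le> a * frob_norm (B * Z)" using assms Z by (intro op_boundD) auto
  also have "\<dots> \<le> a * (b * frob_norm Z)"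
    using assms Z by (intro mult_left_mono op_boundD op_bound_nonneg[of A]) auto
  finally show "frob_norm (A * B * Z) \<le> a * b * frob_norm Z" by simp
qed (use assms op_bound_nonneg in auto)

lemma op_bound_add:
  assumes "op_bound A a" "op_bound B b" "A \<in> carrier_mat n m" "B \<in> carrier_mat n m"
  shows "op_bound (A + B) (a + b)"
proof (rule op_boundI[of _ n m])
  fix k and Z :: "real mat" assume Z: "Z \<in> carrier_mat m k"
  have "frob_norm ((A + B) * Z) = frob_norm (A * Z + B * Z)"
    using assms Z by (simp add: add_mult_distrib_mat[of A n m B Z k])
  also have "\<dots> \<le> frob_norm (A * Z) + frob_norm (B * Z)"
    using assms Z by (intro frob_norm_triangle[of _ n k]) auto
  also have "\<dots> \<le> a * frob_norm Z + b * frob_norm Z"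
    using assms Z by (intro add_mono op_boundD) auto
  finally show "frob_norm ((A + B) * Z) \<le> (a + b) * frob_norm Z" by (simp add: algebra_simps)
qed (use assms op_bound_nonneg[of A a] op_bound_nonneg[of B b] in auto)

lemma frob_norm_isometry:
  assumes P: "P \<in> carrier_mat n k" "transpose_mat P * P = 1\<^sub>m k" and Z: "Z \<in> carrier_mat k m"
  shows "frob_norm (P * Z) = frob_norm Z"
proof -
  have "frob_inner (P * Z) (P * Z) = frob_inner Z (transpose_mat P * (P * Z))"
    using assms by (intro frob_inner_adjoint) auto
  also have "transpose_mat P * (P * Z) = transpose_mat P * P * Z"
    by (rule assoc_mult_dim[symmetric]) (use P(1) Z in auto)
  also have "\<dots> = Z"
    unfolding P(2) using Z by (rule left_mult_one_mat)
  finally show ?thesis by (simp add: frob_norm_def)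
qed

lemma op_bound_isometry:
  assumes P: "P \<in> carrier_mat n k" "transpose_mat P * P = 1\<^sub>m k"
  shows "op_bound P 1"
proof (rule op_boundI[OF P(1)])
  fix m and Z :: "real mat" assume "Z \<in> carrier_mat k m"
  then show "frob_norm (P * Z) \<le> 1 * frob_norm Z" using frob_norm_isometry[OF P, of Z m] by simp
qed simp

lemma frob_norm_isometry_right:
  assumes P: "P \<in> carrier_mat n k" "transpose_mat P * P = 1\<^sub>m k" and Z: "Z \<in> carrier_mat m k"
  shows "frob_norm (Z * transpose_mat P) = frob_norm Z"
proof -
  have "transpose_mat (Z * transpose_mat P) = transpose_mat (transpose_mat P) * transpose_mat Z"
    by (rule transpose_mult) (use P Z in auto)
  then have "frob_norm (Z * transpose_mat P) = frob_norm (P * transpose_mat Z)"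
    unfolding transpose_transpose by (metis frob_norm_transpose)
  then show ?thesis using assms frob_norm_isometry[OF P, of "transpose_mat Z" m] by (simp add: frob_norm_transpose)
qed

lemma orthogonal_transpose:
  fixes U :: "real mat"
  assumes "U \<in> carrier_mat n n" "transpose_mat U * U = 1\<^sub>m n"
  shows "U * transpose_mat U = 1\<^sub>m n"
  using mat_mult_left_right_inverse[of "transpose_mat U" n U] assms by auto

subsection \<open>Singular value decompositions and Weyl's inequality\<close>

text \<open>A thin decomposition with as many columns as listed values, zeros allowed. The compact
  decomposition and the truncated full one are both instances, so Weyl's inequality can compare a
  matrix given by one with a matrix given by the other.\<close>

definition orth_svd :: "nat \<Rightarrow> nat \<Rightarrow> real mat \<Rightarrow> real mat \<Rightarrow> real list \<Rightarrow> real mat \<Rightarrow> bool" where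
  "orth_svd n1 n2 X U s V \<longleftrightarrow>
     U \<in> carrier_mat n1 (length s) \<and> transpose_mat U * U = 1\<^sub>m (length s) \<and>
     V \<in> carrier_mat n2 (length s) \<and> transpose_mat V * V = 1\<^sub>m (length s) \<and>
     sorted_wrt (\<ge>) s \<and> (\<forall>x\<in>set s. 0 \<le> x) \<and>
     X = U * rect_diag (length s) (length s) s * transpose_mat V"

lemma rect_diag_carrier [simp]: "rect_diag n1 n2 s \<in> carrier_mat n1 n2"
  by (simp add: rect_diag_def)

lemma rect_diag_dim [simp]: "dim_row (rect_diag n1 n2 s) = n1" "dim_col (rect_diag n1 n2 s) = n2"
  by (simp_all add: rect_diag_def)

lemma rect_diag_mult_carrier [simp]: "B \<in> carrier_mat n2 m \<Longrightarrow> rect_diag n1 n2 s * B \<in> carrier_mat n1 m"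
  by (rule mult_carrier_mat[OF rect_diag_carrier])

lemma rect_diag_index:
  "i < n1 \<Longrightarrow> j < n2 \<Longrightarrow> rect_diag n1 n2 s $$ (i, j) = (if i = j then nth_default 0 s i else 0)"
  by (simp add: rect_diag_def)

lemma rect_diag_mult_index:
  assumes "Z \<in> carrier_mat n2 m" "i < n1" "j < m"
  shows "(rect_diag n1 n2 s * Z) $$ (i, j) = (if i < n2 then nth_default 0 s i * Z $$ (i, j) else 0)"
proof -
  have "(rect_diag n1 n2 s * Z) $$ (i, j) = (\<Sum>l<n2. rect_diag n1 n2 s $$ (i, l) * Z $$ (l, j))"
    using assms by (intro mult_index) auto
  also have "\<dots> = (\<Sum>l<n2. (if i = l then nth_default 0 s i * Z $$ (l, j) else 0))"
    using assms by (intro sum.cong) (auto simp: rect_diag_index)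
  finally have "(rect_diag n1 n2 s * Z) $$ (i, j)
    = (\<Sum>l<n2. (if i = l then nth_default 0 s i * Z $$ (l, j) else 0))" .
  then show ?thesis by simp
qed

lemma rect_diag_product_index:
  assumes U: "U \<in> carrier_mat n1 k1" and V: "V \<in> carrier_mat n2 k2"
    and s: "length s \<le> k1" "length s \<le> k2" and ab: "a < n1" "b < n2"
  shows "(U * rect_diag k1 k2 s * transpose_mat V) $$ (a, b)
     = (\<Sum>i<length s. U $$ (a, i) * nth_default 0 s i * V $$ (b, i))"
proof -
  have "(U * rect_diag k1 k2 s * transpose_mat V) $$ (a, b)
     = (U * (rect_diag k1 k2 s * transpose_mat V)) $$ (a, b)"
    using U V by (simp add: assoc_mult_dim)
  also have "\<dots> = (\<Sum>i<k1. U $$ (a, i) * (rect_diag k1 k2 s * transpose_mat V) $$ (i, b))"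
    using U V ab by (intro mult_index[of _ _ _ _ n2]) auto
  also have "\<dots> = (\<Sum>i<k1. U $$ (a, i) * (if i < k2 then nth_default 0 s i * V $$ (b, i) else 0))"
    using V ab by (intro sum.cong refl) (auto simp: rect_diag_mult_index[of _ k2 n2] simp del: index_mult_mat(1))
  also have "\<dots> = (\<Sum>i<length s. U $$ (a, i) * (if i < k2 then nth_default 0 s i * V $$ (b, i) else 0))"
    using s by (intro sum.mono_neutral_right) (auto simp: nth_default_beyond)
  also have "\<dots> = (\<Sum>i<length s. U $$ (a, i) * nth_default 0 s i * V $$ (b, i))"
    using s by (intro sum.cong) auto
  finally show ?thesis .
qed

lemma transpose_mult_one_iff:
  assumes "U \<in> carrier_mat n k"
  shows "transpose_mat U * U = 1\<^sub>m k \<longleftrightarrow>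
    (\<forall>i<k. \<forall>j<k. (\<Sum>a<n. U $$ (a, i) * U $$ (a, j)) = (if i = j then 1 else 0 :: real))"
proof -
  have e: "(transpose_mat U * U) $$ (i, j) = (\<Sum>a<n. U $$ (a, i) * U $$ (a, j))" if "i < k" "j < k" for i j
    using assms that by (subst mult_index[of _ k n _ k]) auto
  have "transpose_mat U * U = 1\<^sub>m k \<longleftrightarrow> (\<forall>i<k. \<forall>j<k. (transpose_mat U * U) $$ (i, j) = 1\<^sub>m k $$ (i, j))"
    using assms by (subst mat_eq_iff) auto
  then show ?thesis using e by (auto simp: simp del: index_mult_mat(1))
qed

text \<open>Only the first \<open>min n1 n2\<close> columns of the two orthogonal factors meet the
  diagonal.\<close>

lemma full_svd_imp_orth_svd:
  assumes "full_svd X U s V" "X \<in> carrier_mat n1 n2"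
  shows "orth_svd n1 n2 X (mat n1 (length s) (\<lambda>p. U $$ p)) s (mat n2 (length s) (\<lambda>p. V $$ p))"
proof -
  have s: "U \<in> carrier_mat n1 n1" "transpose_mat U * U = 1\<^sub>m n1"
    "V \<in> carrier_mat n2 n2" "transpose_mat V * V = 1\<^sub>m n2" "length s = min n1 n2" "sorted_wrt (\<ge>) s"
    "\<forall>x\<in>set s. 0 \<le> x" "X = U * rect_diag n1 n2 s * transpose_mat V"
    using assms by (auto simp: full_svd_def Let_def)
  let ?U = "mat n1 (length s) (\<lambda>p. U $$ p)" and ?V = "mat n2 (length s) (\<lambda>p. V $$ p)"
  have "transpose_mat ?U * ?U = 1\<^sub>m (length s)"
    using s(2,5) unfolding transpose_mult_one_iff[OF s(1)]
      transpose_mult_one_iff[OF mat_carrier[of n1 "length s" "\<lambda>p. U $$ p"]] by auto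
  moreover have "transpose_mat ?V * ?V = 1\<^sub>m (length s)"
    using s(4,5) unfolding transpose_mult_one_iff[OF s(3)]
      transpose_mult_one_iff[OF mat_carrier[of n2 "length s" "\<lambda>p. V $$ p"]] by auto
  moreover have "X = ?U * rect_diag (length s) (length s) s * transpose_mat ?V"
  proof (rule eq_matI)
    fix a b assume "a < dim_row (?U * rect_diag (length s) (length s) s * transpose_mat ?V)"
      "b < dim_col (?U * rect_diag (length s) (length s) s * transpose_mat ?V)"
    then have ab: "a < n1" "b < n2" by auto
    have "X $$ (a, b) = (U * rect_diag n1 n2 s * transpose_mat V) $$ (a, b)" using s(8) by simp
    also have "\<dots> = (\<Sum>i<length s. U $$ (a, i) * nth_default 0 s i * V $$ (b, i))"
      using s(1,3,5) ab by (intro rect_diag_product_index) auto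
    also have "\<dots> = (\<Sum>i<length s. ?U $$ (a, i) * nth_default 0 s i * ?V $$ (b, i))"
      using ab by (intro sum.cong) auto
    also have "\<dots> = (?U * rect_diag (length s) (length s) s * transpose_mat ?V) $$ (a, b)"
      using ab by (intro rect_diag_product_index[symmetric]) auto
    finally show "X $$ (a, b) = (?U * rect_diag (length s) (length s) s * transpose_mat ?V) $$ (a, b)" .
  qed (use assms in auto)
  ultimately show ?thesis using s by (auto simp: orth_svd_def)
qed

lemma compact_svd_imp_orth_svd:
  assumes "compact_svd X U s V" "X \<in> carrier_mat n1 n2"
  shows "orth_svd n1 n2 X U s V"
  using assms by (auto simp: orth_svd_def compact_svd_def Let_def order_less_imp_le)

text \<open>Zero rows fill \<open>B\<close> up to a square matrix, whose determinant vanishes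
  because of the zero row at index \<open>k\<close>.\<close>

lemma exists_kernel_vector:
  fixes B :: "real mat"
  assumes B: "B \<in> carrier_mat k n" and kn: "k < n"
  shows "\<exists>a\<in>carrier_mat n 1. frob_norm a > 0 \<and> B * a = 0\<^sub>m k 1"
proof -
  define C where "C = mat n n (\<lambda>(i, j). if i < k then B $$ (i, j) else 0)"
  have C: "C \<in> carrier_mat n n" by (simp add: C_def)
  have "det C = det (mat\<^sub>r n n (\<lambda>i. if i = k then 0\<^sub>v n else row C i))"
  proof (rule arg_cong[of _ _ det], rule eq_matI)
    fix i j assume "i < dim_row (mat\<^sub>r n n (\<lambda>i. if i = k then 0\<^sub>v n else row C i))"
      "j < dim_col (mat\<^sub>r n n (\<lambda>i. if i = k then 0\<^sub>v n else row C i))"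
    then show "C $$ (i, j) = mat\<^sub>r n n (\<lambda>i. if i = k then 0\<^sub>v n else row C i) $$ (i, j)"
      by (auto simp: C_def)
  qed (auto simp: C_def)
  also have "\<dots> = 0" using C by (intro det_row_0[OF kn]) auto
  finally obtain v where v: "v \<in> carrier_vec n" "v \<noteq> 0\<^sub>v n" "C *\<^sub>v v = 0\<^sub>v n"
    using det_0_iff_vec_prod_zero_field[OF C] by auto
  define a where "a = mat n 1 (\<lambda>(i, j). v $ i)"
  have a: "a \<in> carrier_mat n 1" by (simp add: a_def)
  have "B * a = 0\<^sub>m k 1"
  proof (rule eq_matI)
    fix i j assume "i < dim_row (0\<^sub>m k 1 :: real mat)" "j < dim_col (0\<^sub>m k 1 :: real mat)"
    then have i: "i < k" "j = 0" by auto
    have "(B * a) $$ (i, j) = (\<Sum>l<n. B $$ (i, l) * v $ l)"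
      using i B a by (subst mult_index[of B k n a 1]) (auto simp: a_def)
    also have "\<dots> = (\<Sum>l<n. C $$ (i, l) * v $ l)" using i kn by (auto simp: C_def)
    also have "\<dots> = (C *\<^sub>v v) $ i"
      using i kn C v(1) by (auto simp: scalar_prod_def atLeast0LessThan intro!: sum.cong)
    finally show "(B * a) $$ (i, j) = 0\<^sub>m k 1 $$ (i, j)" using i v kn by simp
  qed (use B a in auto)
  moreover have "frob_norm a > 0"
  proof (rule ccontr)
    assume "\<not> frob_norm a > 0"
    then have "frob_norm a = 0" using frob_norm_nonneg[of a] by linarith
    then have "(\<Sum>i<n. \<Sum>j<(1::nat). (a $$ (i, j))\<^sup>2) = 0" using frob_norm_sq[OF a] by simp
    then have "\<forall>i<n. v $ i = 0" by (auto simp: sum_nonneg_eq_0_iff sum_nonneg a_def)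
    then have "v = 0\<^sub>v n" using v(1) by auto
    then show False using v by simp
  qed
  ultimately show ?thesis using a by blast
qed

lemma orth_svd_apply:
  assumes X: "orth_svd n1 n2 X U s V" and Z: "Z \<in> carrier_mat n2 m"
  shows "frob_norm (X * Z) = frob_norm (rect_diag (length s) (length s) s * (transpose_mat V * Z))"
proof -
  let ?p = "length s" let ?S = "rect_diag ?p ?p s"
  note x = X[unfolded orth_svd_def]
  have VZ: "transpose_mat V * Z \<in> carrier_mat ?p m" using x Z by auto
  have UV: "U \<in> carrier_mat n1 ?p" "V \<in> carrier_mat n2 ?p" using x by auto
  have "U * ?S * transpose_mat V * Z = U * (?S * (transpose_mat V * Z))"
    using UV Z assoc_mult_mat[of "U * ?S" n1 ?p "transpose_mat V" n2 Z m]
      assoc_mult_mat[of U n1 ?p ?S ?p "transpose_mat V * Z" m] by simp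
  then have "X * Z = U * (?S * (transpose_mat V * Z))" using x by simp
  then show ?thesis using x VZ frob_norm_isometry[of U n1 ?p "?S * (transpose_mat V * Z)" m] by simp
qed

lemma nth_default_nonneg: "\<forall>x\<in>set s. 0 \<le> x \<Longrightarrow> 0 \<le> nth_default (0::real) s j"
  by (simp add: nth_default_def)

lemma nth_default_antimono:
  assumes "sorted_wrt (\<ge>) s" "\<forall>x\<in>set s. 0 \<le> x" "i \<le> j"
  shows "nth_default (0::real) s j \<le> nth_default 0 s i"
proof (cases "j < length s")
  case True
  then show ?thesis using assms sorted_wrt_nth_less[OF assms(1), of i j]
    by (cases "i = j") (auto simp: nth_default_nth)
qed (use assms in \<open>auto simp: nth_default_beyond nth_default_nonneg\<close>)

text \<open>The dimension count of Courant and Fischer: some nonzero combination of the first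
  \<open>j + 1\<close> right singular vectors of \<open>X\<close> is orthogonal to the first
  \<open>j\<close> of \<open>X'\<close>. On it \<open>X\<close> stretches by at least its value at
  \<open>j\<close>, and \<open>X'\<close> by at most its own.\<close>

lemma orth_svd_weyl:
  assumes X: "orth_svd n1 n2 X U s V" and X': "orth_svd n1 n2 X' U' s' V'"
    and \<delta>: "op_bound (X - X') \<delta>"
  shows "nth_default 0 s j \<le> nth_default 0 s' j + \<delta>"
proof (cases "j < length s")
  case False
  then show ?thesis using X' op_bound_nonneg[OF \<delta>]
    by (auto simp: orth_svd_def nth_default_beyond nth_default_nonneg)
next
  case j: True
  note x = X[unfolded orth_svd_def] and x' = X'[unfolded orth_svd_def]
  \<comment> \<open>\<open>X'\<close> may list fewer than \<open>j\<close> values; then there are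
    fewer orthogonality conditions, and its value at \<open>j\<close> is the default 0.\<close>
  define p p' k where "p = length s" and "p' = length s'" and "k = min j p'"
  have XC: "X \<in> carrier_mat n1 n2" "X' \<in> carrier_mat n1 n2" using x x' by auto
  define C where "C = mat k (Suc j) (\<lambda>p. (transpose_mat V' * V) $$ p)"
  have CC: "C \<in> carrier_mat k (Suc j)" by (simp add: C_def)
  have kj: "k < Suc j" by (simp add: k_def)
  obtain a where a: "a \<in> carrier_mat (Suc j) 1" "frob_norm a > 0" "C * a = 0\<^sub>m k 1"
    using exists_kernel_vector[OF CC kj] by blast
  define y where "y = mat p 1 (\<lambda>(i, l). if i \<le> j then a $$ (i, 0) else 0)"
  have y: "y \<in> carrier_mat p 1" by (simp add: y_def)
  have y0: "frob_norm y > 0"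
  proof -
    have "(frob_norm a)\<^sup>2 = (\<Sum>i<Suc j. (a $$ (i, 0))\<^sup>2)" using a by (simp only: frob_norm_sq[of _ "Suc j" 1] sum_lessThan_1)
    also have "\<dots> = (\<Sum>i<Suc j. (y $$ (i, 0))\<^sup>2)" using j by (intro sum.cong) (auto simp: y_def p_def)
    also have "\<dots> = (\<Sum>i<p. (y $$ (i, 0))\<^sup>2)"
      using j by (intro sum.mono_neutral_left) (auto simp: y_def p_def)
    also have "\<dots> = (frob_norm y)\<^sup>2" using y by (simp only: frob_norm_sq[of _ p 1] sum_lessThan_1)
    finally show ?thesis using a(2) frob_norm_nonneg[of y] by (metis less_eq_real_def power2_eq_iff_nonneg)
  qed
  let ?x = "V * y"
  have V: "V \<in> carrier_mat n2 p" "transpose_mat V * V = 1\<^sub>m p"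
    and V': "V' \<in> carrier_mat n2 p'" "transpose_mat V' * V' = 1\<^sub>m p'"
    using x x' by (auto simp: p_def p'_def)
  have xC: "?x \<in> carrier_mat n2 1" using V y by auto
  have nx: "frob_norm ?x = frob_norm y" using frob_norm_isometry[OF V y] .
  have "transpose_mat V * ?x = y"
    using V y by (subst assoc_mult_dim[symmetric]) auto
  then have Xx: "frob_norm (X * ?x) = frob_norm (rect_diag p p s * y)"
    using orth_svd_apply[OF X xC] by (simp add: p_def)
  have "nth_default 0 s j * frob_norm y \<le> frob_norm (rect_diag p p s * y)"
  proof (rule frob_norm_ge[of _ p 1])
    fix i l assume il: "i < p" "l < (1::nat)"
    show "nth_default 0 s j * \<bar>y $$ (i, l)\<bar> \<le> \<bar>(rect_diag p p s * y) $$ (i, l)\<bar>"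
    proof (cases "i \<le> j")
      case True
      then have "nth_default 0 s j \<le> nth_default 0 s i" using x by (intro nth_default_antimono) auto
      moreover have "0 \<le> nth_default 0 s i" using x by (intro nth_default_nonneg) auto
      ultimately show ?thesis using il y
        by (auto simp: rect_diag_mult_index[of _ p 1] abs_mult mult_right_mono simp del: index_mult_mat(1))
    qed (use il in \<open>auto simp: y_def\<close>)
  qed (use x y in \<open>auto simp: nth_default_nonneg\<close>)
  then have 1: "nth_default 0 s j * frob_norm y \<le> frob_norm (X * ?x)" using Xx by simp
  let ?z = "transpose_mat V' * ?x"
  have z: "?z \<in> carrier_mat p' 1" using V' xC by auto
  have z0: "?z $$ (l, 0) = 0" if "l < k" for l
  proof -
    have lp: "l < p'" using that by (simp add: k_def)
    have "?z $$ (l, 0) = ((transpose_mat V' * V) * y) $$ (l, 0)"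
      using V V' y by (simp add: assoc_mult_dim)
    also have "\<dots> = (\<Sum>i<p. (transpose_mat V' * V) $$ (l, i) * y $$ (i, 0))"
      using V V' y lp by (intro mult_index[of _ p']) auto
    also have "\<dots> = (\<Sum>i<Suc j. (transpose_mat V' * V) $$ (l, i) * y $$ (i, 0))"
      using j by (intro sum.mono_neutral_right) (auto simp: y_def p_def)
    also have "\<dots> = (\<Sum>i<Suc j. C $$ (l, i) * a $$ (i, 0))"
      using j that by (intro sum.cong) (auto simp: y_def p_def C_def)
    also have "\<dots> = (C * a) $$ (l, 0)"
      using that a by (intro mult_index[symmetric, of _ k _ _ 1]) (auto simp: C_def)
    finally show ?thesis using a(3) that by simp
  qed
  have "frob_norm (X' * ?x) = frob_norm (rect_diag p' p' s' * ?z)"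
    using orth_svd_apply[OF X' xC] by (simp add: p'_def)
  also have "\<dots> \<le> nth_default 0 s' j * frob_norm ?z"
  proof (rule frob_norm_le[of _ p' 1])
    fix i l assume il: "i < p'" "l < (1::nat)"
    show "\<bar>(rect_diag p' p' s' * ?z) $$ (i, l)\<bar> \<le> nth_default 0 s' j * \<bar>?z $$ (i, l)\<bar>"
    proof (cases "i < j")
      case True
      then have "?z $$ (i, l) = 0" using z0[of i] il by (auto simp: k_def)
      then show ?thesis using il z by (simp add: rect_diag_mult_index[of _ p' 1] del: index_mult_mat(1))
    next
      case False
      then have "nth_default 0 s' i \<le> nth_default 0 s' j" using x' by (intro nth_default_antimono) auto
      moreover have "0 \<le> nth_default 0 s' i" using x' by (intro nth_default_nonneg) auto
      ultimately show ?thesis using il z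
        by (auto simp: rect_diag_mult_index[of _ p' 1] abs_mult mult_right_mono simp del: index_mult_mat(1))
    qed
  qed (use x' z in \<open>auto simp: nth_default_nonneg\<close>)
  also have "\<dots> \<le> nth_default 0 s' j * (1 * frob_norm ?x)"
    using x' V' xC by (intro mult_left_mono op_boundD[OF op_bound_transpose[OF op_bound_isometry[OF V']]])
      (auto simp: nth_default_nonneg)
  finally have 2: "frob_norm (X' * ?x) \<le> nth_default 0 s' j * frob_norm y" using nx by simp
  have D: "X - X' \<in> carrier_mat n1 n2" by (rule minus_carrier_mat[OF XC(2)])
  have "X * ?x = X' * ?x + (X - X') * ?x"
    unfolding minus_mult_distrib_mat[OF XC xC]
    using mult_carrier_mat[OF XC(1) xC] mult_carrier_mat[OF XC(2) xC] by (intro add_minus_cancel_mat[symmetric])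
  then have "frob_norm (X * ?x) \<le> frob_norm (X' * ?x) + frob_norm ((X - X') * ?x)"
    using frob_norm_triangle[OF mult_carrier_mat[OF XC(2) xC] mult_carrier_mat[OF D xC]] by simp
  also have "frob_norm ((X - X') * ?x) \<le> \<delta> * frob_norm y"
    using op_boundD[OF \<delta> D xC] nx by simp
  finally have "nth_default 0 s j * frob_norm y \<le> (nth_default 0 s' j + \<delta>) * frob_norm y"
    using 1 2 by (simp add: algebra_simps)
  then show ?thesis using y0 by simp
qed

lemma op_bound_zero: "X \<in> carrier_mat n1 n2 \<Longrightarrow> op_bound (X - X) 0"
proof (rule op_boundI[of _ n1 n2])
  fix k and Z :: "real mat" assume "X \<in> carrier_mat n1 n2" "Z \<in> carrier_mat n2 k"
  then have "(X - X) * Z = 0\<^sub>m n1 k" by auto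
  then show "frob_norm ((X - X) * Z) \<le> 0 * frob_norm Z" by (simp add: frob_norm_def frob_inner_def)
qed auto

lemma orth_svd_unique:
  assumes X: "orth_svd n1 n2 X U s V" and X': "orth_svd n1 n2 X U' s' V'"
  shows "nth_default 0 s j = nth_default 0 s' j"
proof -
  have "X \<in> carrier_mat n1 n2" using X by (auto simp: orth_svd_def)
  from orth_svd_weyl[OF X X' op_bound_zero[OF this], of j] orth_svd_weyl[OF X' X op_bound_zero[OF this], of j]
  show ?thesis by simp
qed

subsection \<open>Existence of singular value decompositions\<close>

lemma orthogonal_mult:
  fixes U W :: "real mat"
  assumes U: "U \<in> carrier_mat n n" "transpose_mat U * U = 1\<^sub>m n"
    and W: "W \<in> carrier_mat n n" "transpose_mat W * W = 1\<^sub>m n"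
  shows "transpose_mat (U * W) * (U * W) = 1\<^sub>m n"
proof -
  have UT: "transpose_mat U \<in> carrier_mat n n" and WT: "transpose_mat W \<in> carrier_mat n n"
    using U(1) W(1) by auto
  have "transpose_mat (U * W) * (U * W) = transpose_mat W * transpose_mat U * (U * W)"
    using transpose_mult[OF U(1) W(1)] by simp
  also have "\<dots> = transpose_mat W * (transpose_mat U * (U * W))"
    by (rule assoc_mult_mat[OF WT UT mult_carrier_mat[OF U(1) W(1)]])
  also have "transpose_mat U * (U * W) = transpose_mat U * U * W"
    by (rule assoc_mult_mat[OF UT U(1) W(1), symmetric])
  also have "\<dots> = W" unfolding U(2) by (rule left_mult_one_mat[OF W(1)])
  finally show ?thesis using W(2) by simp
qed

text \<open>The Householder reflection that exchanges \<open>u\<close> with the first basis vector,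
  or the identity if the two agree.\<close>

lemma orthogonal_with_first_column:
  fixes u :: "real mat"
  assumes u: "u \<in> carrier_mat (Suc n) 1" "frob_norm u = 1"
  shows "\<exists>H\<in>carrier_mat (Suc n) (Suc n). transpose_mat H * H = 1\<^sub>m (Suc n) \<and>
    (\<forall>i<Suc n. H $$ (i, 0) = u $$ (i, 0))"
proof -
  let ?u = "\<lambda>i. u $$ (i, 0)"
  have su: "(\<Sum>i<Suc n. (?u i)\<^sup>2) = 1" using frob_norm_sq[OF u(1)] u(2) by simp
  define c where "c = ?u 0"
  define w where "w = (\<lambda>i. ?u i - (if i = 0 then 1 else 0))"
  have sw: "(\<Sum>i<Suc n. w i * w i) = 2 - 2 * c"
  proof -
    have "(\<Sum>i<Suc n. w i * w i) = (\<Sum>i<Suc n. (?u i)\<^sup>2 + (if i = 0 then 1 - 2 * c else 0))"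
      by (intro sum.cong) (auto simp: w_def c_def power2_eq_square algebra_simps)
    also have "\<dots> = 1 + (\<Sum>i<Suc n. if i = 0 then 1 - 2 * c else 0)" by (simp only: sum.distrib su)
    finally show ?thesis by (subst (asm) sum.delta) auto
  qed
  show ?thesis
  proof (cases "c = 1")
    case True
    then have "\<forall>i<Suc n. w i = 0" using sw by (auto simp: sum_nonneg_eq_0_iff simp del: sum.lessThan_Suc)
    then have "?u i = 1\<^sub>m (Suc n) $$ (i, 0)" if "i < Suc n" for i using that by (auto simp: w_def split: if_splits)
    then show ?thesis by (intro bexI[of _ "1\<^sub>m (Suc n)"]) auto
  next
    case False
    \<comment> \<open>The squared length of \<open>w\<close> is \<open>2 - 2 * c\<close>, so this is
      the reflection factor, 2 divided by that squared length.\<close>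
    define q where "q = 1 / (1 - c)"
    have q: "(1 - c) * q = 1" using False by (simp add: q_def)
    define H where "H = mat (Suc n) (Suc n) (\<lambda>(i, j). (if i = j then 1 else 0) - w i * w j * q)"
    have H: "H \<in> carrier_mat (Suc n) (Suc n)" by (simp add: H_def)
    have "(\<Sum>a<Suc n. H $$ (a, i) * H $$ (a, j)) = (if i = j then 1 else 0)" if ij: "i < Suc n" "j < Suc n" for i j
    proof -
      have "(\<Sum>a<Suc n. H $$ (a, i) * H $$ (a, j)) = (\<Sum>a<Suc n.
          (if a = i then (if i = j then 1 else 0) - w i * w j * q else 0)
          - (if a = j then w i * w j * q else 0) + w a * w a * (w i * w j * q * q))"
        using ij by (intro sum.cong) (auto simp: H_def algebra_simps)
      also have "\<dots> = (if i = j then 1 else 0) - w i * w j * q - w i * w j * q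
          + (\<Sum>a<Suc n. w a * w a) * (w i * w j * q * q)"
        unfolding sum.distrib sum_subtractf sum_distrib_right[symmetric] using ij by (simp add: sum.delta del: sum.lessThan_Suc)
      also have "\<dots> = (if i = j then 1 else 0)"
      proof -
        have "(2 - 2 * c) * (w i * w j * q * q) = 2 * (w i * w j * q) * ((1 - c) * q)"
          by (simp add: algebra_simps)
        then show ?thesis unfolding sw q by simp
      qed
      finally show ?thesis .
    qed
    then have "transpose_mat H * H = 1\<^sub>m (Suc n)" using transpose_mult_one_iff[OF H] by simp
    moreover have "H $$ (i, 0) = ?u i" if "i < Suc n" for i
    proof -
      have "w i * w 0 * q = - (w i * ((1 - c) * q))" by (simp add: w_def c_def algebra_simps)
      then have "H $$ (i, 0) = (if i = 0 then 1 else 0) + w i" using that q by (simp add: H_def)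
      then show ?thesis by (simp add: w_def)
    qed
    ultimately show ?thesis using H by blast
  qed
qed

text \<open>Compactness of the unit sphere.\<close>

lemma exists_maximal_vector:
  fixes X :: "real mat"
  assumes X: "X \<in> carrier_mat n m" and m: "m > 0"
  shows "\<exists>x\<in>carrier_mat m 1. frob_norm x = 1 \<and>
    (\<forall>y\<in>carrier_mat m 1. frob_norm (X * y) \<le> frob_norm (X * x) * frob_norm y)"
proof -
  define V where "V = (\<lambda>g :: nat \<Rightarrow> real. mat m 1 (\<lambda>(i, j). g i))"
  have V: "V g \<in> carrier_mat m 1" for g by (simp add: V_def)
  define F where "F = (\<lambda>g :: nat \<Rightarrow> real. \<Sum>i<n. (\<Sum>j<m. X $$ (i, j) * g j)\<^sup>2)"
  have F: "(frob_norm (X * V g))\<^sup>2 = F g" for g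
  proof -
    have "(X * V g) $$ (i, 0) = (\<Sum>j<m. X $$ (i, j) * g j)" if "i < n" for i
      using that mult_index[OF X V, of i 0 g] by (simp add: V_def)
    then show ?thesis using frob_norm_sq[OF mult_carrier_mat[OF X V], of g] by (simp add: F_def)
  qed
  have nV: "(frob_norm (V g))\<^sup>2 = (\<Sum>j<m. (g j)\<^sup>2)" for g
    using frob_norm_sq[OF V, of g] by (simp add: V_def)
  \<comment> \<open>The dimension is a term and not a type, so vectors are represented by sequences
    in a product of intervals, which is compact by Tychonoff; the coordinates from \<open>m\<close>
    on are left free.\<close>
  define K where "K = PiE UNIV (\<lambda>_ :: nat. {-1..1 :: real}) \<inter> {g. (\<Sum>j<m. (g j)\<^sup>2) = 1}"
  have cont: "continuous_on UNIV (\<lambda>g :: nat \<Rightarrow> real. g j)" for j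
    by (rule continuous_on_product_coordinates)
  have "compact (PiE UNIV (\<lambda>_ :: nat. {-1..1 :: real}))"
    using compactin_PiE[of "\<lambda>_ :: nat. euclidean :: real topology" UNIV "\<lambda>_. {-1..1}"]
    by (simp add: euclidean_product_topology)
  moreover have "closed {g :: nat \<Rightarrow> real. (\<Sum>j<m. (g j)\<^sup>2) = 1}"
    by (intro closed_Collect_eq continuous_intros cont)
  ultimately have K: "compact K" unfolding K_def by (rule compact_Int_closed)
  have "(\<lambda>j. if j = 0 then 1 else 0) \<in> K"
    using m by (auto simp: K_def if_distrib[of "\<lambda>x. x\<^sup>2"] cong: if_cong)
  then have ne: "K \<noteq> {}" by blast
  have "continuous_on K F"
    unfolding F_def by (intro continuous_intros continuous_on_subset[OF cont]) auto
  from continuous_attains_sup[OF K ne this] obtain g where g: "g \<in> K" "\<And>h. h \<in> K \<Longrightarrow> F h \<le> F g" by blast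
  have "(frob_norm (V g))\<^sup>2 = 1" using g(1) by (simp add: K_def nV)
  then have n1: "frob_norm (V g) = 1" using frob_norm_nonneg[of "V g"] by (auto simp: power2_eq_1_iff)
  have "frob_norm (X * y) \<le> frob_norm (X * V g) * frob_norm y" if y: "y \<in> carrier_mat m 1" for y
  proof (cases "frob_norm y = 0")
    case True
    then have "(\<Sum>i<m. (y $$ (i, 0))\<^sup>2) = 0" using frob_norm_sq[OF y] by simp
    then have y0: "\<forall>i<m. y $$ (i, 0) = 0" by (auto simp: sum_nonneg_eq_0_iff)
    have "y = V (\<lambda>_. 0)" by (rule eq_matI) (use y y0 in \<open>auto simp: V_def\<close>)
    then have "(frob_norm (X * y))\<^sup>2 = 0" using F[of "\<lambda>_. 0"] by (simp add: F_def)
    then show ?thesis using True by simp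
  next
    case False
    define h where "h = (\<lambda>i. if i < m then y $$ (i, 0) / frob_norm y else 0)"
    have s1: "(\<Sum>j<m. (h j)\<^sup>2) = 1"
    proof -
      have "(\<Sum>j<m. (h j)\<^sup>2) = (\<Sum>j<m. (y $$ (j, 0))\<^sup>2) / (frob_norm y)\<^sup>2"
        by (simp add: h_def power_divide sum_divide_distrib)
      also have "\<dots> = (frob_norm y)\<^sup>2 / (frob_norm y)\<^sup>2" using frob_norm_sq[OF y] by simp
      finally show ?thesis using False by simp
    qed
    have "\<bar>h j\<bar> \<le> 1" for j
    proof (cases "j < m")
      case True
      then have "(h j)\<^sup>2 \<le> (\<Sum>j<m. (h j)\<^sup>2)" by (intro member_le_sum) auto
      then show ?thesis using s1 by (simp add: abs_square_le_1)
    qed (simp add: h_def)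
    then have "h j \<in> {-1..1}" for j by (metis abs_le_iff atLeastAtMost_iff minus_le_iff)
    then have "h \<in> K" using s1 by (simp add: K_def PiE_iff)
    then have "(frob_norm (X * V h))\<^sup>2 \<le> (frob_norm (X * V g))\<^sup>2" using g(2) F by simp
    then have *: "frob_norm (X * V h) \<le> frob_norm (X * V g)" by (rule power2_le_imp_le) simp
    have "y = frob_norm y \<cdot>\<^sub>m V h" by (rule eq_matI) (use y False in \<open>auto simp: V_def h_def\<close>)
    then have "X * y = frob_norm y \<cdot>\<^sub>m (X * V h)" using mult_smult_distrib[OF X V] by metis
    then have "frob_norm (X * y) = frob_norm y * frob_norm (X * V h)"
      using frob_norm_smult[OF mult_carrier_mat[OF X V[of h]], of "frob_norm y"] by simp
    also have "\<dots> \<le> frob_norm y * frob_norm (X * V g)" using * by (intro mult_left_mono) auto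
    finally show ?thesis by (simp add: mult.commute)
  qed
  then show ?thesis using V n1 by blast
qed


lemma abs_index_le_frob_norm:
  assumes "A \<in> carrier_mat n m" "i < n" "j < m"
  shows "\<bar>A $$ (i, j)\<bar> \<le> frob_norm A"
proof -
  have "(A $$ (i, j))\<^sup>2 \<le> (\<Sum>j<m. (A $$ (i, j))\<^sup>2)"
    using assms by (intro member_le_sum) auto
  also have "\<dots> \<le> (\<Sum>i<n. \<Sum>j<m. (A $$ (i, j))\<^sup>2)"
    using assms by (intro member_le_sum[of i "{..<n}" "\<lambda>i. \<Sum>j<m. (A $$ (i, j))\<^sup>2"]) (auto simp: sum_nonneg)
  also have "\<dots> = (frob_norm A)\<^sup>2" using frob_norm_sq[OF assms(1)] by simp
  finally show ?thesis using abs_le_square_iff[of "A $$ (i, j)" "frob_norm A"] by simp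
qed

lemma full_svd_iff:
  "X \<in> carrier_mat n m \<Longrightarrow> full_svd X U s V \<longleftrightarrow>
     U \<in> carrier_mat n n \<and> transpose_mat U * U = 1\<^sub>m n \<and>
     V \<in> carrier_mat m m \<and> transpose_mat V * V = 1\<^sub>m m \<and>
     length s = min n m \<and> sorted_wrt (\<ge>) s \<and> (\<forall>x\<in>set s. 0 \<le> x) \<and>
     X = U * rect_diag n m s * transpose_mat V"
  by (simp add: full_svd_def Let_def)

lemma four_block_orthogonal:
  fixes W :: "real mat"
  assumes W: "W \<in> carrier_mat n n" "transpose_mat W * W = 1\<^sub>m n"
  defines "E \<equiv> four_block_mat (1\<^sub>m 1) (0\<^sub>m 1 n) (0\<^sub>m n 1) W"
  shows "E \<in> carrier_mat (Suc n) (Suc n)" "transpose_mat E * E = 1\<^sub>m (Suc n)"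
    "transpose_mat E = four_block_mat (1\<^sub>m 1) (0\<^sub>m 1 n) (0\<^sub>m n 1) (transpose_mat W)"
proof -
  show "E \<in> carrier_mat (Suc n) (Suc n)"
    unfolding E_def Suc_eq_plus1_left using W(1) by (intro four_block_carrier_mat) auto
  show T: "transpose_mat E = four_block_mat (1\<^sub>m 1) (0\<^sub>m 1 n) (0\<^sub>m n 1) (transpose_mat W)"
    unfolding E_def using W(1) by (subst transpose_four_block_mat[of _ 1 1 _ n _ n]) auto
  have WT: "transpose_mat W \<in> carrier_mat n n" using W(1) by simp
  have "transpose_mat E * E = four_block_mat (1\<^sub>m 1) (0\<^sub>m 1 n) (0\<^sub>m n 1) (1\<^sub>m n)"
    unfolding T unfolding E_def
    by (subst mult_four_block_mat[of _ 1 1 _ n _ n _ _ 1 _ n]) (use W WT in auto)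
  then show "transpose_mat E * E = 1\<^sub>m (Suc n)" by (simp add: Suc_eq_plus1_left del: add_Suc_right plus_1_eq_Suc)
qed

text \<open>The maximal direction \<open>x\<close> and its normalised image become the first columns
  of \<open>Q\<close> and \<open>P\<close>. The first column of \<open>P^T X Q\<close> is then the
  norm of \<open>X x\<close> on top of zeros, and maximality forces the rest of the first row to
  vanish.\<close>

lemma exists_deflation:
  fixes X :: "real mat"
  assumes X: "X \<in> carrier_mat (Suc n) (Suc m)"
    and x: "x \<in> carrier_mat (Suc m) 1" "frob_norm x = 1"
    and max: "\<And>y. y \<in> carrier_mat (Suc m) 1 \<Longrightarrow> frob_norm (X * y) \<le> frob_norm (X * x) * frob_norm y"
    and pos: "frob_norm (X * x) > 0"
  shows "\<exists>P Q B. P \<in> carrier_mat (Suc n) (Suc n) \<and> transpose_mat P * P = 1\<^sub>m (Suc n) \<and>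
    Q \<in> carrier_mat (Suc m) (Suc m) \<and> transpose_mat Q * Q = 1\<^sub>m (Suc m) \<and> B \<in> carrier_mat n m \<and>
    X = P * four_block_mat (mat 1 1 (\<lambda>_. frob_norm (X * x))) (0\<^sub>m 1 m) (0\<^sub>m n 1) B * transpose_mat Q"
proof -
  define \<sigma> where "\<sigma> = frob_norm (X * x)"
  have \<sigma>: "\<sigma> > 0" using pos by (simp add: \<sigma>_def)
  define u where "u = (1 / \<sigma>) \<cdot>\<^sub>m (X * x)"
  have Xx: "X * x \<in> carrier_mat (Suc n) 1" by (rule mult_carrier_mat[OF X x(1)])
  have u: "u \<in> carrier_mat (Suc n) 1" "frob_norm u = 1"
    using Xx frob_norm_smult[OF Xx, of "1 / \<sigma>"] \<sigma> by (auto simp: u_def \<sigma>_def)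
  have \<sigma>u: "X * x = \<sigma> \<cdot>\<^sub>m u"
    by (rule eq_matI) (use Xx \<sigma> in \<open>auto simp: u_def\<close>)
  obtain P where P: "P \<in> carrier_mat (Suc n) (Suc n)" "transpose_mat P * P = 1\<^sub>m (Suc n)"
     "\<forall>i<Suc n. P $$ (i, 0) = u $$ (i, 0)"
    using orthogonal_with_first_column[OF u] by blast
  obtain Q where Q: "Q \<in> carrier_mat (Suc m) (Suc m)" "transpose_mat Q * Q = 1\<^sub>m (Suc m)"
     "\<forall>i<Suc m. Q $$ (i, 0) = x $$ (i, 0)"
    using orthogonal_with_first_column[OF x] by blast
  define e :: "nat \<Rightarrow> real mat" where "e = (\<lambda>k. mat k 1 (\<lambda>(i, j). if i = 0 then 1 else 0))"
  have e: "e k \<in> carrier_mat k 1" for k by (simp add: e_def)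
  have col0: "(H * e k) $$ (i, 0) = H $$ (i, 0)" if "H \<in> carrier_mat l k" "i < l" "0 < k" for H l k i
  proof -
    have "(H * e k) $$ (i, 0) = (\<Sum>a<k. H $$ (i, a) * e k $$ (a, 0))"
      using that by (intro mult_index[OF _ e]) auto
    also have "\<dots> = (\<Sum>a<k. if a = 0 then H $$ (i, 0) else 0)" by (intro sum.cong) (auto simp: e_def)
    finally show ?thesis using that by simp
  qed
  have Pe: "P * e (Suc n) = u"
    by (rule eq_matI) (use P u e[of "Suc n"] col0[OF P(1)] in \<open>auto simp del: index_mult_mat(1)\<close>)
  have Qe: "Q * e (Suc m) = x"
    by (rule eq_matI) (use Q x e[of "Suc m"] col0[OF Q(1)] in \<open>auto simp del: index_mult_mat(1)\<close>)
  have PT: "transpose_mat P \<in> carrier_mat (Suc n) (Suc n)" and QT: "transpose_mat Q \<in> carrier_mat (Suc m) (Suc m)"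
    using P(1) Q(1) by auto
  have XQ: "X * Q \<in> carrier_mat (Suc n) (Suc m)" by (rule mult_carrier_mat[OF X Q(1)])
  define B where "B = transpose_mat P * (X * Q)"
  have B: "B \<in> carrier_mat (Suc n) (Suc m)" unfolding B_def by (rule mult_carrier_mat[OF PT XQ])
  have By: "B * y = transpose_mat P * (X * (Q * y))" if y: "y \<in> carrier_mat (Suc m) 1" for y
    unfolding B_def assoc_mult_mat[OF PT XQ y] assoc_mult_mat[OF X Q(1) y] ..
  have Bmax: "frob_norm (B * y) \<le> \<sigma> * frob_norm y" if y: "y \<in> carrier_mat (Suc m) 1" for y
  proof -
    have Qy: "Q * y \<in> carrier_mat (Suc m) 1" by (rule mult_carrier_mat[OF Q(1) y])
    have "frob_norm (B * y) \<le> 1 * frob_norm (X * (Q * y))"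
      unfolding By[OF y] by (rule op_boundD[OF op_bound_transpose[OF op_bound_isometry[OF P(1,2)]] PT
        mult_carrier_mat[OF X Qy]])
    also have "\<dots> \<le> \<sigma> * frob_norm (Q * y)" using max[OF Qy] by (simp add: \<sigma>_def)
    also have "frob_norm (Q * y) = frob_norm y" by (rule frob_norm_isometry[OF Q(1,2) y])
    finally show ?thesis .
  qed
  have "B * e (Suc m) = transpose_mat P * (\<sigma> \<cdot>\<^sub>m (P * e (Suc n)))"
    unfolding By[OF e] Qe \<sigma>u Pe ..
  also have "\<dots> = \<sigma> \<cdot>\<^sub>m (transpose_mat P * (P * e (Suc n)))"
    by (rule mult_smult_distrib[OF PT mult_carrier_mat[OF P(1) e]])
  also have "transpose_mat P * (P * e (Suc n)) = e (Suc n)"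
    unfolding assoc_mult_mat[OF PT P(1) e, symmetric] P(2) by (rule left_mult_one_mat[OF e])
  finally have Be: "B * e (Suc m) = \<sigma> \<cdot>\<^sub>m e (Suc n)" .
  have B0: "B $$ (i, 0) = (if i = 0 then \<sigma> else 0)" if "i < Suc n" for i
  proof -
    have "B $$ (i, 0) = (B * e (Suc m)) $$ (i, 0)" using col0[OF B that] by simp
    also have "\<dots> = \<sigma> * e (Suc n) $$ (i, 0)" unfolding Be using that by (simp add: e_def)
    finally show ?thesis using that by (simp add: e_def)
  qed
  \<comment> \<open>The bound is tested on the first row \<open>b\<close> itself: the top entry of
    \<open>B b\<close> is the squared norm of \<open>b\<close>, so this norm is at most
    \<open>\<sigma>\<close>, which the first entry alone uses up.\<close>
  define b where "b = mat (Suc m) 1 (\<lambda>(j, i). B $$ (0, j))"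
  have b: "b \<in> carrier_mat (Suc m) 1" by (simp add: b_def)
  have b2: "(frob_norm b)\<^sup>2 = (\<Sum>j<Suc m. (B $$ (0, j))\<^sup>2)"
    unfolding frob_norm_sq[OF b] sum_lessThan_1 by (intro sum.cong) (auto simp: b_def)
  have "(B * b) $$ (0, 0) = (\<Sum>j<Suc m. B $$ (0, j) * b $$ (j, 0))"
    by (rule mult_index[OF B b]) auto
  also have "\<dots> = (frob_norm b)\<^sup>2"
    unfolding b2 by (intro sum.cong) (auto simp: b_def power2_eq_square)
  finally have "(frob_norm b)\<^sup>2 \<le> frob_norm (B * b)"
    using abs_index_le_frob_norm[OF mult_carrier_mat[OF B b], of 0 0] by simp
  also have "\<dots> \<le> \<sigma> * frob_norm b" by (rule Bmax[OF b])
  finally have bb: "frob_norm b * frob_norm b \<le> \<sigma> * frob_norm b" by (simp add: power2_eq_square)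
  have "frob_norm b \<le> \<sigma>"
  proof (cases "frob_norm b = 0")
    case False
    then have "frob_norm b > 0" using frob_norm_nonneg[of b] by linarith
    then show ?thesis using mult_right_le_imp_le[OF bb] by simp
  qed (use \<sigma> in simp)
  then have "(frob_norm b)\<^sup>2 \<le> \<sigma>\<^sup>2" by (rule power_mono) simp
  then have "(\<Sum>j<m. (B $$ (0, Suc j))\<^sup>2) \<le> 0"
    unfolding b2 sum.lessThan_Suc_shift using B0[of 0] by simp
  then have "(\<Sum>j<m. (B $$ (0, Suc j))\<^sup>2) = 0" by (intro antisym sum_nonneg) auto
  then have row0: "B $$ (0, Suc j) = 0" if "j < m" for j using that by (simp add: sum_nonneg_eq_0_iff)
  define B' where "B' = mat n m (\<lambda>(i, j). B $$ (Suc i, Suc j))"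
  have Bblock: "B = four_block_mat (mat 1 1 (\<lambda>_. \<sigma>)) (0\<^sub>m 1 m) (0\<^sub>m n 1) B'"
  proof (rule eq_matI)
    fix i j assume "i < dim_row (four_block_mat (mat 1 1 (\<lambda>_. \<sigma>)) (0\<^sub>m 1 m) (0\<^sub>m n 1) B')"
      "j < dim_col (four_block_mat (mat 1 1 (\<lambda>_. \<sigma>)) (0\<^sub>m 1 m) (0\<^sub>m n 1) B')"
    then have "i < Suc n" "j < Suc m" by (auto simp: B'_def)
    then show "B $$ (i, j) = four_block_mat (mat 1 1 (\<lambda>_. \<sigma>)) (0\<^sub>m 1 m) (0\<^sub>m n 1) B' $$ (i, j)"
      using B0 row0 by (cases i; cases j) (auto simp: B'_def)
  qed (use B in \<open>auto simp: B'_def\<close>)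
  have "P * B = X * Q"
    unfolding B_def assoc_mult_mat[OF P(1) PT XQ, symmetric] orthogonal_transpose[OF P(1,2)]
    by (rule left_mult_one_mat[OF XQ])
  then have "P * B * transpose_mat Q = X * (Q * transpose_mat Q)"
    using assoc_mult_mat[OF X Q(1) QT] by simp
  also have "\<dots> = X" unfolding orthogonal_transpose[OF Q(1,2)] by (rule right_mult_one_mat[OF X])
  finally have "X = P * four_block_mat (mat 1 1 (\<lambda>_. \<sigma>)) (0\<^sub>m 1 m) (0\<^sub>m n 1) B' * transpose_mat Q"
    using Bblock by simp
  moreover have "B' \<in> carrier_mat n m" by (simp add: B'_def)
  ultimately show ?thesis using P Q unfolding \<sigma>_def by blast
qed

text \<open>Induction on the number of rows; deflation splits off the largest singular
  value.\<close>

theorem exists_full_svd: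
  "X \<in> carrier_mat n m \<Longrightarrow> \<exists>U s V. full_svd X U s V"
proof (induction n arbitrary: m X)
  case 0
  have "X = 1\<^sub>m 0 * rect_diag 0 m [] * transpose_mat (1\<^sub>m m)"
    by (rule eq_matI) (use 0 in auto)
  then show ?case using 0 full_svd_iff[OF 0, of "1\<^sub>m 0" "[]" "1\<^sub>m m"] by force
next
  case (Suc n)
  note X = Suc.prems
  show ?case
  proof (cases m)
    case m: 0
    have "X = 1\<^sub>m (Suc n) * rect_diag (Suc n) m [] * transpose_mat (1\<^sub>m m)"
      by (rule eq_matI) (use X m in auto)
    then show ?thesis using m full_svd_iff[OF X, of "1\<^sub>m (Suc n)" "[]" "1\<^sub>m m"] by force
  next
    case m: (Suc k)
    note X = X[unfolded m]
    obtain x where x: "x \<in> carrier_mat (Suc k) 1" "frob_norm x = 1"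
      and max: "\<And>y. y \<in> carrier_mat (Suc k) 1 \<Longrightarrow> frob_norm (X * y) \<le> frob_norm (X * x) * frob_norm y"
      using exists_maximal_vector[OF X] by blast
    show ?thesis
    proof (cases "frob_norm (X * x) = 0")
      \<comment> \<open>If even the maximal direction is mapped to zero, the whole matrix is
        zero.\<close>
      case True
      have X0: "X $$ (i, j) = 0" if ij: "i < Suc n" "j < Suc k" for i j
      proof -
        define y :: "real mat" where "y = mat (Suc k) 1 (\<lambda>(l, _). if l = j then 1 else 0)"
        have y: "y \<in> carrier_mat (Suc k) 1" by (simp add: y_def)
        have "(X * y) $$ (i, 0) = (\<Sum>l<Suc k. X $$ (i, l) * y $$ (l, 0))"
          using ij by (intro mult_index[OF X y]) auto
        also have "\<dots> = (\<Sum>l<Suc k. if l = j then X $$ (i, j) else 0)"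
          by (intro sum.cong) (auto simp: y_def)
        also have "\<dots> = X $$ (i, j)" using ij by (simp del: sum.lessThan_Suc)
        finally have "\<bar>X $$ (i, j)\<bar> \<le> frob_norm (X * y)"
          using abs_index_le_frob_norm[OF mult_carrier_mat[OF X y], of i 0] ij by simp
        then show ?thesis using max[OF y] True by simp
      qed
      define p where "p = min (Suc n) (Suc k)"
      let ?s = "replicate p 0 :: real list"
      have s0: "nth_default 0 ?s i = 0" for i by (cases "i < p") (auto simp: nth_default_def)
      have R0: "rect_diag (Suc n) (Suc k) ?s = 0\<^sub>m (Suc n) (Suc k)"
        by (rule eq_matI) (auto simp: rect_diag_index s0)
      have "X = 0\<^sub>m (Suc n) (Suc k)" by (rule eq_matI) (use X X0 in auto)
      then have "X = 1\<^sub>m (Suc n) * rect_diag (Suc n) (Suc k) ?s * transpose_mat (1\<^sub>m (Suc k))"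
        unfolding R0 by simp
      moreover have "sorted_wrt (\<ge>) ?s" by (auto simp: sorted_wrt_iff_nth_less)
      ultimately have "full_svd X (1\<^sub>m (Suc n)) ?s (1\<^sub>m (Suc k))"
        unfolding full_svd_iff[OF X] p_def by auto
      then show ?thesis by blast
    next
      case False
      define \<sigma> where "\<sigma> = frob_norm (X * x)"
      have \<sigma>: "\<sigma> > 0" using False frob_norm_nonneg[of "X * x"] unfolding \<sigma>_def by linarith
      obtain P Q B where P: "P \<in> carrier_mat (Suc n) (Suc n)" "transpose_mat P * P = 1\<^sub>m (Suc n)"
        and Q: "Q \<in> carrier_mat (Suc k) (Suc k)" "transpose_mat Q * Q = 1\<^sub>m (Suc k)"
        and B: "B \<in> carrier_mat n k"
        and XB: "X = P * four_block_mat (mat 1 1 (\<lambda>_. \<sigma>)) (0\<^sub>m 1 k) (0\<^sub>m n 1) B * transpose_mat Q"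
        using exists_deflation[OF X x max] \<sigma> unfolding \<sigma>_def by blast
      obtain U' s' V' where svd: "full_svd B U' s' V'" using Suc.IH[OF B] by blast
      note svd' = svd[unfolded full_svd_iff[OF B]]
      have U': "U' \<in> carrier_mat n n" "transpose_mat U' * U' = 1\<^sub>m n"
        and V': "V' \<in> carrier_mat k k" "transpose_mat V' * V' = 1\<^sub>m k"
        and s': "length s' = min n k" "sorted_wrt (\<ge>) s'" "\<forall>x\<in>set s'. 0 \<le> x"
        and Beq: "B = U' * rect_diag n k s' * transpose_mat V'" using svd' by blast+
      define E where "E = four_block_mat (1\<^sub>m 1) (0\<^sub>m 1 n) (0\<^sub>m n 1) U'"
      define F where "F = four_block_mat (1\<^sub>m 1) (0\<^sub>m 1 k) (0\<^sub>m k 1) V'"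
      define S where "S = rect_diag (Suc n) (Suc k) (\<sigma> # s')"
      note E = four_block_orthogonal[OF U', folded E_def]
      note F = four_block_orthogonal[OF V', folded F_def]
      have S: "S \<in> carrier_mat (Suc n) (Suc k)" by (simp add: S_def)
      have Sblock: "S = four_block_mat (mat 1 1 (\<lambda>_. \<sigma>)) (0\<^sub>m 1 k) (0\<^sub>m n 1) (rect_diag n k s')"
      proof (rule eq_matI)
        fix i j assume "i < dim_row (four_block_mat (mat 1 1 (\<lambda>_. \<sigma>)) (0\<^sub>m 1 k) (0\<^sub>m n 1) (rect_diag n k s'))"
          "j < dim_col (four_block_mat (mat 1 1 (\<lambda>_. \<sigma>)) (0\<^sub>m 1 k) (0\<^sub>m n 1) (rect_diag n k s'))"
        then have "i < Suc n" "j < Suc k" by auto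
        then show "S $$ (i, j) = four_block_mat (mat 1 1 (\<lambda>_. \<sigma>)) (0\<^sub>m 1 k) (0\<^sub>m n 1) (rect_diag n k s') $$ (i, j)"
          by (cases i; cases j) (auto simp: S_def rect_diag_index nth_default_def)
      qed (auto simp: S_def)
      have U'R: "U' * rect_diag n k s' \<in> carrier_mat n k" by (rule mult_carrier_mat[OF U'(1) rect_diag_carrier])
      have ES: "E * S = four_block_mat (mat 1 1 (\<lambda>_. \<sigma>)) (0\<^sub>m 1 k) (0\<^sub>m n 1) (U' * rect_diag n k s')"
        unfolding E_def Sblock
        by (subst mult_four_block_mat[of _ 1 1 _ n _ n _ _ 1 _ k]) (use U' U'R in auto)
      have VT: "transpose_mat V' \<in> carrier_mat k k" using V'(1) by simp
      have ESF: "E * S * transpose_mat F = four_block_mat (mat 1 1 (\<lambda>_. \<sigma>)) (0\<^sub>m 1 k) (0\<^sub>m n 1) B"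
        unfolding ES F(3) Beq
        by (subst mult_four_block_mat[of _ 1 1 _ k _ n _ _ 1 _ k]) (use U'R VT in auto)
      have FT: "transpose_mat F \<in> carrier_mat (Suc k) (Suc k)" and QT: "transpose_mat Q \<in> carrier_mat (Suc k) (Suc k)"
        using F(1) Q(1) by auto
      have PE: "P * E \<in> carrier_mat (Suc n) (Suc n)" by (rule mult_carrier_mat[OF P(1) E(1)])
      have QF: "Q * F \<in> carrier_mat (Suc k) (Suc k)" by (rule mult_carrier_mat[OF Q(1) F(1)])
      have ESc: "E * S \<in> carrier_mat (Suc n) (Suc k)" by (rule mult_carrier_mat[OF E(1) S])
      have "X = P * (E * S * transpose_mat F) * transpose_mat Q" using XB ESF by simp
      also have "\<dots> = P * (E * S) * transpose_mat F * transpose_mat Q"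
        using assoc_mult_mat[OF P(1) ESc FT] by simp
      also have "\<dots> = P * (E * S) * (transpose_mat F * transpose_mat Q)"
        by (rule assoc_mult_mat[OF mult_carrier_mat[OF P(1) ESc] FT QT])
      also have "P * (E * S) = P * E * S" using assoc_mult_mat[OF P(1) E(1) S] by simp
      also have "transpose_mat F * transpose_mat Q = transpose_mat (Q * F)"
        using transpose_mult[OF Q(1) F(1)] by simp
      finally have Xeq: "X = P * E * S * transpose_mat (Q * F)" .
      note PEo = orthogonal_mult[OF P E(1,2)] and QFo = orthogonal_mult[OF Q F(1,2)]
      \<comment> \<open>The list stays sorted because \<open>\<sigma>\<close> bounds the stretching
        of every unit vector, in particular of the right singular vector that belongs to
        \<open>y\<close>.\<close>
      have le: "y \<le> \<sigma>" if y: "y \<in> set s'" for y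
      proof -
        obtain l where l: "l < length s'" "y = s' ! l" using y by (auto simp: in_set_conv_nth)
        define z :: "real mat" where "z = mat (Suc k) 1 (\<lambda>(a, _). if a = Suc l then 1 else 0)"
        have z: "z \<in> carrier_mat (Suc k) 1" by (simp add: z_def)
        have lk: "Suc l < Suc k" "Suc l < Suc n" using l s' by auto
        have "(frob_norm z)\<^sup>2 = (\<Sum>a<Suc k. if a = Suc l then 1 else 0)"
          unfolding frob_norm_sq[OF z] sum_lessThan_1 by (intro sum.cong) (auto simp: z_def)
        then have "(frob_norm z)\<^sup>2 = 1" using lk by (simp del: sum.lessThan_Suc)
        then have z1: "frob_norm z = 1" using frob_norm_nonneg[of z] by (auto simp: power2_eq_1_iff)
        have QFz: "Q * F * z \<in> carrier_mat (Suc k) 1" by (rule mult_carrier_mat[OF QF z])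
        have Sz: "S * z \<in> carrier_mat (Suc n) 1" by (rule mult_carrier_mat[OF S z])
        have QFT: "transpose_mat (Q * F) \<in> carrier_mat (Suc k) (Suc k)" using QF transpose_carrier_mat by blast
        have "transpose_mat (Q * F) * (Q * F * z) = z"
          unfolding assoc_mult_mat[OF QFT QF z, symmetric] QFo by (rule left_mult_one_mat[OF z])
        then have "X * (Q * F * z) = P * E * (S * z)"
          using assoc_mult_mat[OF mult_carrier_mat[OF PE S] QFT QFz] assoc_mult_mat[OF PE S z] Xeq by simp
        then have "frob_norm (S * z) = frob_norm (X * (Q * F * z))"
          using frob_norm_isometry[OF PE PEo Sz] by simp
        also have "\<dots> \<le> \<sigma> * frob_norm (Q * F * z)" using max[OF QFz] by (simp add: \<sigma>_def)
        also have "\<dots> = \<sigma>" using frob_norm_isometry[OF QF QFo z] z1 by simp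
        finally have "frob_norm (S * z) \<le> \<sigma>" .
        moreover have "(S * z) $$ (Suc l, 0) = y"
          unfolding S_def using lk l z by (subst rect_diag_mult_index[of _ _ 1]) (auto simp: z_def nth_default_def)
        ultimately show ?thesis using abs_index_le_frob_norm[OF Sz lk(2), of 0] by simp
      qed
      have "full_svd X (P * E) (\<sigma> # s') (Q * F)"
        unfolding full_svd_iff[OF X] using PE PEo QF QFo s' \<sigma> le Xeq unfolding S_def by auto
      then show ?thesis by blast
    qed
  qed
qed

subsection \<open>Singular values and the spectral norm\<close>

lemma singular_values_eq:
  assumes X: "X \<in> carrier_mat n m" and svd: "full_svd X U s V"
  shows "singular_values X = s"
  unfolding singular_values_def
proof (rule the_equality)
  show "\<exists>U V. full_svd X U s V" using svd by blast
next
  fix s' assume "\<exists>U V. full_svd X U s' V"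
  then obtain U' V' where svd': "full_svd X U' s' V'" by blast
  have len: "length s = length s'" using svd svd' unfolding full_svd_iff[OF X] by simp
  have "nth_default 0 s' j = nth_default 0 s j" for j
    by (rule orth_svd_unique[OF full_svd_imp_orth_svd[OF svd' X] full_svd_imp_orth_svd[OF svd X]])
  then show "s' = s" using len by (intro nth_equalityI) (simp, metis nth_default_nth)
qed

text \<open>The index counts from 1 in \<open>singular_value\<close> and from 0 in the list. A thin
  decomposition may list fewer values than a full one; the missing ones read as 0.\<close>

lemma singular_value_eq:
  assumes svd: "orth_svd n m X U s V"
  shows "singular_value (Suc j) X = nth_default 0 s j"
proof -
  have X: "X \<in> carrier_mat n m" using svd by (auto simp: orth_svd_def)
  obtain U' s' V' where svd': "full_svd X U' s' V'" using exists_full_svd[OF X] by blast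
  show ?thesis
    unfolding singular_value_def singular_values_eq[OF X svd'] diff_Suc_1
    by (rule orth_svd_unique[OF full_svd_imp_orth_svd[OF svd' X] svd])
qed

lemma exists_orth_svd:
  assumes X: "X \<in> carrier_mat n m"
  obtains U s V where "orth_svd n m X U s V"
  using exists_full_svd[OF X] full_svd_imp_orth_svd[OF _ X] by blast

lemma spectral_norm_eq:
  "orth_svd n m X U s V \<Longrightarrow> spectral_norm X = nth_default 0 s 0"
  using singular_value_eq[of n m X U s V 0] by (simp add: spectral_norm_def One_nat_def)

lemma op_bound_spectral_norm:
  assumes X: "X \<in> carrier_mat n m"
  shows "op_bound X (spectral_norm X)"
proof -
  obtain U s V where svd: "orth_svd n m X U s V" using exists_orth_svd[OF X] .
  note x = svd[unfolded orth_svd_def]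
  have V: "V \<in> carrier_mat m (length s)" "transpose_mat V * V = 1\<^sub>m (length s)" using x by auto
  have s0: "0 \<le> nth_default 0 s 0" using x by (intro nth_default_nonneg) auto
  show ?thesis unfolding spectral_norm_eq[OF svd]
  proof (rule op_boundI[OF X s0])
    fix k and Z :: "real mat" assume Z: "Z \<in> carrier_mat m k"
    have VT: "transpose_mat V \<in> carrier_mat (length s) m" using V(1) by simp
    have VZ: "transpose_mat V * Z \<in> carrier_mat (length s) k" by (rule mult_carrier_mat[OF VT Z])
    have "frob_norm (X * Z) = frob_norm (rect_diag (length s) (length s) s * (transpose_mat V * Z))"
      by (rule orth_svd_apply[OF svd Z])
    also have "\<dots> \<le> nth_default 0 s 0 * frob_norm (transpose_mat V * Z)"
    proof (rule frob_norm_le[OF rect_diag_mult_carrier[OF VZ] VZ s0])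
      fix i j assume ij: "i < length s" "j < k"
      have "nth_default 0 s i \<le> nth_default 0 s 0" "0 \<le> nth_default 0 s i"
        using x by (auto intro!: nth_default_antimono nth_default_nonneg)
      then show "\<bar>(rect_diag (length s) (length s) s * (transpose_mat V * Z)) $$ (i, j)\<bar>
          \<le> nth_default 0 s 0 * \<bar>(transpose_mat V * Z) $$ (i, j)\<bar>"
        unfolding rect_diag_mult_index[OF VZ ij] using ij by (simp add: abs_mult mult_right_mono del: index_mult_mat(1))
    qed
    also have "frob_norm (transpose_mat V * Z) \<le> 1 * frob_norm Z"
      by (rule op_boundD[OF op_bound_transpose[OF op_bound_isometry[OF V]] VT Z])
    finally show "frob_norm (X * Z) \<le> nth_default 0 s 0 * frob_norm Z"
      using s0 by (simp add: mult_left_mono)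
  qed
qed

lemma spectral_norm_nonneg: "X \<in> carrier_mat n m \<Longrightarrow> 0 \<le> spectral_norm X"
  using op_bound_spectral_norm op_bound_nonneg by blast

text \<open>Once the orthonormal factors are removed, the largest singular value is an entry of what
  remains.\<close>

lemma spectral_norm_le_frob_norm:
  assumes X: "X \<in> carrier_mat n m"
  shows "spectral_norm X \<le> frob_norm X"
proof -
  obtain U s V where svd: "orth_svd n m X U s V" using exists_orth_svd[OF X] .
  define p where "p = length s"
  note x = svd[unfolded orth_svd_def, folded p_def]
  have V: "V \<in> carrier_mat m p" "transpose_mat V * V = 1\<^sub>m p"
    and U: "U \<in> carrier_mat n p" "transpose_mat U * U = 1\<^sub>m p"
    and Xe: "X = U * rect_diag p p s * transpose_mat V" using x by auto
  show ?thesis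
  proof (cases "p = 0")
    case True
    then show ?thesis unfolding spectral_norm_eq[OF svd] by (simp add: nth_default_def p_def)
  next
    case False
    have US: "U * rect_diag p p s \<in> carrier_mat n p" by (rule mult_carrier_mat[OF U(1) rect_diag_carrier])
    have "frob_norm X = frob_norm (U * rect_diag p p s)"
      unfolding Xe by (rule frob_norm_isometry_right[OF V US])
    also have "\<dots> = frob_norm (rect_diag p p s)" by (rule frob_norm_isometry[OF U rect_diag_carrier])
    finally have "frob_norm X = frob_norm (rect_diag p p s)" .
    moreover have "\<bar>rect_diag p p s $$ (0, 0)\<bar> \<le> frob_norm (rect_diag p p s)"
      using False by (intro abs_index_le_frob_norm[OF rect_diag_carrier]) auto
    ultimately show ?thesis unfolding spectral_norm_eq[OF svd] using False by (simp add: rect_diag_index)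
  qed
qed

lemma singular_value_weyl:
  assumes X: "X \<in> carrier_mat n m" and Y: "Y \<in> carrier_mat n m" and XY: "op_bound (X - Y) \<delta>"
  shows "singular_value (Suc j) X \<le> singular_value (Suc j) Y + \<delta>"
proof -
  obtain U s V where x: "orth_svd n m X U s V" using exists_orth_svd[OF X] .
  obtain U' s' V' where y: "orth_svd n m Y U' s' V'" using exists_orth_svd[OF Y] .
  show ?thesis unfolding singular_value_eq[OF x] singular_value_eq[OF y]
    by (rule orth_svd_weyl[OF x y XY])
qed

subsection \<open>Perturbation of singular subspaces\<close>

lemma rect_diag_transpose: "transpose_mat (rect_diag n m s) = rect_diag m n s"
  by (rule eq_matI) (auto simp: rect_diag_index)

lemma mult_rect_diag_index:
  assumes Z: "Z \<in> carrier_mat n m" and "i < n" "j < k"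
  shows "(Z * rect_diag m k s) $$ (i, j) = (if j < m then Z $$ (i, j) * nth_default 0 s j else 0)"
proof -
  have "(Z * rect_diag m k s) $$ (i, j) = (\<Sum>l<m. Z $$ (i, l) * rect_diag m k s $$ (l, j))"
    using assms by (intro mult_index[OF Z]) auto
  also have "\<dots> = (\<Sum>l<m. if l = j then Z $$ (i, j) * nth_default 0 s j else 0)"
    using assms by (intro sum.cong) (auto simp: rect_diag_index)
  finally show ?thesis by simp
qed

lemma op_bound_rect_diag:
  assumes c: "0 \<le> c" and s: "\<And>i. i < min n m \<Longrightarrow> \<bar>nth_default 0 s i\<bar> \<le> c"
  shows "op_bound (rect_diag n m s) c"
proof (rule op_boundI[OF rect_diag_carrier c])
  fix k and Z :: "real mat" assume Z: "Z \<in> carrier_mat m k"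
  have le: "((rect_diag n m s * Z) $$ (i, j))\<^sup>2 \<le> (if i < m then c\<^sup>2 * (Z $$ (i, j))\<^sup>2 else 0)"
    if ij: "i < n" "j < k" for i j
  proof (cases "i < m")
    case True
    then have "(nth_default 0 s i)\<^sup>2 \<le> c\<^sup>2" using power_mono[OF s[of i], of 2] ij by simp
    then show ?thesis unfolding rect_diag_mult_index[OF Z ij] using True
      by (simp add: power_mult_distrib mult_right_mono)
  qed (simp add: rect_diag_mult_index[OF Z ij] del: index_mult_mat(1))
  have "(frob_norm (rect_diag n m s * Z))\<^sup>2 \<le> (\<Sum>i<n. \<Sum>j<k. if i < m then c\<^sup>2 * (Z $$ (i, j))\<^sup>2 else 0)"
    unfolding frob_norm_sq[OF rect_diag_mult_carrier[OF Z]] using le by (intro sum_mono) auto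
  also have "\<dots> = (\<Sum>i<n. if i \<in> {..<m} then \<Sum>j<k. c\<^sup>2 * (Z $$ (i, j))\<^sup>2 else 0)"
    by (intro sum.cong) auto
  also have "\<dots> = (\<Sum>i\<in>{..<n} \<inter> {..<m}. \<Sum>j<k. c\<^sup>2 * (Z $$ (i, j))\<^sup>2)"
    by (rule sum.inter_restrict[symmetric]) simp
  also have "\<dots> \<le> (\<Sum>i<m. \<Sum>j<k. c\<^sup>2 * (Z $$ (i, j))\<^sup>2)"
    by (intro sum_mono2) (auto intro!: sum_nonneg)
  also have "\<dots> = (c * frob_norm Z)\<^sup>2"
    by (simp add: frob_norm_sq[OF Z] power_mult_distrib sum_distrib_left)
  finally show "frob_norm (rect_diag n m s * Z) \<le> c * frob_norm Z"
    by (rule power2_le_imp_le) (use c in simp)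
qed

section \<open>Coordinate projections to leading and trailing singular directions\<close>

definition head_diag :: "nat \<Rightarrow> nat \<Rightarrow> real mat" where
  "head_diag n r = rect_diag n n (map (\<lambda>i. if i < r then 1 else 0) [0..<n])"

definition tail_diag :: "nat \<Rightarrow> nat \<Rightarrow> real mat" where
  "tail_diag n r = rect_diag n n (map (\<lambda>i. if i < r then 0 else 1) [0..<n])"

lemma minus_zero_mat: "W \<in> carrier_mat n m \<Longrightarrow> W - 0\<^sub>m n m = (W :: real mat)"
  by (intro eq_matI) auto

lemma nth_default_map_upt: "nth_default 0 (map f [0..<n]) i = (if i < n then f i else 0)"
  by (auto simp: nth_default_def)

lemma head_diag_carrier [simp]: "head_diag n r \<in> carrier_mat n n"
  by (simp add: head_diag_def)

lemma tail_diag_carrier [simp]: "tail_diag n r \<in> carrier_mat n n"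
  by (simp add: tail_diag_def)

lemma head_diag_dim [simp]: "dim_row (head_diag n r) = n" "dim_col (head_diag n r) = n"
  by (simp_all add: head_diag_def)

lemma tail_diag_dim [simp]: "dim_row (tail_diag n r) = n" "dim_col (tail_diag n r) = n"
  by (simp_all add: tail_diag_def)

lemma head_diag_mult_index:
  "Z \<in> carrier_mat n m \<Longrightarrow> i < n \<Longrightarrow> j < m \<Longrightarrow>
    (head_diag n r * Z) $$ (i, j) = (if i < r then Z $$ (i, j) else 0)"
  unfolding head_diag_def by (subst rect_diag_mult_index) (auto simp: nth_default_map_upt)

lemma tail_diag_mult_index:
  "Z \<in> carrier_mat n m \<Longrightarrow> i < n \<Longrightarrow> j < m \<Longrightarrow>
    (tail_diag n r * Z) $$ (i, j) = (if i < r then 0 else Z $$ (i, j))"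
  unfolding tail_diag_def by (subst rect_diag_mult_index) (auto simp: nth_default_map_upt)

lemma mult_tail_diag_index:
  "Z \<in> carrier_mat n m \<Longrightarrow> i < n \<Longrightarrow> j < m \<Longrightarrow>
    (Z * tail_diag m r) $$ (i, j) = (if j < r then 0 else Z $$ (i, j))"
  unfolding tail_diag_def by (subst mult_rect_diag_index) (auto simp: nth_default_map_upt)

lemma head_diag_transpose: "transpose_mat (head_diag n r) = head_diag n r"
  by (simp add: head_diag_def rect_diag_transpose)

lemma tail_diag_transpose: "transpose_mat (tail_diag n r) = tail_diag n r"
  by (simp add: tail_diag_def rect_diag_transpose)

lemma op_bound_tail_diag: "op_bound (tail_diag n r) 1"
  unfolding tail_diag_def by (rule op_bound_rect_diag) (auto simp: nth_default_map_upt)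

lemma head_diag_plus_tail_diag: "head_diag n r + tail_diag n r = 1\<^sub>m n"
  by (rule eq_matI) (auto simp: head_diag_def tail_diag_def rect_diag_index nth_default_map_upt)

lemma frob_norm_head_diag:
  assumes "r \<le> n"
  shows "frob_norm (head_diag n r) = sqrt (real r)"
proof -
  have "(frob_norm (head_diag n r))\<^sup>2 = (\<Sum>i<n. \<Sum>j<n. if j = i then if i < r then 1 else 0 else 0)"
    unfolding frob_norm_sq[OF head_diag_carrier]
    by (intro sum.cong) (auto simp: head_diag_def rect_diag_index nth_default_map_upt)
  also have "\<dots> = (\<Sum>i<n. if i < r then 1 else 0)" by (intro sum.cong) auto
  also have "\<dots> = (\<Sum>i<r. 1)" using assms by (intro sum.mono_neutral_cong_right) auto
  finally show ?thesis by (simp add: real_sqrt_unique)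
qed

text \<open>The leading left singular vectors satisfy \<open>U\<^sub>r = X V\<^sub>r \<Sigma>\<^sub>r\<^sup>-\<^sup>1\<close>, and \<open>Q X = Q (X - X\<^sub>0)\<close>
  once \<open>Q\<close> annihilates \<open>X\<^sub>0\<close>.\<close>

lemma op_bound_head_block:
  assumes U: "U \<in> carrier_mat n n" and V: "V \<in> carrier_mat m m" "transpose_mat V * V = 1\<^sub>m m"
    and X: "X = U * rect_diag n m s * transpose_mat V" and X0: "X0 \<in> carrier_mat n m"
    and Q: "Q \<in> carrier_mat n n" "op_bound Q 1" "Q * X0 = 0\<^sub>m n m"
    and \<delta>: "op_bound (X - X0) \<delta>" and r: "r \<le> n" "r \<le> m"
    and s: "\<And>i. i < r \<Longrightarrow> \<sigma> \<le> nth_default 0 s i" and \<sigma>: "0 < \<sigma>"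
  shows "op_bound (Q * (U * head_diag n r)) (\<delta> / \<sigma>)"
proof -
  \<comment> \<open>\<open>R\<close> inverts the leading \<open>r\<close> singular values and is
    zero elsewhere, so \<open>X V R\<close> consists of the leading left singular vectors.\<close>
  define R where "R = rect_diag m n (map (\<lambda>i. if i < r then 1 / nth_default 0 s i else 0) [0..<m])"
  have R: "R \<in> carrier_mat m n" by (simp add: R_def)
  let ?S = "rect_diag n m s"
  have VT: "transpose_mat V \<in> carrier_mat m m" using V(1) by simp
  have US: "U * ?S \<in> carrier_mat n m" by (rule mult_carrier_mat[OF U rect_diag_carrier])
  have XC: "X \<in> carrier_mat n m" unfolding X by (rule mult_carrier_mat[OF US VT])
  have D: "X - X0 \<in> carrier_mat n m" by (rule minus_carrier_mat[OF X0])
  have VR: "V * R \<in> carrier_mat m n" by (rule mult_carrier_mat[OF V(1) R])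
  have SR: "?S * R = head_diag n r"
  proof (rule eq_matI)
    fix i j assume "i < dim_row (head_diag n r)" "j < dim_col (head_diag n r)"
    then have ij: "i < n" "j < n" by auto
    show "(?S * R) $$ (i, j) = head_diag n r $$ (i, j)"
      unfolding rect_diag_mult_index[OF R ij] using ij r s[of i] \<sigma>
      by (auto simp: R_def head_diag_def rect_diag_index nth_default_map_upt)
  qed (use R in auto)
  have "X * (V * R) = U * ?S * (transpose_mat V * (V * R))"
    unfolding X by (rule assoc_mult_mat[OF US VT VR])
  also have "transpose_mat V * (V * R) = R"
    unfolding assoc_mult_mat[OF VT V(1) R, symmetric] V(2) by (rule left_mult_one_mat[OF R])
  also have "U * ?S * R = U * (?S * R)" by (rule assoc_mult_mat[OF U rect_diag_carrier R])
  finally have XVR: "X * (V * R) = U * head_diag n r" unfolding SR .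
  have QD: "Q * (X - X0) = Q * X"
    unfolding mult_minus_distrib_mat[OF Q(1) XC X0] Q(3) by (rule minus_zero_mat[OF mult_carrier_mat[OF Q(1) XC]])
  have "Q * (U * head_diag n r) = Q * X * (V * R)"
    unfolding XVR[symmetric] by (rule assoc_mult_mat[OF Q(1) XC VR, symmetric])
  then have eq: "Q * (U * head_diag n r) = Q * (X - X0) * (V * R)" unfolding QD .
  have "op_bound R (1 / \<sigma>)"
    unfolding R_def
  proof (rule op_bound_rect_diag)
    fix i assume "i < min m n"
    then show "\<bar>nth_default 0 (map (\<lambda>i. if i < r then 1 / nth_default 0 s i else 0) [0..<m]) i\<bar> \<le> 1 / \<sigma>"
      using s[of i] \<sigma> by (auto simp: nth_default_map_upt frac_le)
  qed (use \<sigma> in auto)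
  then have VR1: "op_bound (V * R) (1 * (1 / \<sigma>))"
    by (rule op_bound_mult[OF op_bound_isometry[OF V] _ V(1) R])
  have "op_bound (Q * (X - X0)) (1 * \<delta>)" by (rule op_bound_mult[OF Q(2) \<delta> Q(1) D])
  then have "op_bound (Q * (X - X0) * (V * R)) (1 * \<delta> * (1 * (1 / \<sigma>)))"
    using VR1 by (rule op_bound_mult[OF _ _ mult_carrier_mat[OF Q(1) D] VR])
  then show ?thesis unfolding eq by simp
qed

text \<open>\<open>X0\<close> is \<open>X\<close> plus a difference. In the trailing left singular
  directions \<open>X\<close> has only singular values up to \<open>\<epsilon>\<close>, and the
  difference adds at most \<open>\<delta>\<close>.\<close>

lemma op_bound_tail_block:
  assumes U: "U \<in> carrier_mat n n" "transpose_mat U * U = 1\<^sub>m n"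
    and V: "V \<in> carrier_mat m m" "transpose_mat V * V = 1\<^sub>m m"
    and X: "X = U * rect_diag n m s * transpose_mat V" and X0: "X0 \<in> carrier_mat n m"
    and \<delta>: "op_bound (X0 - X) \<delta>"
    and s: "\<And>i. r \<le> i \<Longrightarrow> \<bar>nth_default 0 s i\<bar> \<le> \<epsilon>" and \<epsilon>: "0 \<le> \<epsilon>"
  shows "op_bound (tail_diag n r * transpose_mat U * X0) (\<epsilon> + \<delta>)"
proof -
  let ?S = "rect_diag n m s" and ?T = "tail_diag n r * transpose_mat U"
  have VT: "transpose_mat V \<in> carrier_mat m m" and UT: "transpose_mat U \<in> carrier_mat n n"
    using U(1) V(1) by simp_all
  have US: "U * ?S \<in> carrier_mat n m" by (rule mult_carrier_mat[OF U(1) rect_diag_carrier])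
  have XC: "X \<in> carrier_mat n m" unfolding X by (rule mult_carrier_mat[OF US VT])
  have D: "X0 - X \<in> carrier_mat n m" by (rule minus_carrier_mat[OF XC])
  have T: "?T \<in> carrier_mat n n" by (rule mult_carrier_mat[OF tail_diag_carrier UT])
  have T1: "op_bound ?T (1 * 1)"
    by (rule op_bound_mult[OF op_bound_tail_diag op_bound_transpose[OF op_bound_isometry[OF U]]
      tail_diag_carrier UT])
  have TS: "tail_diag n r * ?S = rect_diag n m (map (\<lambda>i. if i < r then 0 else nth_default 0 s i) [0..<n])"
  proof (rule eq_matI)
    fix i j assume "i < dim_row (rect_diag n m (map (\<lambda>i. if i < r then 0 else nth_default 0 s i) [0..<n]))"
      "j < dim_col (rect_diag n m (map (\<lambda>i. if i < r then 0 else nth_default 0 s i) [0..<n]))"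
    then have ij: "i < n" "j < m" by auto
    show "(tail_diag n r * ?S) $$ (i, j)
      = rect_diag n m (map (\<lambda>i. if i < r then 0 else nth_default 0 s i) [0..<n]) $$ (i, j)"
      unfolding tail_diag_mult_index[OF rect_diag_carrier ij] using ij
      by (auto simp: rect_diag_index nth_default_map_upt)
  qed auto
  have "U * (?S * transpose_mat V) = X"
    unfolding X by (rule assoc_mult_mat[OF U(1) rect_diag_carrier VT, symmetric])
  moreover have SV: "?S * transpose_mat V \<in> carrier_mat n m" by (rule mult_carrier_mat[OF rect_diag_carrier VT])
  ultimately have "transpose_mat U * X = ?S * transpose_mat V"
    using assoc_mult_mat[OF UT U(1) SV] U(2) left_mult_one_mat[OF SV] by simp
  then have "?T * X = tail_diag n r * ?S * transpose_mat V"
    using assoc_mult_mat[OF tail_diag_carrier UT XC] assoc_mult_mat[OF tail_diag_carrier rect_diag_carrier VT]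
    by simp
  moreover have "op_bound (tail_diag n r * ?S) \<epsilon>"
    unfolding TS using s \<epsilon> by (intro op_bound_rect_diag) (auto simp: nth_default_map_upt)
  ultimately have TX: "op_bound (?T * X) (\<epsilon> * 1)"
    using op_bound_mult[OF _ op_bound_transpose[OF op_bound_isometry[OF V]]
      mult_carrier_mat[OF tail_diag_carrier rect_diag_carrier] VT] by metis
  have "X0 = X + (X0 - X)" by (rule add_minus_cancel_mat[OF X0 XC, symmetric])
  then have "?T * X0 = ?T * X + ?T * (X0 - X)"
    using mult_add_distrib_mat[OF T XC D] by simp
  moreover have "op_bound (?T * X + ?T * (X0 - X)) (\<epsilon> * 1 + 1 * 1 * \<delta>)"
    by (rule op_bound_add[OF TX op_bound_mult[OF T1 \<delta> T D] mult_carrier_mat[OF T XC] mult_carrier_mat[OF T D]])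
  ultimately show ?thesis by simp
qed

text \<open>This compares the parts of \<open>Z\<close> normal to two tangent spaces. The pieces
  \<open>P Z\<close> and \<open>P' Z S\<close> meet one of the small products \<open>Q P\<close> and
  \<open>S R\<close>; what is left is \<open>P' Z S'\<close>, the normal part for the second
  space.\<close>

lemma frob_norm_two_sided_split:
  assumes Q: "Q \<in> carrier_mat n n" "op_bound Q 1" and R: "R \<in> carrier_mat m m" "op_bound R 1"
    and P: "P \<in> carrier_mat n n" "P' \<in> carrier_mat n n" "P + P' = 1\<^sub>m n" "op_bound P' 1"
    and S: "S \<in> carrier_mat m m" "S' \<in> carrier_mat m m" "S + S' = 1\<^sub>m m"
    and QP: "op_bound (Q * P) a" and SR: "op_bound (S * R) a" and Z: "Z \<in> carrier_mat n m"
  shows "frob_norm (Q * Z * R) \<le> 2 * a * frob_norm Z + frob_norm (P' * Z * S')"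
proof -
  have a0: "a \<ge> 0" using QP op_bound_nonneg by blast
  have PZ: "P * Z \<in> carrier_mat n m" and PZ': "P' * Z \<in> carrier_mat n m"
    using mult_carrier_mat[OF P(1) Z] mult_carrier_mat[OF P(2) Z] .
  have PZS: "P' * Z * S \<in> carrier_mat n m" and PZS': "P' * Z * S' \<in> carrier_mat n m"
    using mult_carrier_mat[OF PZ' S(1)] mult_carrier_mat[OF PZ' S(2)] .
  have 1: "Z = P * Z + P' * Z"
    using add_mult_distrib_mat[OF P(1,2) Z] P(3) left_mult_one_mat[OF Z] by simp
  have 2: "P' * Z = P' * Z * S + P' * Z * S'"
    using mult_add_distrib_mat[OF PZ' S(1,2)] S(3) right_mult_one_mat[OF PZ'] by simp
  have tail: "frob_norm (Q * W * R) \<le> frob_norm (W * R)" if W: "W \<in> carrier_mat n m" for W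
    using op_boundD[OF Q(2,1) mult_carrier_mat[OF W R(1)]] assoc_mult_mat[OF Q(1) W R(1)] by simp
  have tail': "frob_norm (W * R) \<le> frob_norm W" if W: "W \<in> carrier_mat n m" for W
    using op_bound_right[OF R(2,1) W] by simp
  have c: "Q * W \<in> carrier_mat n m" if "W \<in> carrier_mat n m" for W by (rule mult_carrier_mat[OF Q(1) that])
  have c': "Q * W * R \<in> carrier_mat n m" if "W \<in> carrier_mat n m" for W
    by (rule mult_carrier_mat[OF c[OF that] R(1)])
  have "Q * Z = Q * (P * Z) + Q * (P' * Z)"
    using mult_add_distrib_mat[OF Q(1) PZ PZ'] 1 by simp
  then have "Q * Z * R = Q * (P * Z) * R + Q * (P' * Z) * R"
    using add_mult_distrib_mat[OF c[OF PZ] c[OF PZ'] R(1)] by simp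
  then have "frob_norm (Q * Z * R) \<le> frob_norm (Q * (P * Z) * R) + frob_norm (Q * (P' * Z) * R)"
    using frob_norm_triangle[OF c'[OF PZ] c'[OF PZ']] by simp
  also have "frob_norm (Q * (P * Z) * R) \<le> a * frob_norm Z"
  proof -
    have "frob_norm (Q * (P * Z) * R) \<le> frob_norm (Q * P * Z)"
      using tail'[OF c[OF PZ]] assoc_mult_mat[OF Q(1) P(1) Z] by simp
    also have "\<dots> \<le> a * frob_norm Z" by (rule op_boundD[OF QP mult_carrier_mat[OF Q(1) P(1)] Z])
    finally show ?thesis .
  qed
  also have "frob_norm (Q * (P' * Z) * R) \<le> a * frob_norm Z + frob_norm (P' * Z * S')"
  proof -
    have "P' * Z * R = P' * Z * S * R + P' * Z * S' * R"
      using add_mult_distrib_mat[OF PZS PZS' R(1)] 2 by simp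
    then have "frob_norm (P' * Z * R) \<le> frob_norm (P' * Z * S * R) + frob_norm (P' * Z * S' * R)"
      using frob_norm_triangle[OF mult_carrier_mat[OF PZS R(1)] mult_carrier_mat[OF PZS' R(1)]] by simp
    also have "frob_norm (P' * Z * S * R) \<le> a * frob_norm Z"
    proof -
      have "frob_norm (P' * Z * S * R) \<le> a * frob_norm (P' * Z)"
        using op_bound_right[OF SR mult_carrier_mat[OF S(1) R(1)] PZ'] assoc_mult_mat[OF PZ' S(1) R(1)] by simp
      also have "\<dots> \<le> a * (1 * frob_norm Z)"
        by (rule mult_left_mono[OF op_boundD[OF P(4,2) Z] a0])
      finally show ?thesis by simp
    qed
    also have "frob_norm (P' * Z * S' * R) \<le> frob_norm (P' * Z * S')" by (rule tail'[OF PZS'])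
    finally show ?thesis using tail[OF PZ'] by linarith
  qed
  finally show ?thesis by simp
qed

section \<open>Projections complementary to orthonormal columns\<close>

definition co_proj :: "nat \<Rightarrow> real mat \<Rightarrow> real mat" where
  "co_proj n U = 1\<^sub>m n - U * transpose_mat U"

lemma co_proj:
  assumes U: "U \<in> carrier_mat n r" "transpose_mat U * U = 1\<^sub>m r"
  shows co_proj_carrier: "co_proj n U \<in> carrier_mat n n"
    and co_proj_transpose: "transpose_mat (co_proj n U) = co_proj n U"
    and co_proj_mult: "co_proj n U * U = 0\<^sub>m n r"
    and co_proj_idem: "co_proj n U * co_proj n U = co_proj n U"
    and op_bound_co_proj: "op_bound (co_proj n U) 1"
proof -
  have UT: "transpose_mat U \<in> carrier_mat r n" using U(1) by simp
  have UU: "U * transpose_mat U \<in> carrier_mat n n" by (rule mult_carrier_mat[OF U(1) UT])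
  show C: "co_proj n U \<in> carrier_mat n n" unfolding co_proj_def by (rule minus_carrier_mat[OF UU])
  have "transpose_mat (U * transpose_mat U) = U * transpose_mat U"
    using transpose_mult[OF U(1) UT] by simp
  then show T: "transpose_mat (co_proj n U) = co_proj n U"
    unfolding co_proj_def using transpose_minus[OF one_carrier_mat UU] by simp
  have "U * transpose_mat U * U = U"
    using assoc_mult_mat[OF U(1) UT U(1)] U(2) right_mult_one_mat[OF U(1)] by simp
  then have "co_proj n U * U = U - U"
    unfolding co_proj_def using minus_mult_distrib_mat[OF one_carrier_mat UU U(1)] left_mult_one_mat[OF U(1)] by simp
  then show M: "co_proj n U * U = 0\<^sub>m n r" using minus_r_inv_mat[OF U(1)] by simp
  have "co_proj n U * (U * transpose_mat U) = 0\<^sub>m n r * transpose_mat U"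
    unfolding M[symmetric] by (rule assoc_mult_mat[OF C U(1) UT, symmetric])
  also have "\<dots> = 0\<^sub>m n n" using UT by (rule left_mult_zero_mat)
  finally have z: "co_proj n U * (U * transpose_mat U) = 0\<^sub>m n n" .
  have "co_proj n U * co_proj n U = co_proj n U * 1\<^sub>m n - co_proj n U * (U * transpose_mat U)"
    by (subst (2) co_proj_def) (rule mult_minus_distrib_mat[OF C one_carrier_mat UU])
  then show I: "co_proj n U * co_proj n U = co_proj n U"
    unfolding z right_mult_one_mat[OF C] using minus_zero_mat[OF C] by simp
  show "op_bound (co_proj n U) 1"
  proof (rule op_boundI[OF C])
    fix k and Z :: "real mat" assume Z: "Z \<in> carrier_mat n k"
    let ?Y = "co_proj n U * Z"
    have Y: "?Y \<in> carrier_mat n k" by (rule mult_carrier_mat[OF C Z])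
    have "(frob_norm ?Y)\<^sup>2 = frob_inner Z (transpose_mat (co_proj n U) * ?Y)"
      unfolding frob_norm_sq_inner by (rule frob_inner_adjoint[OF C Z Y])
    also have "transpose_mat (co_proj n U) * ?Y = ?Y"
      unfolding T assoc_mult_mat[OF C C Z, symmetric] I ..
    also have "frob_inner Z ?Y \<le> frob_norm Z * frob_norm ?Y" using frob_inner_le[OF Z Y] by simp
    finally have *: "frob_norm ?Y * frob_norm ?Y \<le> frob_norm Z * frob_norm ?Y" by (simp add: power2_eq_square)
    show "frob_norm ?Y \<le> 1 * frob_norm Z"
    proof (cases "frob_norm ?Y = 0")
      case False
      then have "frob_norm ?Y > 0" using frob_norm_nonneg[of ?Y] by linarith
      then show ?thesis using mult_right_le_imp_le[OF *] by simp
    qed simp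
  qed simp
qed

lemma orth_svd_transpose:
  assumes X: "orth_svd n m X U s V"
  shows "orth_svd m n (transpose_mat X) V s U"
proof -
  define p where "p = length s"
  note x = X[unfolded orth_svd_def, folded p_def]
  have U: "U \<in> carrier_mat n p" and V: "V \<in> carrier_mat m p" and Xe: "X = U * rect_diag p p s * transpose_mat V"
    using x by auto
  have VT: "transpose_mat V \<in> carrier_mat p m" and UT: "transpose_mat U \<in> carrier_mat p n" using V U by auto
  have "transpose_mat X = V * (rect_diag p p s * transpose_mat U)"
    unfolding Xe transpose_mult[OF mult_carrier_mat[OF U rect_diag_carrier] VT]
      transpose_mult[OF U rect_diag_carrier] rect_diag_transpose transpose_transpose ..
  also have "\<dots> = V * rect_diag p p s * transpose_mat U"
    by (rule assoc_mult_mat[OF V rect_diag_carrier UT, symmetric])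
  finally show ?thesis using x unfolding orth_svd_def p_def[symmetric] by simp
qed

lemma full_svd_transpose:
  assumes XC: "X \<in> carrier_mat n m" and X: "full_svd X U s V"
  shows "full_svd (transpose_mat X) V s U"
proof -
  note x = X[unfolded full_svd_iff[OF XC]]
  have U: "U \<in> carrier_mat n n" and V: "V \<in> carrier_mat m m" and Xe: "X = U * rect_diag n m s * transpose_mat V"
    using x by auto
  have VT: "transpose_mat V \<in> carrier_mat m m" and UT: "transpose_mat U \<in> carrier_mat n n" using V U by auto
  have "transpose_mat X = V * (rect_diag m n s * transpose_mat U)"
    unfolding Xe transpose_mult[OF mult_carrier_mat[OF U rect_diag_carrier] VT]
      transpose_mult[OF U rect_diag_carrier] rect_diag_transpose transpose_transpose ..
  also have "\<dots> = V * rect_diag m n s * transpose_mat U"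
    by (rule assoc_mult_mat[OF V rect_diag_carrier UT, symmetric])
  finally show ?thesis using x XC by (subst full_svd_iff[of _ m n]) auto
qed

text \<open>One iterate \<open>X\<close> near the target \<open>X0\<close> of rank \<open>r\<close>.
  As \<open>\<delta>\<close> is at most half of the smallest nonzero singular value of
  \<open>X0\<close>, Weyl's inequality keeps the first \<open>r\<close> singular values of
  \<open>X\<close> at least half as large as that value, and the others at most
  \<open>\<delta>\<close>.\<close>

locale svd_pair =
  fixes d1 d2 r :: nat and X0 X U V U0 V0 :: "real mat" and s s0 :: "real list" and \<delta> :: real
  assumes X0: "orth_svd d1 d2 X0 U0 s0 V0" and s0: "length s0 = r" and r1: "1 \<le> r"
    and rd: "r \<le> d1" "r \<le> d2" and XC: "X \<in> carrier_mat d1 d2"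
    and X: "full_svd X U s V" and \<delta>: "op_bound (X - X0) \<delta>"
    and \<delta>\<sigma>: "\<delta> \<le> nth_default 0 s0 (r - 1) / 2" and \<sigma>_pos: "0 < nth_default 0 s0 (r - 1)"
begin

definition \<sigma> :: real where "\<sigma> = nth_default 0 s0 (r - 1)"
definition \<epsilon> :: real where "\<epsilon> = nth_default 0 s r"

lemma \<sigma>: "0 < \<sigma>" "\<delta> \<le> \<sigma> / 2"
  using \<delta>\<sigma> \<sigma>_pos by (simp_all add: \<sigma>_def)

lemma \<delta>_nonneg: "0 \<le> \<delta>" using \<delta> by (rule op_bound_nonneg)

lemmas X' = X[unfolded full_svd_iff[OF XC]]

lemma U: "U \<in> carrier_mat d1 d1" "transpose_mat U * U = 1\<^sub>m d1"
  and V: "V \<in> carrier_mat d2 d2" "transpose_mat V * V = 1\<^sub>m d2"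
  and s: "length s = min d1 d2" "sorted_wrt (\<ge>) s" "\<forall>x\<in>set s. 0 \<le> x"
  and Xeq: "X = U * rect_diag d1 d2 s * transpose_mat V"
  using X' by blast+

lemma U0: "U0 \<in> carrier_mat d1 r" "transpose_mat U0 * U0 = 1\<^sub>m r"
  and V0: "V0 \<in> carrier_mat d2 r" "transpose_mat V0 * V0 = 1\<^sub>m r"
  and s0': "sorted_wrt (\<ge>) s0" "\<forall>x\<in>set s0. 0 \<le> x"
  and X0eq: "X0 = U0 * rect_diag r r s0 * transpose_mat V0"
  using X0 unfolding orth_svd_def s0 by blast+

lemma U0T: "transpose_mat U0 \<in> carrier_mat r d1" and V0T: "transpose_mat V0 \<in> carrier_mat r d2"
  and UT: "transpose_mat U \<in> carrier_mat d1 d1" and VT: "transpose_mat V \<in> carrier_mat d2 d2"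
  using U0 V0 U V by simp_all

lemma X0C: "X0 \<in> carrier_mat d1 d2"
  unfolding X0eq using mult_carrier_mat[OF mult_carrier_mat[OF U0(1) rect_diag_carrier] V0T] .

lemma \<delta>': "op_bound (X0 - X) \<delta>"
  by (rule op_bound_minus_commute[OF XC X0C \<delta>])

lemma s_head: "i < r \<Longrightarrow> \<sigma> / 2 \<le> nth_default 0 s i"
proof -
  assume i: "i < r"
  have "\<sigma> \<le> nth_default 0 s (r - 1) + \<delta>"
    unfolding \<sigma>_def by (rule orth_svd_weyl[OF X0 full_svd_imp_orth_svd[OF X XC] \<delta>'])
  moreover have "nth_default 0 s (r - 1) \<le> nth_default 0 s i"
    using s i by (intro nth_default_antimono) auto
  ultimately show ?thesis using \<sigma> by linarith
qed

lemma \<epsilon>_nonneg: "0 \<le> \<epsilon>"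
  unfolding \<epsilon>_def using s(3) by (rule nth_default_nonneg)

lemma \<epsilon>_le: "\<epsilon> \<le> \<delta>"
  using orth_svd_weyl[OF full_svd_imp_orth_svd[OF X XC] X0 \<delta>, of r] s0 by (simp add: \<epsilon>_def nth_default_beyond)

lemma s_tail: "r \<le> i \<Longrightarrow> nth_default 0 s i \<le> \<epsilon>"
  unfolding \<epsilon>_def using s by (intro nth_default_antimono)

text \<open>Bounds are proved for left singular vectors; interpreting the locale at the transposed
  pair supplies those for the right ones.\<close>

lemma svd_pair_transpose:
  "svd_pair d2 d1 r (transpose_mat X0) (transpose_mat X) V U V0 U0 s s0 \<delta>"
proof
  show "op_bound (transpose_mat X - transpose_mat X0) \<delta>"
    using op_bound_transpose[OF \<delta>] transpose_minus[OF XC X0C] by simp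
qed (use orth_svd_transpose[OF X0] full_svd_transpose[OF XC X] s0 r1 rd XC \<delta>\<sigma> \<sigma>_pos in auto)

lemma co_proj_X0: "co_proj d1 U0 * X0 = 0\<^sub>m d1 d2"
proof -
  note C = co_proj_carrier[OF U0]
  have SV: "rect_diag r r s0 * transpose_mat V0 \<in> carrier_mat r d2" by (rule mult_carrier_mat[OF rect_diag_carrier V0T])
  have "X0 = U0 * (rect_diag r r s0 * transpose_mat V0)"
    unfolding X0eq by (rule assoc_mult_mat[OF U0(1) rect_diag_carrier V0T])
  then have "co_proj d1 U0 * X0 = co_proj d1 U0 * U0 * (rect_diag r r s0 * transpose_mat V0)"
    using assoc_mult_mat[OF C U0(1) SV] by simp
  then show ?thesis unfolding co_proj_mult[OF U0] using left_mult_zero_mat[OF SV] by simp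
qed

definition head_proj :: "real mat" where "head_proj = U * head_diag d1 r * transpose_mat U"
definition tail_proj :: "real mat" where "tail_proj = U * tail_diag d1 r * transpose_mat U"

lemma head_proj_carrier: "head_proj \<in> carrier_mat d1 d1" and tail_proj_carrier: "tail_proj \<in> carrier_mat d1 d1"
  unfolding head_proj_def tail_proj_def
  using mult_carrier_mat[OF mult_carrier_mat[OF U(1) head_diag_carrier] UT]
    mult_carrier_mat[OF mult_carrier_mat[OF U(1) tail_diag_carrier] UT] .

lemma head_proj_transpose: "transpose_mat head_proj = head_proj"
  unfolding head_proj_def transpose_mult[OF mult_carrier_mat[OF U(1) head_diag_carrier] UT]
    transpose_mult[OF U(1) head_diag_carrier] head_diag_transpose transpose_transpose
  by (rule assoc_mult_mat[OF U(1) head_diag_carrier UT, symmetric])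

lemma proj_sum: "head_proj + tail_proj = 1\<^sub>m d1"
proof -
  have "head_proj + tail_proj = (U * head_diag d1 r + U * tail_diag d1 r) * transpose_mat U"
    unfolding head_proj_def tail_proj_def
    by (rule add_mult_distrib_mat[OF mult_carrier_mat[OF U(1) head_diag_carrier]
      mult_carrier_mat[OF U(1) tail_diag_carrier] UT, symmetric])
  also have "U * head_diag d1 r + U * tail_diag d1 r = U * 1\<^sub>m d1"
    unfolding head_diag_plus_tail_diag[of d1 r, symmetric]
    by (rule mult_add_distrib_mat[OF U(1) head_diag_carrier tail_diag_carrier, symmetric])
  finally show ?thesis using right_mult_one_mat[OF U(1)] orthogonal_transpose[OF U] by simp
qed

lemma op_bound_tail_proj: "op_bound tail_proj 1"
proof -
  have "op_bound (U * tail_diag d1 r) (1 * 1)"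
    by (rule op_bound_mult[OF op_bound_isometry[OF U] op_bound_tail_diag U(1) tail_diag_carrier])
  then have "op_bound tail_proj (1 * 1 * 1)"
    unfolding tail_proj_def by (rule op_bound_mult[OF _ op_bound_transpose[OF op_bound_isometry[OF U]]
      mult_carrier_mat[OF U(1) tail_diag_carrier] UT])
  then show ?thesis by simp
qed

text \<open>A bound of Wedin type for the sine of the angle between the leading left singular spaces
  of \<open>X\<close> and \<open>X0\<close>. The factor 2 comes from the lower bound
  \<open>\<sigma> / 2\<close> in \<open>s_head\<close>.\<close>

lemma op_bound_co_head_proj: "op_bound (co_proj d1 U0 * head_proj) (2 * \<delta> / \<sigma>)"
proof -
  note C = co_proj_carrier[OF U0]
  have UD: "U * head_diag d1 r \<in> carrier_mat d1 d1" by (rule mult_carrier_mat[OF U(1) head_diag_carrier])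
  have "op_bound (co_proj d1 U0 * (U * head_diag d1 r)) (\<delta> / (\<sigma> / 2))"
    by (rule op_bound_head_block[OF U(1) V Xeq X0C C op_bound_co_proj[OF U0] co_proj_X0 \<delta> rd s_head])
      (use \<sigma> in auto)
  then have "op_bound (co_proj d1 U0 * (U * head_diag d1 r) * transpose_mat U) (\<delta> / (\<sigma> / 2) * 1)"
    by (rule op_bound_mult[OF _ op_bound_transpose[OF op_bound_isometry[OF U]]
      mult_carrier_mat[OF C UD] UT])
  then show ?thesis unfolding head_proj_def assoc_mult_mat[OF C UD UT] by (simp add: mult.commute)
qed

lemma op_bound_tail_X0: "op_bound (tail_diag d1 r * transpose_mat U * X0) (2 * \<delta>)"
proof -
  have "op_bound (tail_diag d1 r * transpose_mat U * X0) (\<epsilon> + \<delta>)"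
    by (rule op_bound_tail_block[OF U V Xeq X0C \<delta>' _ \<epsilon>_nonneg])
      (use s_tail nth_default_nonneg[OF s(3)] in auto)
  then show ?thesis by (rule op_bound_mono) (use \<epsilon>_le in auto)
qed

end

section \<open>Coordinates in the singular bases of the iterate\<close>

context svd_pair
begin

definition coord :: "real mat \<Rightarrow> real mat" where
  "coord Z = transpose_mat U * Z * V"

text \<open>In coordinates, the part of \<open>Z\<close> normal to the tangent space at the rank
  \<open>r\<close> truncation of \<open>X\<close>.\<close>

definition tail_block :: "real mat \<Rightarrow> real mat" where
  "tail_block Z = tail_diag d1 r * coord Z * tail_diag d2 r"

lemma coord_carrier: "Z \<in> carrier_mat d1 d2 \<Longrightarrow> coord Z \<in> carrier_mat d1 d2"
  unfolding coord_def by (rule mult_carrier_mat[OF mult_carrier_mat[OF UT] V(1)])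

lemma frob_norm_coord:
  assumes Z: "Z \<in> carrier_mat d1 d2"
  shows "frob_norm (coord Z) = frob_norm Z"
proof -
  have UZ: "transpose_mat U * Z \<in> carrier_mat d1 d2" by (rule mult_carrier_mat[OF UT Z])
  have "transpose_mat (transpose_mat V) * transpose_mat V = 1\<^sub>m d2"
    "transpose_mat (transpose_mat U) * transpose_mat U = 1\<^sub>m d1"
    using orthogonal_transpose[OF V] orthogonal_transpose[OF U] by simp_all
  then show ?thesis unfolding coord_def
    using frob_norm_isometry_right[OF VT _ UZ] frob_norm_isometry[OF UT _ Z] by simp
qed

lemma coord_add:
  assumes "Y \<in> carrier_mat d1 d2" "Z \<in> carrier_mat d1 d2"
  shows "coord (Y + Z) = coord Y + coord Z"
  unfolding coord_def mult_add_distrib_mat[OF UT assms]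
  by (rule add_mult_distrib_mat[OF mult_carrier_mat[OF UT assms(1)] mult_carrier_mat[OF UT assms(2)] V(1)])

lemma coord_X: "coord X = rect_diag d1 d2 s"
proof -
  have SV: "rect_diag d1 d2 s * transpose_mat V \<in> carrier_mat d1 d2" by (rule mult_carrier_mat[OF rect_diag_carrier VT])
  have "transpose_mat U * X = transpose_mat U * (U * (rect_diag d1 d2 s * transpose_mat V))"
    using Xeq assoc_mult_mat[OF U(1) rect_diag_carrier VT] by simp
  also have "\<dots> = rect_diag d1 d2 s * transpose_mat V"
    unfolding assoc_mult_mat[OF UT U(1) SV, symmetric] U(2) by (rule left_mult_one_mat[OF SV])
  finally have "coord X = rect_diag d1 d2 s * (transpose_mat V * V)"
    unfolding coord_def using assoc_mult_mat[OF rect_diag_carrier VT V(1)] by simp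
  then show ?thesis unfolding V(2) using right_mult_one_mat[OF rect_diag_carrier] by simp
qed

lemma tail_block_carrier: "Z \<in> carrier_mat d1 d2 \<Longrightarrow> tail_block Z \<in> carrier_mat d1 d2"
  unfolding tail_block_def
  by (rule mult_carrier_mat[OF mult_carrier_mat[OF tail_diag_carrier coord_carrier] tail_diag_carrier])

lemma tail_block_index:
  assumes Z: "Z \<in> carrier_mat d1 d2" and ij: "i < d1" "j < d2"
  shows "tail_block Z $$ (i, j) = (if i < r \<or> j < r then 0 else coord Z $$ (i, j))"
  unfolding tail_block_def
    mult_tail_diag_index[OF mult_carrier_mat[OF tail_diag_carrier coord_carrier[OF Z]] ij]
    tail_diag_mult_index[OF coord_carrier[OF Z] ij] by simp

lemma frob_norm_tail_proj:
  assumes Z: "Z \<in> carrier_mat d1 d2"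
  shows "frob_norm (tail_proj * Z * svd_pair.tail_proj d2 r V) = frob_norm (tail_block Z)"
proof -
  interpret T: svd_pair d2 d1 r "transpose_mat X0" "transpose_mat X" V U V0 U0 s s0 \<delta>
    by (rule svd_pair_transpose)
  have d: "dim_row U = d1" "dim_col U = d1" "dim_row V = d2" "dim_col V = d2" "dim_row Z = d1" "dim_col Z = d2"
    using U V Z by auto
  have "tail_proj * Z * T.tail_proj = U * (tail_block Z * transpose_mat V)"
    unfolding tail_proj_def T.tail_proj_def tail_block_def coord_def
    by (simp only: assoc_mult_dim d index_mult_mat(2,3) index_transpose_mat(2,3) tail_diag_dim)
  then show ?thesis
    using frob_norm_isometry[OF U mult_carrier_mat[OF tail_block_carrier[OF Z] VT]]
      frob_norm_isometry_right[OF V tail_block_carrier[OF Z]] by simp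
qed

text \<open>The null space property refers to the singular spaces of \<open>X0\<close>. Moving it to
  those of \<open>X\<close> costs a multiple of \<open>\<delta> / \<sigma>\<close> times the norm of
  \<open>Z\<close>, which is absorbed on the left.\<close>

lemma frob_norm_le_tail_block:
  assumes Z: "Z \<in> carrier_mat d1 d2" and q: "1 \<le> q" "12 * q * \<delta> \<le> \<sigma>"
    and ns: "(frob_norm Z)\<^sup>2 \<le> (1 + q) * (frob_norm (co_proj d1 U0 * Z * co_proj d2 V0))\<^sup>2"
  shows "frob_norm Z \<le> 3 * sqrt q * frob_norm (tail_block Z)"
proof -
  interpret T: svd_pair d2 d1 r "transpose_mat X0" "transpose_mat X" V U V0 U0 s s0 \<delta>
    by (rule svd_pair_transpose)
  note C = co_proj_carrier[OF U0] and C' = co_proj_carrier[OF V0]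
  have "op_bound (transpose_mat (co_proj d2 V0 * T.head_proj)) (2 * \<delta> / \<sigma>)"
    by (rule op_bound_transpose[OF T.op_bound_co_head_proj])
  moreover have "transpose_mat (co_proj d2 V0 * T.head_proj) = T.head_proj * co_proj d2 V0"
    unfolding transpose_mult[OF C' T.head_proj_carrier] T.head_proj_transpose co_proj_transpose[OF V0] ..
  ultimately have R: "op_bound (T.head_proj * co_proj d2 V0) (2 * \<delta> / \<sigma>)" by simp
  define a where "a = 2 * \<delta> / \<sigma>"
  have split: "frob_norm (co_proj d1 U0 * Z * co_proj d2 V0) \<le> 2 * a * frob_norm Z + frob_norm (tail_block Z)"
    unfolding a_def frob_norm_tail_proj[OF Z, symmetric]
    by (rule frob_norm_two_sided_split[OF C op_bound_co_proj[OF U0] C' op_bound_co_proj[OF V0]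
      head_proj_carrier tail_proj_carrier proj_sum op_bound_tail_proj
      T.head_proj_carrier T.tail_proj_carrier T.proj_sum op_bound_co_head_proj R Z])
  \<comment> \<open>\<open>g\<close> comes from \<open>1 + q \<le> 2 * q\<close>; the 3 in the claim
    is a bound for \<open>2 * sqrt 2\<close>.\<close>
  define g where "g = sqrt (2 * q)"
  have g: "g\<^sup>2 = 2 * q" "g \<ge> 0" using q by (auto simp: g_def)
  have gq: "g \<le> 3 / 2 * q"
  proof (rule power2_le_imp_le)
    have "2 * q \<le> 9 / 4 * (q * q)" using q mult_left_mono[of 1 q q] by simp
    then show "g\<^sup>2 \<le> (3 / 2 * q)\<^sup>2" unfolding g by (simp add: power2_eq_square)
  qed (use q in auto)
  have "(frob_norm Z)\<^sup>2 \<le> (g * frob_norm (co_proj d1 U0 * Z * co_proj d2 V0))\<^sup>2"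
    unfolding power_mult_distrib g(1) using q by (intro order_trans[OF ns] mult_right_mono) auto
  then have "frob_norm Z \<le> g * frob_norm (co_proj d1 U0 * Z * co_proj d2 V0)"
    by (rule power2_le_imp_le) (use g in simp)
  also have "\<dots> \<le> g * (2 * a * frob_norm Z + frob_norm (tail_block Z))"
    using split g by (intro mult_left_mono)
  finally have 1: "frob_norm Z \<le> (g * (2 * a)) * frob_norm Z + g * frob_norm (tail_block Z)"
    by (simp add: algebra_simps)
  \<comment> \<open>The assumption \<open>12 * q * \<delta> \<le> \<sigma>\<close> is tailored to
    this absorption: it makes the coefficient \<open>6 * q * \<delta> / \<sigma>\<close> at most one
    half.\<close>
  have "g * (2 * a) \<le> (3 / 2 * q) * (2 * a)"
    using gq \<sigma> \<delta>_nonneg by (intro mult_right_mono) (auto simp: a_def)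
  also have "\<dots> \<le> 1 / 2" using q(2) \<sigma> by (simp add: a_def field_simps)
  finally have "(g * (2 * a)) * frob_norm Z \<le> 1 / 2 * frob_norm Z" by (intro mult_right_mono) auto
  with 1 have "frob_norm Z \<le> 2 * g * frob_norm (tail_block Z)" by simp
  also have "2 * g \<le> 3 * sqrt q"
  proof (rule power2_le_imp_le)
    show "(2 * g)\<^sup>2 \<le> (3 * sqrt q)\<^sup>2" using q by (simp add: power_mult_distrib g(1))
  qed (use q in auto)
  finally show ?thesis by (simp add: mult_right_mono)
qed

text \<open>\<open>V0\<close> equals \<open>X0^T U0 R\<close> with \<open>R\<close> the inverse of
  the diagonal factor, so the tail bound for the transpose of \<open>X0\<close> applies. The
  Frobenius norm falls on the \<open>r\<close> by \<open>r\<close> matrix \<open>R\<close>, which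
  gives \<open>sqrt r\<close>.\<close>

lemma frob_norm_tail_V0: "frob_norm (tail_diag d2 r * transpose_mat V * V0) \<le> 2 * \<delta> * (sqrt (real r) / \<sigma>)"
proof -
  interpret T: svd_pair d2 d1 r "transpose_mat X0" "transpose_mat X" V U V0 U0 s s0 \<delta>
    by (rule svd_pair_transpose)
  define R where "R = rect_diag r r (map (\<lambda>i. 1 / nth_default 0 s0 i) [0..<r])"
  have R: "R \<in> carrier_mat r r" by (simp add: R_def)
  have s0i: "\<sigma> \<le> nth_default 0 s0 i" if "i < r" for i
    unfolding \<sigma>_def using s0' that by (intro nth_default_antimono) auto
  have SR: "rect_diag r r s0 * R = 1\<^sub>m r"
  proof (rule eq_matI)
    fix i j assume "i < dim_row (1\<^sub>m r :: real mat)" "j < dim_col (1\<^sub>m r :: real mat)"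
    then have ij: "i < r" "j < r" by auto
    show "(rect_diag r r s0 * R) $$ (i, j) = 1\<^sub>m r $$ (i, j)"
      unfolding rect_diag_mult_index[OF R ij] using ij s0i[of i] \<sigma>
      by (auto simp: R_def rect_diag_index nth_default_map_upt)
  qed (use R in auto)
  have UR: "U0 * R \<in> carrier_mat d1 r" by (rule mult_carrier_mat[OF U0(1) R])
  have SU: "rect_diag r r s0 * transpose_mat U0 \<in> carrier_mat r d1" by (rule mult_carrier_mat[OF rect_diag_carrier U0T])
  have "transpose_mat X0 * (U0 * R) = V0 * (rect_diag r r s0 * transpose_mat U0) * (U0 * R)"
    using T.X0eq assoc_mult_mat[OF V0(1) rect_diag_carrier U0T] by simp
  also have "\<dots> = V0 * (rect_diag r r s0 * transpose_mat U0 * (U0 * R))"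
    by (rule assoc_mult_mat[OF V0(1) SU UR])
  also have "rect_diag r r s0 * transpose_mat U0 * (U0 * R) = rect_diag r r s0 * (transpose_mat U0 * (U0 * R))"
    by (rule assoc_mult_mat[OF rect_diag_carrier U0T UR])
  also have "transpose_mat U0 * (U0 * R) = R"
    unfolding assoc_mult_mat[OF U0T U0(1) R, symmetric] U0(2) by (rule left_mult_one_mat[OF R])
  finally have V0eq: "transpose_mat X0 * (U0 * R) = V0" unfolding SR using right_mult_one_mat[OF V0(1)] by simp
  have TV: "tail_diag d2 r * transpose_mat V \<in> carrier_mat d2 d2" by (rule mult_carrier_mat[OF tail_diag_carrier VT])
  have X0T: "transpose_mat X0 \<in> carrier_mat d2 d1" using X0C by simp
  have "tail_diag d2 r * transpose_mat V * V0 = tail_diag d2 r * transpose_mat V * transpose_mat X0 * (U0 * R)"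
    unfolding assoc_mult_mat[OF TV X0T UR] V0eq ..
  then have "frob_norm (tail_diag d2 r * transpose_mat V * V0) \<le> 2 * \<delta> * frob_norm (U0 * R)"
    using op_boundD[OF T.op_bound_tail_X0 mult_carrier_mat[OF TV X0T] UR] by simp
  also have "frob_norm (U0 * R) = frob_norm R" by (rule frob_norm_isometry[OF U0 R])
  also have "frob_norm R \<le> 1 / \<sigma> * frob_norm (head_diag r r)"
  proof (rule frob_norm_le[OF R head_diag_carrier])
    fix i j assume ij: "i < r" "j < r"
    show "\<bar>R $$ (i, j)\<bar> \<le> 1 / \<sigma> * \<bar>head_diag r r $$ (i, j)\<bar>"
      using ij s0i[of i] \<sigma> by (auto simp: R_def head_diag_def rect_diag_index nth_default_map_upt frac_le)
  qed (use \<sigma> in auto)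
  also have "frob_norm (head_diag r r) = sqrt (real r)" by (rule frob_norm_head_diag) simp
  finally show ?thesis using \<delta>_nonneg by (simp add: mult_left_mono)
qed

text \<open>The tail block of the rank \<open>r\<close> matrix \<open>X\<^sub>0\<close> is a Schur complement, hence of second order.\<close>

lemma frob_norm_tail_block_X0: "frob_norm (tail_block X0) \<le> 4 * sqrt (real r) * \<delta>\<^sup>2 / \<sigma>"
proof -
  interpret T: svd_pair d2 d1 r "transpose_mat X0" "transpose_mat X" V U V0 U0 s s0 \<delta>
    by (rule svd_pair_transpose)
  have X0T: "transpose_mat X0 \<in> carrier_mat d2 d1" using X0C by simp
  have VV: "V0 * transpose_mat V0 \<in> carrier_mat d2 d2" by (rule mult_carrier_mat[OF V0(1) V0T])
  have T2: "tail_diag d2 r * transpose_mat V * V0 \<in> carrier_mat d2 r"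
    by (rule mult_carrier_mat[OF mult_carrier_mat[OF tail_diag_carrier VT] V0(1)])
  have T1: "tail_diag d1 r * transpose_mat U \<in> carrier_mat d1 d1" by (rule mult_carrier_mat[OF tail_diag_carrier UT])
  \<comment> \<open>Inserting the projection to the row space of \<open>X0\<close> splits its tail
    block into two tail factors, each of order \<open>\<delta>\<close>.\<close>
  have XV: "X0 * V0 * transpose_mat V0 = X0"
  proof -
    have d: "dim_row U0 = d1" "dim_col U0 = r" "dim_row V0 = d2" "dim_col V0 = r"
      using U0 V0 by auto
    have "X0 * V0 * transpose_mat V0 = U0 * (rect_diag r r s0 * (transpose_mat V0 * V0 * transpose_mat V0))"
      unfolding X0eq
      by (simp only: assoc_mult_dim d index_mult_mat(2,3) index_transpose_mat(2,3) rect_diag_dim)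
    also have "\<dots> = X0"
      unfolding V0(2) left_mult_one_mat[OF V0T] unfolding X0eq
      by (rule assoc_mult_mat[OF U0(1) rect_diag_carrier V0T, symmetric])
    finally show ?thesis .
  qed
  define W where "W = tail_diag d2 r * transpose_mat V * V0"
  have W: "W \<in> carrier_mat d2 r" using T2 by (simp add: W_def)
  have WT: "transpose_mat W = transpose_mat V0 * V * tail_diag d2 r"
  proof -
    have "transpose_mat W = transpose_mat V0 * (V * tail_diag d2 r)"
      unfolding W_def transpose_mult[OF mult_carrier_mat[OF tail_diag_carrier VT] V0(1)]
        transpose_mult[OF tail_diag_carrier VT] tail_diag_transpose transpose_transpose ..
    then show ?thesis using assoc_mult_mat[OF V0T V(1) tail_diag_carrier] by simp
  qed
  have "tail_block X0 = tail_diag d1 r * transpose_mat U * X0 * (V0 * transpose_mat W)"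
  proof -
    have d: "dim_row U = d1" "dim_col U = d1" "dim_row V = d2" "dim_col V = d2" "dim_row X0 = d1" "dim_col X0 = d2"
      "dim_row V0 = d2" "dim_col V0 = r"
      using U V X0C V0 by auto
    have "tail_block X0 = tail_diag d1 r * (transpose_mat U * (X0 * V0 * transpose_mat V0) * V) * tail_diag d2 r"
      unfolding XV tail_block_def coord_def ..
    also have "\<dots> = tail_diag d1 r * transpose_mat U * X0 * (V0 * transpose_mat W)"
      unfolding WT by (simp only: assoc_mult_dim d index_mult_mat(2,3) index_transpose_mat(2,3) tail_diag_dim)
    finally show ?thesis .
  qed
  moreover have VW: "V0 * transpose_mat W \<in> carrier_mat d2 d2"
    using W by (intro mult_carrier_mat[OF V0(1)]) simp
  ultimately have "frob_norm (tail_block X0) \<le> 2 * \<delta> * frob_norm (V0 * transpose_mat W)"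
    using op_boundD[OF op_bound_tail_X0 mult_carrier_mat[OF T1 X0C] VW] by simp
  also have "frob_norm (V0 * transpose_mat W) = frob_norm W"
    using frob_norm_isometry[OF V0, of "transpose_mat W" d2] W frob_norm_transpose[of W] by simp
  also have "2 * \<delta> * frob_norm W \<le> 2 * \<delta> * (2 * \<delta> * (sqrt (real r) / \<sigma>))"
    unfolding W_def using \<delta>_nonneg by (intro mult_left_mono frob_norm_tail_V0) auto
  finally show ?thesis by (simp add: power2_eq_square mult_ac)
qed

text \<open>The perturbation is applied to \<open>head_diag\<close>, whose Frobenius norm is
  \<open>sqrt r\<close>; so its spectral bound turns into a Frobenius bound for \<open>r\<close>
  rows at that cost.\<close>

lemma head_rows_bound:
  "(\<Sum>i<r. \<Sum>j<d2. (coord (X0 - X) $$ (i, j))\<^sup>2) \<le> real r * \<delta>\<^sup>2"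
proof -
  have D: "X0 - X \<in> carrier_mat d1 d2" by (rule minus_carrier_mat[OF XC])
  define E where "E = coord (X0 - X)"
  have E: "E \<in> carrier_mat d1 d2" unfolding E_def by (rule coord_carrier[OF D])
  have "op_bound (transpose_mat U * (X0 - X)) (1 * \<delta>)"
    by (rule op_bound_mult[OF op_bound_transpose[OF op_bound_isometry[OF U]] \<delta>' UT D])
  then have "op_bound E (1 * \<delta> * 1)"
    unfolding E_def coord_def by (rule op_bound_mult[OF _ op_bound_isometry[OF V] mult_carrier_mat[OF UT D] V(1)])
  then have "op_bound E \<delta>" by simp
  from op_bound_right[OF this E head_diag_carrier[of d1 r]]
  have "frob_norm (head_diag d1 r * E) \<le> \<delta> * sqrt (real r)"
    using frob_norm_head_diag[OF rd(1)] by simp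
  then have "(frob_norm (head_diag d1 r * E))\<^sup>2 \<le> (\<delta> * sqrt (real r))\<^sup>2" by (rule power_mono) simp
  moreover have "(frob_norm (head_diag d1 r * E))\<^sup>2 = (\<Sum>i<r. \<Sum>j<d2. (E $$ (i, j))\<^sup>2)"
    unfolding frob_norm_sq[OF mult_carrier_mat[OF head_diag_carrier E]]
    using rd(1) by (intro sum.mono_neutral_cong_right) (auto simp: head_diag_mult_index[OF E] simp del: index_mult_mat(1))
  ultimately show ?thesis by (simp add: E_def power_mult_distrib mult.commute)
qed

lemma head_cols_bound:
  "(\<Sum>j<r. \<Sum>i<d1. (coord (X0 - X) $$ (i, j))\<^sup>2) \<le> real r * \<delta>\<^sup>2"
proof -
  interpret T: svd_pair d2 d1 r "transpose_mat X0" "transpose_mat X" V U V0 U0 s s0 \<delta>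
    by (rule svd_pair_transpose)
  have D: "X0 - X \<in> carrier_mat d1 d2" by (rule minus_carrier_mat[OF XC])
  have DT: "transpose_mat (X0 - X) \<in> carrier_mat d2 d1" using D by simp
  have "T.coord (transpose_mat X0 - transpose_mat X) = transpose_mat (coord (X0 - X))"
    unfolding T.coord_def coord_def transpose_mult[OF mult_carrier_mat[OF UT D] V(1)] transpose_mult[OF UT D]
      transpose_minus[OF X0C XC, symmetric] transpose_transpose
    by (rule assoc_mult_mat[OF VT DT U(1)])
  moreover have "transpose_mat (coord (X0 - X)) $$ (j, i) = coord (X0 - X) $$ (i, j)" if "i < d1" "j < d2" for i j
    using coord_carrier[OF D] that by simp
  ultimately show ?thesis using T.head_rows_bound rd by simp
qed

end

subsection \<open>One step of the iteration\<close>

lemma sum_mult_le_L2_set: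
  "\<bar>\<Sum>p\<in>A. f p * g p :: real\<bar> \<le> L2_set f A * L2_set g A"
proof -
  have "\<bar>\<Sum>p\<in>A. f p * g p\<bar> \<le> (\<Sum>p\<in>A. \<bar>f p\<bar> * \<bar>g p\<bar>)"
    using sum_abs[of "\<lambda>p. f p * g p" A] by (simp add: abs_mult)
  also have "\<dots> \<le> L2_set f A * L2_set g A" by (rule L2_set_mult_ineq)
  finally show ?thesis .
qed

text \<open>Here \<open>a\<close> stands for the target and \<open>y\<close> for the error in
  coordinates; \<open>opt\<close> is the first order condition of the weighted least squares
  problem. It makes the weighted square sum of \<open>y\<close> equal to minus the pairing of
  \<open>h a\<close> with \<open>y\<close>. Keeping the indices in \<open>B\<close> on the left and
  multiplying by \<open>\<epsilon>^2\<close> gives the bound.\<close>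

lemma weighted_tail_bound:
  fixes h a y :: "'a \<Rightarrow> real"
  assumes I: "finite I" "B \<subseteq> I" and h: "\<And>p. p \<in> I \<Longrightarrow> 0 \<le> h p" "\<And>p. p \<in> B \<Longrightarrow> h p = 1 / \<epsilon>\<^sup>2"
    and \<epsilon>: "0 < \<epsilon>" and opt: "(\<Sum>p\<in>I. h p * (a p + y p) * y p) = 0"
    and c: "L2_set (\<lambda>p. h p * a p) (I - B) \<le> c"
  shows "(L2_set y B)\<^sup>2 \<le> \<epsilon>\<^sup>2 * c * L2_set y I + L2_set a B * L2_set y B"
proof -
  have L2sq: "(L2_set y B)\<^sup>2 = (\<Sum>p\<in>B. (y p)\<^sup>2)" by (simp add: L2_set_def sum_nonneg)
  have "(\<Sum>p\<in>B. (y p)\<^sup>2) / \<epsilon>\<^sup>2 = (\<Sum>p\<in>B. h p * (y p)\<^sup>2)" using h(2) by (simp add: sum_divide_distrib)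
  also have "\<dots> \<le> (\<Sum>p\<in>I. h p * (y p)\<^sup>2)" using I h(1) by (intro sum_mono2) auto
  also have "\<dots> = - (\<Sum>p\<in>I. h p * a p * y p)"
  proof -
    have "(\<Sum>p\<in>I. h p * a p * y p) + (\<Sum>p\<in>I. h p * (y p)\<^sup>2) = (\<Sum>p\<in>I. h p * (a p + y p) * y p)"
      unfolding sum.distrib[symmetric] by (intro sum.cong) (auto simp: algebra_simps power2_eq_square)
    then show ?thesis using opt by simp
  qed
  also have "(\<Sum>p\<in>I. h p * a p * y p) = (\<Sum>p\<in>I - B. h p * a p * y p) + (\<Sum>p\<in>B. h p * a p * y p)"
    using I by (intro sum.subset_diff)
  also have "(\<Sum>p\<in>B. h p * a p * y p) = (\<Sum>p\<in>B. a p * y p) / \<epsilon>\<^sup>2"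
    using h(2) by (simp add: sum_divide_distrib)
  finally have 1: "(\<Sum>p\<in>B. (y p)\<^sup>2) / \<epsilon>\<^sup>2 \<le> - (\<Sum>p\<in>I - B. h p * a p * y p) - (\<Sum>p\<in>B. a p * y p) / \<epsilon>\<^sup>2"
    by simp
  have "- (\<Sum>p\<in>I - B. h p * a p * y p) \<le> L2_set (\<lambda>p. h p * a p) (I - B) * L2_set y (I - B)"
    using sum_mult_le_L2_set[of "\<lambda>p. h p * a p" y "I - B"] by linarith
  also have "\<dots> \<le> c * L2_set y I"
  proof (rule mult_mono[OF c])
    show "L2_set y (I - B) \<le> L2_set y I"
      unfolding L2_set_def using I by (intro real_sqrt_le_mono sum_mono2) auto
    show "0 \<le> c" using c L2_set_nonneg order_trans by blast
  qed simp
  finally have 2: "- (\<Sum>p\<in>I - B. h p * a p * y p) \<le> c * L2_set y I" .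
  have 3: "- (\<Sum>p\<in>B. a p * y p) \<le> L2_set a B * L2_set y B"
    using sum_mult_le_L2_set[of a y B] by linarith
  have e2: "\<epsilon>\<^sup>2 > 0" using \<epsilon> by simp
  have "(\<Sum>p\<in>B. (y p)\<^sup>2) = \<epsilon>\<^sup>2 * ((\<Sum>p\<in>B. (y p)\<^sup>2) / \<epsilon>\<^sup>2)" using \<epsilon> by simp
  also have "\<dots> \<le> \<epsilon>\<^sup>2 * (c * L2_set y I - (\<Sum>p\<in>B. a p * y p) / \<epsilon>\<^sup>2)"
    using 1 2 e2 by (intro mult_left_mono) auto
  also have "\<dots> = \<epsilon>\<^sup>2 * c * L2_set y I - (\<Sum>p\<in>B. a p * y p)" using \<epsilon> by (simp add: field_simps)
  finally show ?thesis using 3 L2sq by linarith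
qed

section \<open>Weights in the singular bases and the size of one step\<close>

context svd_pair
begin

definition weight :: "nat \<times> nat \<Rightarrow> real" where
  "weight = (\<lambda>(i, j). inverse (max (nth_default 0 s i) \<epsilon> * max (nth_default 0 s j) \<epsilon>))"

lemma weight_tail: "r \<le> i \<Longrightarrow> r \<le> j \<Longrightarrow> weight (i, j) = 1 / \<epsilon>\<^sup>2"
  using s_tail[of i] s_tail[of j] by (simp add: weight_def max_absorb2 inverse_eq_divide power2_eq_square)

lemma weight_nonneg: "0 \<le> weight p"
  using \<epsilon>_nonneg by (auto simp: weight_def split: prod.splits intro!: mult_nonneg_nonneg max.coboundedI2)

text \<open>The weight is the reciprocal square of the singular value here, so the leading part of
  \<open>X\<close> contributes reciprocals of its singular values, which do not blow up as
  \<open>\<epsilon>\<close> tends to zero.\<close>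

lemma weight_head_diag:
  assumes "i < r"
  shows "0 \<le> weight (i, i) * nth_default 0 s i" "weight (i, i) * nth_default 0 s i \<le> 2 / \<sigma>"
proof -
  have si: "0 < nth_default 0 s i" "\<sigma> / 2 \<le> nth_default 0 s i" using s_head[OF assms] \<sigma> by auto
  have "\<epsilon> \<le> nth_default 0 s i"
    unfolding \<epsilon>_def using s assms by (intro nth_default_antimono) auto
  then have eq: "weight (i, i) * nth_default 0 s i = 1 / nth_default 0 s i"
    using si by (simp add: weight_def max_absorb1 field_simps)
  show "0 \<le> weight (i, i) * nth_default 0 s i" "weight (i, i) * nth_default 0 s i \<le> 2 / \<sigma>"
    unfolding eq using si \<sigma> by (auto simp: field_simps)
qed

text \<open>One of the two maxima is at least \<open>\<sigma> / 2\<close> and the other at least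
  \<open>\<epsilon>\<close>, so outside the tail block at most one factor
  \<open>1 / \<epsilon>\<close> appears.\<close>

lemma weight_le:
  assumes "i < r \<or> j < r" and e: "0 < \<epsilon>"
  shows "weight (i, j) \<le> 2 / (\<sigma> * \<epsilon>)"
proof -
  let ?m = "\<lambda>i. max (nth_default 0 s i) \<epsilon>"
  have m: "\<epsilon> \<le> ?m i" "\<epsilon> \<le> ?m j" by auto
  have mh: "\<sigma> / 2 \<le> ?m k" if "k < r" for k using s_head[OF that] by linarith
  have "\<sigma> / 2 * \<epsilon> \<le> ?m i * ?m j"
    using assms(1)
  proof
    assume "i < r"
    then show ?thesis using mh m e \<sigma> by (intro mult_mono) (auto intro: order_trans[of 0 \<epsilon>])
  next
    assume "j < r"
    then have "\<epsilon> * (\<sigma> / 2) \<le> ?m i * ?m j"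
      using mh m e \<sigma> by (intro mult_mono) (auto intro: order_trans[of 0 \<epsilon>])
    then show ?thesis by (simp add: mult.commute)
  qed
  moreover have "0 < \<sigma> / 2 * \<epsilon>" using \<sigma> e by simp
  ultimately have "inverse (?m i * ?m j) \<le> inverse (\<sigma> / 2 * \<epsilon>)" by (rule le_imp_inverse_le)
  then show ?thesis by (simp add: weight_def inverse_eq_divide)
qed

lemma coord_X0_index:
  assumes "i < d1" "j < d2"
  shows "coord X0 $$ (i, j) = (if i = j then nth_default 0 s i else 0) + coord (X0 - X) $$ (i, j)"
proof -
  have D: "X0 - X \<in> carrier_mat d1 d2" by (rule minus_carrier_mat[OF XC])
  have "coord X0 = coord X + coord (X0 - X)"
    unfolding coord_add[OF XC D, symmetric] add_minus_cancel_mat[OF X0C XC] ..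
  then show ?thesis using assms coord_carrier[OF D] by (simp add: coord_X rect_diag_index)
qed

text \<open>In the singular bases \<open>X0\<close> is the diagonal of \<open>X\<close> plus a
  perturbation. Off the tail block the diagonal has \<open>r\<close> entries and the perturbation
  fills \<open>r\<close> rows and \<open>r\<close> columns, so both are bounded with
  \<open>sqrt r\<close> and not with \<open>sqrt d\<close>.\<close>

lemma weighted_head_bound:
  assumes e: "0 < \<epsilon>"
  defines "I \<equiv> {..<d1} \<times> {..<d2}" and "B \<equiv> {r..<d1} \<times> {r..<d2}"
  shows "L2_set (\<lambda>p. weight p * coord X0 $$ p) (I - B)
    \<le> sqrt (real r) * (2 / \<sigma>) + 2 / (\<sigma> * \<epsilon>) * (sqrt 2 * sqrt (real r) * \<delta>)"
proof -
  let ?E = "\<lambda>p. coord (X0 - X) $$ p"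
  let ?S = "\<lambda>(i, j). weight (i, j) * (if i = j then nth_default 0 s i else 0)"
  have T: "p \<in> I - B \<longleftrightarrow> fst p < d1 \<and> snd p < d2 \<and> (fst p < r \<or> snd p < r)" for p
    by (cases p) (auto simp: I_def B_def)
  have fin: "finite (I - B)" by (simp add: I_def)
  have "L2_set (\<lambda>p. weight p * coord X0 $$ p) (I - B) = L2_set (\<lambda>p. ?S p + weight p * ?E p) (I - B)"
  proof (rule L2_set_cong)
    fix p assume "p \<in> I - B"
    then have "fst p < d1 \<and> snd p < d2" unfolding T by blast
    then show "weight p * coord X0 $$ p = ?S p + weight p * ?E p"
      by (cases p) (auto simp: coord_X0_index algebra_simps)
  qed simp
  also have "\<dots> \<le> L2_set ?S (I - B) + L2_set (\<lambda>p. weight p * ?E p) (I - B)" by (rule L2_set_triangle_ineq)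
  also have "L2_set ?S (I - B) \<le> sqrt (real r) * (2 / \<sigma>)"
  proof -
    have "(\<Sum>p\<in>I - B. (?S p)\<^sup>2) \<le> (\<Sum>p\<in>I - B. if p \<in> (\<lambda>i. (i, i)) ` {..<r} then (2 / \<sigma>)\<^sup>2 else 0)"
    proof (rule sum_mono)
      fix p assume p: "p \<in> I - B"
      obtain i j where ij: "p = (i, j)" by (cases p)
      show "(?S p)\<^sup>2 \<le> (if p \<in> (\<lambda>i. (i, i)) ` {..<r} then (2 / \<sigma>)\<^sup>2 else 0)"
      proof (cases "i = j")
        case True
        then have "i < r" using p[unfolded T] ij by auto
        then show ?thesis using True ij weight_head_diag[of i] by (auto intro: power_mono)
      qed (use ij in auto)
    qed
    also have "\<dots> = (\<Sum>p\<in>(I - B) \<inter> (\<lambda>i. (i, i)) ` {..<r}. (2 / \<sigma>)\<^sup>2)"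
      by (rule sum.inter_restrict[OF fin, symmetric])
    also have "\<dots> \<le> (\<Sum>p\<in>(\<lambda>i :: nat. (i, i)) ` {..<r}. (2 / \<sigma>)\<^sup>2)" by (intro sum_mono2) auto
    also have "\<dots> = real r * (2 / \<sigma>)\<^sup>2" by (simp add: card_image inj_on_def)
    finally have "(\<Sum>p\<in>I - B. (?S p)\<^sup>2) \<le> real r * (2 / \<sigma>)\<^sup>2" .
    then have "L2_set ?S (I - B) \<le> sqrt (real r * (2 / \<sigma>)\<^sup>2)" unfolding L2_set_def by (rule real_sqrt_le_mono)
    then show ?thesis using \<sigma> by (simp add: real_sqrt_mult)
  qed
  also have "L2_set (\<lambda>p. weight p * ?E p) (I - B) \<le> 2 / (\<sigma> * \<epsilon>) * (sqrt 2 * sqrt (real r) * \<delta>)"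
  proof -
    \<comment> \<open>Rows and columns count once each, hence \<open>sqrt 2\<close>.\<close>
    have absE: "L2_set (\<lambda>p. \<bar>?E p\<bar>) (I - B) \<le> sqrt 2 * sqrt (real r) * \<delta>"
    proof -
      have sub: "I - B \<subseteq> {..<r} \<times> {..<d2} \<union> {..<d1} \<times> {..<r}"
      proof
        fix p assume "p \<in> I - B"
        then show "p \<in> {..<r} \<times> {..<d2} \<union> {..<d1} \<times> {..<r}" unfolding T by (cases p) auto
      qed
      have "(\<Sum>p\<in>I - B. (?E p)\<^sup>2) \<le> (\<Sum>p\<in>{..<r} \<times> {..<d2} \<union> {..<d1} \<times> {..<r}. (?E p)\<^sup>2)"
        using sub by (intro sum_mono2) auto
      also have "\<dots> \<le> (\<Sum>p\<in>{..<r} \<times> {..<d2}. (?E p)\<^sup>2) + (\<Sum>p\<in>{..<d1} \<times> {..<r}. (?E p)\<^sup>2)"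
        by (simp add: sum_Un sum_nonneg)
      also have "(\<Sum>p\<in>{..<r} \<times> {..<d2}. (?E p)\<^sup>2) = (\<Sum>i<r. \<Sum>j<d2. (?E (i, j))\<^sup>2)"
        by (simp add: sum.cartesian_product)
      also have "(\<Sum>p\<in>{..<d1} \<times> {..<r}. (?E p)\<^sup>2) = (\<Sum>i<d1. \<Sum>j<r. (?E (i, j))\<^sup>2)"
        by (simp add: sum.cartesian_product)
      also have "\<dots> = (\<Sum>j<r. \<Sum>i<d1. (?E (i, j))\<^sup>2)" by (rule sum.swap)
      finally have "(\<Sum>p\<in>I - B. (?E p)\<^sup>2) \<le> 2 * real r * \<delta>\<^sup>2"
        using head_rows_bound head_cols_bound by linarith
      then have "L2_set (\<lambda>p. \<bar>?E p\<bar>) (I - B) \<le> sqrt (2 * real r * \<delta>\<^sup>2)"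
        unfolding L2_set_def by (intro real_sqrt_le_mono) simp
      then show ?thesis using \<delta>_nonneg by (simp add: real_sqrt_mult)
    qed
    have "L2_set (\<lambda>p. weight p * ?E p) (I - B) = L2_set (\<lambda>p. weight p * \<bar>?E p\<bar>) (I - B)"
      by (simp add: L2_set_def power_mult_distrib)
    also have "\<dots> \<le> L2_set (\<lambda>p. 2 / (\<sigma> * \<epsilon>) * \<bar>?E p\<bar>) (I - B)"
    proof (rule L2_set_mono)
      fix p assume "p \<in> I - B"
      then have "weight p \<le> 2 / (\<sigma> * \<epsilon>)" using weight_le[OF _ e] T by (cases p) auto
      then show "weight p * \<bar>?E p\<bar> \<le> 2 / (\<sigma> * \<epsilon>) * \<bar>?E p\<bar>" by (rule mult_right_mono) simp
    qed (auto simp: weight_nonneg)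
    also have "\<dots> = 2 / (\<sigma> * \<epsilon>) * L2_set (\<lambda>p. \<bar>?E p\<bar>) (I - B)"
      using \<sigma> e by (intro L2_set_right_distrib[symmetric]) auto
    also have "\<dots> \<le> 2 / (\<sigma> * \<epsilon>) * (sqrt 2 * sqrt (real r) * \<delta>)"
      using \<sigma> e by (intro mult_left_mono[OF absE]) auto
    finally show ?thesis .
  qed
  finally show ?thesis by simp
qed

text \<open>The squared norm of the tail block is bounded by terms which, by \<open>tb\<close>, are
  linear in that norm, so one factor cancels. Both coefficients are of the second order quantity
  \<open>R\<close>.\<close>

lemma quadratic_step:
  assumes Z: "Z \<in> carrier_mat d1 d2" and e: "0 < \<epsilon>" and q: "1 \<le> q"
    and tb: "frob_norm Z \<le> 3 * sqrt q * frob_norm (tail_block Z)"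
    and opt: "(\<Sum>p\<in>{..<d1} \<times> {..<d2}. weight p * (coord X0 $$ p + coord Z $$ p) * coord Z $$ p) = 0"
  shows "frob_norm Z \<le> 57 * q * sqrt (real r) * \<delta>\<^sup>2 / \<sigma>"
proof -
  define I B where "I = {..<d1} \<times> {..<d2}" and "B = {r..<d1} \<times> {r..<d2}"
  have tbB: "frob_norm (tail_block Y) = L2_set (\<lambda>p. coord Y $$ p) B" if Y: "Y \<in> carrier_mat d1 d2" for Y
  proof -
    have "(\<Sum>p\<in>I. (tail_block Y $$ p)\<^sup>2) = (\<Sum>p\<in>B. (coord Y $$ p)\<^sup>2)"
      by (intro sum.mono_neutral_cong_right) (auto simp: I_def B_def tail_block_index[OF Y] split: if_splits)
    then show ?thesis unfolding frob_norm_L2[OF tail_block_carrier[OF Y]] L2_set_def I_def by simp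
  qed
  define b R where "b = frob_norm (tail_block Z)" and "R = sqrt (real r) * \<delta>\<^sup>2 / \<sigma>"
  define c where "c = sqrt (real r) * (2 / \<sigma>) + 2 / (\<sigma> * \<epsilon>) * (sqrt 2 * sqrt (real r) * \<delta>)"
  have R0: "0 \<le> R" using \<sigma> by (simp add: R_def)
  have b0: "0 \<le> b" by (simp add: b_def)
  have "b\<^sup>2 \<le> \<epsilon>\<^sup>2 * c * L2_set (\<lambda>p. coord Z $$ p) I + L2_set (\<lambda>p. coord X0 $$ p) B * b"
    unfolding b_def tbB[OF Z] c_def I_def B_def
    using weighted_head_bound[OF e] opt e
    by (intro weighted_tail_bound[where h = weight]) (auto simp: weight_nonneg weight_tail)
  also have "L2_set (\<lambda>p. coord Z $$ p) I = frob_norm Z"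
    unfolding I_def frob_norm_L2[OF coord_carrier[OF Z], symmetric] by (rule frob_norm_coord[OF Z])
  also have "L2_set (\<lambda>p. coord X0 $$ p) B = frob_norm (tail_block X0)" by (rule tbB[OF X0C, symmetric])
  also have "frob_norm (tail_block X0) * b \<le> 4 * R * b"
    using frob_norm_tail_block_X0 b0 by (intro mult_right_mono) (simp_all add: R_def)
  also have "\<epsilon>\<^sup>2 * c * frob_norm Z \<le> 5 * R * (3 * sqrt q * b)"
  proof (rule mult_mono)
    \<comment> \<open>The square of \<open>\<epsilon>\<close> outweighs the single
      \<open>1 / \<epsilon>\<close> of the mixed weights; with
      \<open>\<epsilon> \<le> \<delta>\<close> all is bounded by
      \<open>5 * \<delta>^2\<close>.\<close>
    have "\<epsilon>\<^sup>2 * c = sqrt (real r) * (2 * \<epsilon>\<^sup>2 + 2 * sqrt 2 * (\<epsilon> * \<delta>)) / \<sigma>"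
      using \<sigma> e by (simp add: c_def field_simps power2_eq_square)
    also have "\<dots> \<le> sqrt (real r) * (5 * \<delta>\<^sup>2) / \<sigma>"
    proof (intro divide_right_mono mult_left_mono)
      have "\<epsilon>\<^sup>2 \<le> \<delta>\<^sup>2" using \<epsilon>_le \<epsilon>_nonneg by (intro power_mono)
      moreover have "2 * sqrt 2 * (\<epsilon> * \<delta>) \<le> 3 * (\<delta> * \<delta>)"
      proof (intro mult_mono)
        show "2 * sqrt 2 \<le> (3 :: real)" by (rule power2_le_imp_le) (auto simp: power_mult_distrib)
      qed (use \<epsilon>_le \<epsilon>_nonneg \<delta>_nonneg in auto)
      ultimately show "2 * \<epsilon>\<^sup>2 + 2 * sqrt 2 * (\<epsilon> * \<delta>) \<le> 5 * \<delta>\<^sup>2" by (simp add: power2_eq_square)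
    qed (use \<sigma> in auto)
    finally show "\<epsilon>\<^sup>2 * c \<le> 5 * R" by (simp add: R_def mult.commute mult.left_commute)
    show "frob_norm Z \<le> 3 * sqrt q * b" using tb by (simp add: b_def)
  qed (use R0 in auto)
  \<comment> \<open>The 15 is \<open>5 * 3\<close> from the two factors just bounded;
    \<open>15 + 4 = 19\<close> and \<open>3 * 19 = 57\<close> lead to the constant of the
    claim.\<close>
  finally have "b * b \<le> ((15 * sqrt q + 4) * R) * b" by (simp add: power2_eq_square algebra_simps)
  then have "b \<le> (15 * sqrt q + 4) * R"
  proof (cases "b = 0")
    case False
    assume "b * b \<le> ((15 * sqrt q + 4) * R) * b"
    then show ?thesis using False b0 mult_right_le_imp_le[of b b "(15 * sqrt q + 4) * R"] by simp
  qed (use R0 q in auto)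
  also have "\<dots> \<le> (19 * sqrt q) * R"
    using q R0 by (intro mult_right_mono) auto
  finally have b: "b \<le> 19 * sqrt q * R" .
  have "frob_norm Z \<le> 3 * sqrt q * b" using tb by (simp add: b_def)
  also have "\<dots> \<le> 3 * sqrt q * (19 * sqrt q * R)" using b q by (intro mult_left_mono) auto
  also have "\<dots> = 57 * (sqrt q * sqrt q) * R" by simp
  also have "sqrt q * sqrt q = q" using q by simp
  finally show ?thesis by (simp add: R_def)
qed

text \<open>In its own bases the tail block of \<open>X\<close> is diagonal with entries at most
  \<open>\<epsilon>\<close>, and that of \<open>X0\<close> is of second order; their difference is
  the tail block of the error.\<close>

lemma error_le_smoothing:
  assumes tb: "frob_norm (X - X0) \<le> 3 * sqrt q * frob_norm (tail_block (X - X0))" and q: "0 \<le> q"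
  shows "frob_norm (X - X0) \<le> 3 * sqrt q * (sqrt (real (min d1 d2)) * \<epsilon> + 4 * sqrt (real r) * \<delta>\<^sup>2 / \<sigma>)"
proof -
  let ?Z = "X - X0"
  have Z: "?Z \<in> carrier_mat d1 d2" by (rule minus_carrier_mat[OF X0C])
  have "X0 + ?Z = X" by (rule add_minus_cancel_mat[OF XC X0C])
  then have cX: "coord X = coord X0 + coord ?Z" using coord_add[OF X0C Z] by simp
  have sum: "tail_block X = tail_block X0 + tail_block ?Z"
  proof (rule eq_matI)
    fix i j assume "i < dim_row (tail_block X0 + tail_block ?Z)" "j < dim_col (tail_block X0 + tail_block ?Z)"
    then have ij: "i < d1" "j < d2" using tail_block_carrier[OF Z] by auto
    show "tail_block X $$ (i, j) = (tail_block X0 + tail_block ?Z) $$ (i, j)"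
      using ij tail_block_carrier[OF Z] tail_block_carrier[OF X0C] coord_carrier[OF Z] coord_carrier[OF X0C] cX
      by (simp add: tail_block_index[OF XC] tail_block_index[OF X0C] tail_block_index[OF Z])
  qed (use tail_block_carrier[OF Z] tail_block_carrier[OF XC] in auto)
  have "tail_block ?Z = tail_block X - tail_block X0"
    unfolding sum using tail_block_carrier[OF Z] tail_block_carrier[OF X0C] by (intro eq_matI) auto
  then have "frob_norm (tail_block ?Z) \<le> frob_norm (tail_block X) + frob_norm (tail_block X0)"
    using frob_norm_triangle_minus[OF tail_block_carrier[OF XC] tail_block_carrier[OF X0C]] by simp
  also have "frob_norm (tail_block X) \<le> sqrt (real (min d1 d2)) * \<epsilon>"
  proof (rule power2_le_imp_le)
    have "(frob_norm (tail_block X))\<^sup>2 \<le> (\<Sum>i<d1. \<Sum>j<d2. if j = i then \<epsilon>\<^sup>2 else 0)"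
      unfolding frob_norm_sq[OF tail_block_carrier[OF XC]]
    proof (intro sum_mono)
      fix i j assume "i \<in> {..<d1}" "j \<in> {..<d2}"
      then show "(tail_block X $$ (i, j))\<^sup>2 \<le> (if j = i then \<epsilon>\<^sup>2 else 0)"
        using s_tail[of i] nth_default_nonneg[OF s(3), of i]
        by (auto simp: tail_block_index[OF XC] coord_X rect_diag_index power_mono)
    qed
    also have "\<dots> = (\<Sum>i<d1. if i \<in> {..<d2} then \<epsilon>\<^sup>2 else 0)" by (intro sum.cong) auto
    also have "\<dots> = (\<Sum>i\<in>{..<d1} \<inter> {..<d2}. \<epsilon>\<^sup>2)" by (rule sum.inter_restrict[symmetric]) simp
    also have "{..<d1} \<inter> {..<d2} = {..<min d1 d2}" by auto
    finally show "(frob_norm (tail_block X))\<^sup>2 \<le> (sqrt (real (min d1 d2)) * \<epsilon>)\<^sup>2"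
      by (simp add: power_mult_distrib)
  qed (use \<epsilon>_nonneg in auto)
  finally have "frob_norm (tail_block ?Z) \<le> sqrt (real (min d1 d2)) * \<epsilon> + 4 * sqrt (real r) * \<delta>\<^sup>2 / \<sigma>"
    using frob_norm_tail_block_X0 by linarith
  then show ?thesis using q by (intro order_trans[OF tb] mult_left_mono) auto
qed

lemma frob_inner_weight_operator:
  assumes Z: "Z \<in> carrier_mat d1 d2"
  shows "frob_inner Z (weight_operator U s V \<epsilon> Z) = (\<Sum>p\<in>{..<d1} \<times> {..<d2}. weight p * (coord Z $$ p)\<^sup>2)"
proof -
  define M where "M = mat d1 d2 (\<lambda>p. weight p * coord Z $$ p)"
  have M: "M \<in> carrier_mat d1 d2" by (simp add: M_def)
  have w: "weight_operator U s V \<epsilon> Z = U * M * transpose_mat V"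
    using Z by (simp add: weight_operator_def M_def coord_def weight_def Let_def split_def)
  have MV: "M * transpose_mat V \<in> carrier_mat d1 d2" by (rule mult_carrier_mat[OF M VT])
  have UZ: "transpose_mat U * Z \<in> carrier_mat d1 d2" by (rule mult_carrier_mat[OF UT Z])
  have comm: "frob_inner A B = frob_inner B A" if "A \<in> carrier_mat n m" "B \<in> carrier_mat n m" for A B n m
    using that by (simp add: frob_inner_carrier mult.commute)
  have tr: "frob_inner A B = frob_inner (transpose_mat A) (transpose_mat B)"
    if "A \<in> carrier_mat n m" "B \<in> carrier_mat n m" for A B n m
    using that unfolding frob_inner_def by (subst sum.swap) auto
  have "frob_inner Z (U * M * transpose_mat V) = frob_inner (U * (M * transpose_mat V)) Z"
    unfolding assoc_mult_mat[OF U(1) M VT] by (rule comm[OF Z mult_carrier_mat[OF U(1) MV]])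
  also have "\<dots> = frob_inner (M * transpose_mat V) (transpose_mat U * Z)"
    by (rule frob_inner_adjoint[OF U(1) MV Z])
  also have "\<dots> = frob_inner (transpose_mat (M * transpose_mat V)) (transpose_mat (transpose_mat U * Z))"
    by (rule tr[OF MV UZ])
  also have "transpose_mat (M * transpose_mat V) = V * transpose_mat M"
    using transpose_mult[OF M VT] by simp
  also have "frob_inner (V * transpose_mat M) (transpose_mat (transpose_mat U * Z))
      = frob_inner (transpose_mat M) (transpose_mat V * transpose_mat (transpose_mat U * Z))"
    using M UZ by (intro frob_inner_adjoint[OF V(1)]) auto
  also have "transpose_mat V * transpose_mat (transpose_mat U * Z) = transpose_mat (coord Z)"
    unfolding coord_def by (rule transpose_mult[OF UZ V(1), symmetric])
  also have "frob_inner (transpose_mat M) (transpose_mat (coord Z)) = frob_inner M (coord Z)"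
    by (rule tr[OF M coord_carrier[OF Z], symmetric])
  also have "\<dots> = (\<Sum>i<d1. \<Sum>j<d2. weight (i, j) * (coord Z $$ (i, j))\<^sup>2)"
    unfolding frob_inner_carrier[OF M] by (intro sum.cong) (auto simp: M_def power2_eq_square)
  finally show ?thesis unfolding w by (simp add: sum.cartesian_product split_def)
qed

text \<open>The first order condition along the line through the minimiser and \<open>X0\<close>; in
  the application this line is feasible.\<close>

lemma weighted_minimizer_orthogonal:
  assumes Xn: "Xn \<in> carrier_mat d1 d2"
    and min: "\<And>t. frob_inner Xn (weight_operator U s V \<epsilon> Xn)
      \<le> frob_inner (Xn + t \<cdot>\<^sub>m (Xn - X0)) (weight_operator U s V \<epsilon> (Xn + t \<cdot>\<^sub>m (Xn - X0)))"
  shows "(\<Sum>p\<in>{..<d1} \<times> {..<d2}. weight p * (coord X0 $$ p + coord (Xn - X0) $$ p) * coord (Xn - X0) $$ p) = 0"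
proof -
  let ?I = "{..<d1} \<times> {..<d2}"
  let ?Z = "Xn - X0"
  have Z: "?Z \<in> carrier_mat d1 d2" by (rule minus_carrier_mat[OF X0C])
  have "coord Xn = coord X0 + coord ?Z"
    unfolding coord_add[OF X0C Z, symmetric] add_minus_cancel_mat[OF Xn X0C] ..
  then have cXn: "coord Xn $$ p = coord X0 $$ p + coord ?Z $$ p" if "p \<in> ?I" for p
    using that coord_carrier[OF X0C] coord_carrier[OF Z] by auto
  define b c where "b = (\<Sum>p\<in>?I. weight p * coord Xn $$ p * coord ?Z $$ p)"
    and "c = (\<Sum>p\<in>?I. weight p * (coord ?Z $$ p)\<^sup>2)"
  have *: "0 \<le> 2 * t * b + t\<^sup>2 * c" for t
  proof -
    have tZ: "t \<cdot>\<^sub>m ?Z \<in> carrier_mat d1 d2" using Z by simp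
    have XtZ: "Xn + t \<cdot>\<^sub>m ?Z \<in> carrier_mat d1 d2" using Xn tZ by simp
    have "coord (t \<cdot>\<^sub>m ?Z) = t \<cdot>\<^sub>m coord ?Z"
      unfolding coord_def mult_smult_distrib[OF UT Z]
      by (rule mult_smult_assoc_mat[OF mult_carrier_mat[OF UT Z] V(1)])
    then have ct: "coord (Xn + t \<cdot>\<^sub>m ?Z) $$ p = coord Xn $$ p + t * coord ?Z $$ p" if "p \<in> ?I" for p
      using that coord_add[OF Xn tZ] coord_carrier[OF Z] by auto
    have "(\<Sum>p\<in>?I. weight p * (coord (Xn + t \<cdot>\<^sub>m ?Z) $$ p)\<^sup>2)
       = (\<Sum>p\<in>?I. weight p * (coord Xn $$ p)\<^sup>2 + 2 * t * (weight p * coord Xn $$ p * coord ?Z $$ p)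
           + t\<^sup>2 * (weight p * (coord ?Z $$ p)\<^sup>2))"
      by (intro sum.cong) (auto simp: ct power2_eq_square algebra_simps simp del: mem_Sigma_iff)
    also have "\<dots> = (\<Sum>p\<in>?I. weight p * (coord Xn $$ p)\<^sup>2) + 2 * t * b + t\<^sup>2 * c"
      by (simp add: sum.distrib sum_distrib_left b_def c_def)
    finally show ?thesis
      using min[of t] unfolding frob_inner_weight_operator[OF Xn] frob_inner_weight_operator[OF XtZ] by simp
  qed
  have c0: "0 \<le> c" unfolding c_def by (intro sum_nonneg mult_nonneg_nonneg weight_nonneg) auto
  have "b = 0"
  proof (rule ccontr)
    assume "b \<noteq> 0"
    \<comment> \<open>The step \<open>- b * k\<close> makes the quadratic polynomial negative; the
      \<open>+ 1\<close> covers the case \<open>c = 0\<close>.\<close>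
    define k where "k = 1 / (c + 1)"
    have k: "k * c = 1 - k" "0 < k" using c0 by (auto simp: k_def field_simps)
    have "2 * (- b * k) * b + (- b * k)\<^sup>2 * c = b\<^sup>2 * k * (k * c - 2)"
      by (simp add: power2_eq_square algebra_simps)
    also have "\<dots> < 0" unfolding k(1) using \<open>b \<noteq> 0\<close> k(2) by (intro mult_pos_neg) auto
    finally show False using *[of "- b * k"] by simp
  qed
  then show ?thesis unfolding b_def using cXn by (simp cong: sum.cong)
qed

end

declare One_nat_def [simp]

subsection \<open>The tangent space\<close>

definition tangent_proj :: "real mat \<Rightarrow> real mat \<Rightarrow> real mat \<Rightarrow> real mat" where
  "tangent_proj U V Z = Z - co_proj (dim_row U) U * Z * co_proj (dim_row V) V"

text \<open>The residual is \<open>Z\<close> multiplied from both sides by the complementary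
  projections. It is orthogonal to both kinds of summands of the tangent space, as the left factor
  kills \<open>U\<close> and the right one kills \<open>V\<close>.\<close>

lemma orth_proj_tangent_space:
  assumes U: "U \<in> carrier_mat n r" "transpose_mat U * U = 1\<^sub>m r"
    and V: "V \<in> carrier_mat m r" "transpose_mat V * V = 1\<^sub>m r" and Z: "Z \<in> carrier_mat n m"
  shows "orth_proj (tangent_space U V) Z = tangent_proj U V Z"
proof -
  let ?QU = "co_proj n U" and ?QV = "co_proj m V"
  note C = co_proj_carrier[OF U] and C' = co_proj_carrier[OF V]
  have UT: "transpose_mat U \<in> carrier_mat r n" and VT: "transpose_mat V \<in> carrier_mat r m" using U V by simp_all
  have tp: "tangent_proj U V Z = Z - ?QU * Z * ?QV" using U V by (simp add: tangent_proj_def)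
  have T: "tangent_space U V = {U * transpose_mat M + M' * transpose_mat V | M M'.
      M \<in> carrier_mat m r \<and> M' \<in> carrier_mat n r}"
    unfolding tangent_space_def using U V by auto
  have QZ: "?QU * Z \<in> carrier_mat n m" by (rule mult_carrier_mat[OF C Z])
  have ZQ: "Z * ?QV \<in> carrier_mat n m" by (rule mult_carrier_mat[OF Z C'])
  have QZQ: "?QU * Z * ?QV \<in> carrier_mat n m" by (rule mult_carrier_mat[OF QZ C'])
  have PZ: "tangent_proj U V Z \<in> carrier_mat n m" unfolding tp by (rule minus_carrier_mat[OF QZQ])
  have TC: "Y \<in> carrier_mat n m" if Y: "Y \<in> tangent_space U V" for Y
  proof -
    obtain M M' where "Y = U * transpose_mat M + M' * transpose_mat V" "M \<in> carrier_mat m r" "M' \<in> carrier_mat n r"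
      using Y unfolding T by blast
    then show ?thesis using mult_carrier_mat[of M' n r "transpose_mat V" m] VT by simp
  qed
  have inT: "tangent_proj U V Z \<in> tangent_space U V"
  proof -
    have VV: "V * transpose_mat V \<in> carrier_mat m m" by (rule mult_carrier_mat[OF V(1) VT])
    have UU: "U * transpose_mat U \<in> carrier_mat n n" by (rule mult_carrier_mat[OF U(1) UT])
    have ZVV: "Z * (V * transpose_mat V) \<in> carrier_mat n m" by (rule mult_carrier_mat[OF Z VV])
    have UUZ: "U * transpose_mat U * (Z * ?QV) \<in> carrier_mat n m" by (rule mult_carrier_mat[OF UU ZQ])
    have "Z * ?QV = Z - Z * (V * transpose_mat V)"
      unfolding co_proj_def mult_minus_distrib_mat[OF Z one_carrier_mat VV] right_mult_one_mat[OF Z] ..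
    moreover have "?QU * Z * ?QV = Z * ?QV - U * transpose_mat U * (Z * ?QV)"
      unfolding assoc_mult_mat[OF C Z C'] by (subst co_proj_def)
        (simp only: minus_mult_distrib_mat[OF one_carrier_mat UU ZQ] left_mult_one_mat[OF ZQ])
    moreover have "A - (A - B - D) = D + B" if "A \<in> carrier_mat n m" "B \<in> carrier_mat n m" "D \<in> carrier_mat n m"
      for A B D :: "real mat"
      using that by (intro eq_matI) auto
    ultimately have "tangent_proj U V Z = U * transpose_mat U * (Z * ?QV) + Z * (V * transpose_mat V)"
      unfolding tp using Z ZVV UUZ by metis
    also have "U * transpose_mat U * (Z * ?QV) = U * (transpose_mat U * (Z * ?QV))"
      by (rule assoc_mult_mat[OF U(1) UT ZQ])
    also have "Z * (V * transpose_mat V) = Z * V * transpose_mat V"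
      by (rule assoc_mult_mat[OF Z V(1) VT, symmetric])
    finally have "tangent_proj U V Z
        = U * transpose_mat (transpose_mat (transpose_mat U * (Z * ?QV))) + Z * V * transpose_mat V" by simp
    moreover have "transpose_mat (transpose_mat U * (Z * ?QV)) \<in> carrier_mat m r"
      using mult_carrier_mat[OF UT ZQ] by (simp only: transpose_carrier_mat)
    moreover have "Z * V \<in> carrier_mat n r" by (rule mult_carrier_mat[OF Z V(1)])
    ultimately show ?thesis unfolding T by blast
  qed
  have add: "frob_inner W (A + B) = frob_inner W A + frob_inner W B"
    if "W \<in> carrier_mat n m" "A \<in> carrier_mat n m" "B \<in> carrier_mat n m" for W A B
    using that by (simp add: frob_inner_carrier algebra_simps sum.distrib)
  have tr: "frob_inner A B = frob_inner (transpose_mat A) (transpose_mat B)"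
    if "A \<in> carrier_mat k l" "B \<in> carrier_mat k l" for A B k l
    using that unfolding frob_inner_def by (subst sum.swap) auto
  have zero: "frob_inner A (0\<^sub>m k l) = 0" if "A \<in> carrier_mat k l" for A k l
    using that by (simp add: frob_inner_carrier)
  have orth: "frob_inner (?QU * Z * ?QV) Y = 0" if YT: "Y \<in> tangent_space U V" for Y
  proof -
    obtain M M' where Y: "Y = U * transpose_mat M + M' * transpose_mat V" and M: "M \<in> carrier_mat m r" "M' \<in> carrier_mat n r"
      using YT unfolding T by blast
    have MT: "transpose_mat M \<in> carrier_mat r m" using M(1) by simp
    have UM: "U * transpose_mat M \<in> carrier_mat n m" by (rule mult_carrier_mat[OF U(1) MT])
    have MV: "M' * transpose_mat V \<in> carrier_mat n m" by (rule mult_carrier_mat[OF M(2) VT])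
    have "frob_inner (?QU * (Z * ?QV)) (U * transpose_mat M) = frob_inner (Z * ?QV) (?QU * (U * transpose_mat M))"
      using frob_inner_adjoint[OF C ZQ UM] unfolding co_proj_transpose[OF U] .
    also have "?QU * (U * transpose_mat M) = 0\<^sub>m n m"
      unfolding assoc_mult_mat[OF C U(1) MT, symmetric] co_proj_mult[OF U] by (rule left_mult_zero_mat[OF MT])
    finally have 1: "frob_inner (?QU * Z * ?QV) (U * transpose_mat M) = 0"
      using zero[OF ZQ] assoc_mult_mat[OF C Z C'] by simp
    have QZT: "transpose_mat (?QU * Z) \<in> carrier_mat m n" using QZ by (simp only: transpose_carrier_mat)
    have MT': "transpose_mat M' \<in> carrier_mat r n" using M(2) by simp
    have "transpose_mat (?QU * Z * ?QV) = ?QV * transpose_mat (?QU * Z)"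
      using transpose_mult[OF QZ C'] co_proj_transpose[OF V] by simp
    moreover have "transpose_mat (M' * transpose_mat V) = V * transpose_mat M'"
      using transpose_mult[OF M(2) VT] by simp
    ultimately have "frob_inner (?QU * Z * ?QV) (M' * transpose_mat V)
        = frob_inner (?QV * transpose_mat (?QU * Z)) (V * transpose_mat M')"
      using tr[OF QZQ MV] by simp
    also have "\<dots> = frob_inner (transpose_mat (?QU * Z)) (?QV * (V * transpose_mat M'))"
      using frob_inner_adjoint[OF C' QZT mult_carrier_mat[OF V(1) MT']] unfolding co_proj_transpose[OF V] .
    also have "?QV * (V * transpose_mat M') = 0\<^sub>m m n"
      unfolding assoc_mult_mat[OF C' V(1) MT', symmetric] co_proj_mult[OF V] by (rule left_mult_zero_mat[OF MT'])
    finally have 2: "frob_inner (?QU * Z * ?QV) (M' * transpose_mat V) = 0" using zero[OF QZT] by simp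
    show ?thesis unfolding Y using add[OF QZQ UM MV] 1 2 by simp
  qed
  have res: "Z - tangent_proj U V Z = ?QU * Z * ?QV"
    unfolding tp using Z QZQ by (intro eq_matI) auto
  show ?thesis
    unfolding orth_proj_def
  proof (rule the_equality)
    show "tangent_proj U V Z \<in> tangent_space U V \<and>
        (\<forall>Y\<in>tangent_space U V. frob_inner (Z - tangent_proj U V Z) Y = 0)"
      using inT orth res by simp
  next
    fix P assume P: "P \<in> tangent_space U V \<and> (\<forall>Y\<in>tangent_space U V. frob_inner (Z - P) Y = 0)"
    let ?P = "tangent_proj U V Z"
    have PC: "P \<in> carrier_mat n m" using TC P by blast
    have min: "frob_inner (A - B) Y = frob_inner A Y - frob_inner B Y"
      if "A \<in> carrier_mat n m" "B \<in> carrier_mat n m" "Y \<in> carrier_mat n m" for A B Y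
      unfolding frob_inner_carrier[OF minus_carrier_mat[OF that(2)]] frob_inner_carrier[OF that(1)]
        frob_inner_carrier[OF that(2)] sum_subtractf[symmetric]
      using that by (intro sum.cong) (auto simp: algebra_simps)
    have dZ: "frob_inner (?P - P) Y = 0" if "Y \<in> tangent_space U V" for Y
    proof -
      have "frob_inner (Z - P) Y = 0" "frob_inner (Z - ?P) Y = 0" using P orth res that by auto
      then show ?thesis using min[OF Z PC TC[OF that]] min[OF Z PZ TC[OF that]] min[OF PZ PC TC[OF that]] by simp
    qed
    have comm: "frob_inner A B = frob_inner B A" if "A \<in> carrier_mat n m" "B \<in> carrier_mat n m" for A B
      using that by (simp add: frob_inner_carrier mult.commute)
    have DC: "?P - P \<in> carrier_mat n m" by (rule minus_carrier_mat[OF PC])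
    \<comment> \<open>Both candidates lie in the space and their difference is orthogonal to each of
      them, hence to itself.\<close>
    have "(frob_norm (?P - P))\<^sup>2 = frob_inner ?P (?P - P) - frob_inner P (?P - P)"
      unfolding frob_norm_sq_inner by (rule min[OF PZ PC DC])
    also have "\<dots> = 0"
      using dZ[OF inT] dZ[of P] P comm[OF PZ DC] comm[OF PC DC] by simp
    finally have "(\<Sum>i<n. \<Sum>j<m. ((?P - P) $$ (i, j))\<^sup>2) = 0" using frob_norm_sq[OF DC] by simp
    then have "(?P - P) $$ (i, j) = 0" if "i < n" "j < m" for i j
      using that by (auto simp: sum_nonneg_eq_0_iff sum_nonneg simp del: index_minus_mat)
    then show "P = ?P" using PC PZ by (intro eq_matI) auto
  qed
qed

locale tangent_kernel =
  fixes d1 d2 r :: nat and U V :: "real mat"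
  assumes U: "U \<in> carrier_mat d1 r" "transpose_mat U * U = 1\<^sub>m r"
    and V: "V \<in> carrier_mat d2 r" "transpose_mat V * V = 1\<^sub>m r"
    and d: "0 < d1" "0 < d2"
begin

text \<open>\<open>G\<close> is the matrix of the map to the residual and \<open>kern\<close> that
  of the tangent projection, both indexed by matrix positions. Writing \<open>kern\<close> as
  identity minus \<open>G\<close> reduces its idempotence to that of \<open>co_proj\<close>.\<close>

definition G :: "nat \<times> nat \<Rightarrow> nat \<times> nat \<Rightarrow> real" where
  "G = (\<lambda>(i, j) (k, l). co_proj d1 U $$ (i, k) * co_proj d2 V $$ (l, j))"

definition kern :: "nat \<times> nat \<Rightarrow> nat \<times> nat \<Rightarrow> real" where
  "kern = (\<lambda>a b. (if a = b then 1 else 0) - G a b)"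

abbreviation "A \<equiv> {..<d1} \<times> {..<d2}"

lemma co_proj_sym:
  "i < d1 \<Longrightarrow> k < d1 \<Longrightarrow> co_proj d1 U $$ (i, k) = co_proj d1 U $$ (k, i)"
  "j < d2 \<Longrightarrow> l < d2 \<Longrightarrow> co_proj d2 V $$ (j, l) = co_proj d2 V $$ (l, j)"
  using co_proj_transpose[OF U] co_proj_transpose[OF V] co_proj_carrier[OF U] co_proj_carrier[OF V]
  by (metis carrier_matD index_transpose_mat(1))+

lemma G_sum:
  assumes Z: "Z \<in> carrier_mat d1 d2" and ij: "i < d1" "j < d2"
  shows "(\<Sum>b\<in>A. G (i, j) b * Z $$ b) = (co_proj d1 U * Z * co_proj d2 V) $$ (i, j)"
proof -
  note C = co_proj_carrier[OF U] and C' = co_proj_carrier[OF V]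
  have "(co_proj d1 U * Z * co_proj d2 V) $$ (i, j) = (\<Sum>l<d2. (co_proj d1 U * Z) $$ (i, l) * co_proj d2 V $$ (l, j))"
    by (rule mult_index[OF mult_carrier_mat[OF C Z] C' ij])
  also have "\<dots> = (\<Sum>l<d2. \<Sum>k<d1. co_proj d1 U $$ (i, k) * Z $$ (k, l) * co_proj d2 V $$ (l, j))"
    using ij by (intro sum.cong refl) (simp add: mult_index[OF C Z] sum_distrib_right del: index_mult_mat(1))
  also have "\<dots> = (\<Sum>k<d1. \<Sum>l<d2. co_proj d1 U $$ (i, k) * Z $$ (k, l) * co_proj d2 V $$ (l, j))"
    by (rule sum.swap)
  also have "\<dots> = (\<Sum>b\<in>A. G (i, j) b * Z $$ b)"
    by (simp add: sum.cartesian_product G_def split_def mult_ac)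
  finally show ?thesis ..
qed

sublocale K: projection_kernel A kern
proof
  show "finite A" "A \<noteq> {}" using d by auto
  show "kern a b = kern b a" if "a \<in> A" "b \<in> A" for a b
    using that co_proj_sym by (cases a; cases b) (auto simp: kern_def G_def)
  show "(\<Sum>c\<in>A. kern a c * kern c b) = kern a b" if ab: "a \<in> A" "b \<in> A" for a b
  proof -
    obtain i j k l where ij: "a = (i, j)" "b = (k, l)" by (cases a; cases b)
    have ijl: "i < d1" "j < d2" "k < d1" "l < d2" using ab ij by auto
    have "(\<Sum>c\<in>A. G a c * G c b) = (\<Sum>x<d1. \<Sum>y<d2.
        (co_proj d1 U $$ (i, x) * co_proj d1 U $$ (x, k)) * (co_proj d2 V $$ (l, y) * co_proj d2 V $$ (y, j)))"
      by (simp add: sum.cartesian_product G_def split_def ij mult_ac)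
    also have "\<dots> = (co_proj d1 U * co_proj d1 U) $$ (i, k) * (co_proj d2 V * co_proj d2 V) $$ (l, j)"
      using ijl unfolding sum_distrib_left[symmetric] sum_distrib_right[symmetric]
      by (simp add: mult_index[OF co_proj_carrier[OF U] co_proj_carrier[OF U]]
        mult_index[OF co_proj_carrier[OF V] co_proj_carrier[OF V]] del: index_mult_mat(1))
    finally have GG: "(\<Sum>c\<in>A. G a c * G c b) = G a b"
      unfolding co_proj_idem[OF U] co_proj_idem[OF V] by (simp add: G_def ij)
    have "(\<Sum>c\<in>A. kern a c * kern c b) = (\<Sum>c\<in>A. (if c = a then kern a b else 0) - (if c = b then G a b else 0) + G a c * G c b)"
      by (intro sum.cong) (auto simp: kern_def algebra_simps)
    also have "\<dots> = kern a b" using ab GG by (simp add: sum.distrib sum_subtractf)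
    finally show ?thesis .
  qed
qed

text \<open>The diagonal entry of a projection is the squared norm of the projected basis vector;
  through it incoherence limits the step size of the Kaczmarz iteration.\<close>

lemma kern_diag:
  assumes ij: "i < d1" "j < d2"
  shows "kern (i, j) (i, j) = (frob_norm (orth_proj (tangent_space U V) (basis_mat d1 d2 i j)))\<^sup>2"
proof -
  let ?E = "basis_mat d1 d2 i j"
  have E: "?E \<in> carrier_mat d1 d2" by (simp add: basis_mat_def)
  have C: "co_proj d1 U * ?E * co_proj d2 V \<in> carrier_mat d1 d2"
    by (rule mult_carrier_mat[OF mult_carrier_mat[OF co_proj_carrier[OF U] E] co_proj_carrier[OF V]])
  have P: "tangent_proj U V ?E = ?E - co_proj d1 U * ?E * co_proj d2 V"
    using U V by (simp add: tangent_proj_def)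
  have "tangent_proj U V ?E $$ (k, l) = kern (i, j) (k, l)" if kl: "k < d1" "l < d2" for k l
  proof -
    have "(co_proj d1 U * ?E * co_proj d2 V) $$ (k, l) = (\<Sum>b\<in>A. G (k, l) b * ?E $$ b)"
      by (rule G_sum[OF E kl, symmetric])
    also have "\<dots> = (\<Sum>b\<in>A. if b = (i, j) then G (k, l) (i, j) else 0)"
      by (intro sum.cong) (auto simp: basis_mat_def split: if_splits)
    also have "\<dots> = G (k, l) (i, j)" using ij by (subst sum.delta) auto
    also have "\<dots> = G (i, j) (k, l)" using co_proj_sym ij kl by (simp add: G_def)
    finally have "(co_proj d1 U * ?E * co_proj d2 V) $$ (k, l) = G (i, j) (k, l)" .
    moreover have "tangent_proj U V ?E $$ (k, l) = ?E $$ (k, l) - (co_proj d1 U * ?E * co_proj d2 V) $$ (k, l)"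
      unfolding P by (rule index_minus_mat(1)) (use kl C in auto)
    moreover have "?E $$ (k, l) = (if (i, j) = (k, l) then 1 else 0)" using kl by (auto simp: basis_mat_def)
    ultimately show ?thesis by (simp add: kern_def)
  qed
  moreover have "tangent_proj U V ?E \<in> carrier_mat d1 d2" unfolding P by (rule minus_carrier_mat[OF C])
  ultimately have "(frob_norm (tangent_proj U V ?E))\<^sup>2 = K.nsq (kern (i, j))"
    by (simp add: frob_norm_sq K.nsq_def sum.cartesian_product)
  also have "\<dots> = kern (i, j) (i, j)" using ij by (intro K.kernel_diag) auto
  finally show ?thesis unfolding orth_proj_tangent_space[OF U V E] ..
qed

lemma null_space_boundD:
  assumes ns: "K.null_space_bound q S" and Z: "Z \<in> carrier_mat d1 d2" and S: "\<And>p. p \<in> S \<Longrightarrow> p \<in> A \<Longrightarrow> Z $$ p = 0"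
  shows "(frob_norm Z)\<^sup>2 \<le> (1 + q) * (frob_norm (co_proj d1 U * Z * co_proj d2 V))\<^sup>2"
proof -
  have C: "co_proj d1 U * Z * co_proj d2 V \<in> carrier_mat d1 d2"
    by (rule mult_carrier_mat[OF mult_carrier_mat[OF co_proj_carrier[OF U] Z] co_proj_carrier[OF V]])
  \<comment> \<open>\<open>null_space_bound\<close> speaks of functions on all pairs, so the values
    outside the matrix are set to zero.\<close>
  define h where "h = (\<lambda>a. if a \<in> A then Z $$ a else 0)"
  have "Z $$ a - (\<Sum>b\<in>A. kern a b * Z $$ b) = (co_proj d1 U * Z * co_proj d2 V) $$ a" if "a \<in> A" for a
  proof -
    obtain i j where ij: "a = (i, j)" "i < d1" "j < d2" using \<open>a \<in> A\<close> by auto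
    have "(\<Sum>b\<in>A. kern a b * Z $$ b) = (\<Sum>b\<in>A. (if b = a then Z $$ a else 0) - G a b * Z $$ b)"
      by (intro sum.cong) (auto simp: kern_def algebra_simps)
    also have "\<dots> = Z $$ a - (\<Sum>b\<in>A. G a b * Z $$ b)" using that by (simp add: sum_subtractf)
    finally show ?thesis using G_sum[OF Z ij(2,3)] ij(1) by simp
  qed
  then have "K.nsq (\<lambda>a. h a - (\<Sum>b\<in>A. kern a b * h b)) = (frob_norm (co_proj d1 U * Z * co_proj d2 V))\<^sup>2"
    unfolding frob_norm_sq[OF C] K.nsq_def by (simp add: sum.cartesian_product split_def h_def)
  moreover have "K.nsq h = (frob_norm Z)\<^sup>2"
    unfolding frob_norm_sq[OF Z] K.nsq_def by (simp add: sum.cartesian_product split_def h_def)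
  moreover have "K.nsq h \<le> (1 + q) * K.nsq (\<lambda>a. h a - (\<Sum>b\<in>A. kern a b * h b))"
    by (rule ns[unfolded K.null_space_bound_def, rule_format]) (use S in \<open>auto simp: h_def\<close>)
  ultimately show ?thesis by simp
qed

end

subsection \<open>Sampling an incoherent tangent space\<close>

lemma (in projection_kernel) null_space_bound_le:
  "null_space_bound q S \<Longrightarrow> q \<le> q' \<Longrightarrow> null_space_bound q' S"
  unfolding null_space_bound_def using nsq_nonneg
  by (meson add_left_mono mult_right_mono order_trans)

text \<open>The lower bound on \<open>m\<close> must fit below \<open>d1 * d2\<close>. As
  \<open>ln (d1 + d2)\<close> is at least one half, this forces \<open>min d1 d2\<close> to be large
  compared with \<open>\<mu>0 * r\<close>.\<close>

lemma sample_size_bounds: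
  fixes \<mu>0 :: real
  assumes d: "0 < d1" "0 < d2" and \<mu>0: "1 \<le> \<mu>0" and r: "1 \<le> r" and m: "m \<le> d1 * d2"
    and mC: "10000 * \<mu>0 * real r * real (d1 + d2) * ln (real (d1 + d2)) \<le> real m"
  shows "5000 * \<mu>0 * real r \<le> real (min d1 d2)" "1 \<le> ln (real (max d1 d2))"
    "5000 \<le> real (max d1 d2)"
proof -
  let ?n = "real (d1 + d2)"
  have n2: "2 \<le> ?n" using d by linarith
  have "2 / 3 \<le> ln ?n" using ln2_ge_two_thirds n2 by (smt (verit) ln_le_cancel_iff)
  then have "10000 * \<mu>0 * real r * ?n * (1 / 2) \<le> 10000 * \<mu>0 * real r * ?n * ln ?n"
    using \<mu>0 by (intro mult_left_mono) auto
  also have "\<dots> \<le> real (d1 * d2)" using mC m by linarith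
  also have "\<dots> = real (min d1 d2) * real (max d1 d2)" by (simp add: min_def max_def)
  also have "\<dots> \<le> real (min d1 d2) * ?n" by (intro mult_left_mono) auto
  finally have "(5000 * \<mu>0 * real r) * ?n \<le> real (min d1 d2) * ?n" by simp
  then show 1: "5000 * \<mu>0 * real r \<le> real (min d1 d2)" by (rule mult_right_le_imp_le) (use n2 in simp)
  have "1 * 1 \<le> \<mu>0 * real r" using \<mu>0 r by (intro mult_mono) auto
  then have "5000 \<le> 5000 * \<mu>0 * real r" by simp
  then show 5: "5000 \<le> real (max d1 d2)" using 1 by linarith
  have "exp 1 \<le> real (max d1 d2)" using exp_le 5 by linarith
  moreover have "0 < real (max d1 d2)" using 5 by linarith
  ultimately have "ln (exp 1) \<le> ln (real (max d1 d2))" by (simp only: ln_le_cancel_iff exp_gt_zero)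
  then show "1 \<le> ln (real (max d1 d2))" by simp
qed

context tangent_kernel
begin

lemma prob_null_space_bound_incoherent:
  fixes \<mu>0 :: real
  assumes \<mu>0: "1 \<le> \<mu>0" and r: "1 \<le> r" and m: "m \<le> d1 * d2"
    and mC: "10000 * \<mu>0 * real r * real (d1 + d2) * ln (real (d1 + d2)) \<le> real m"
    and inc: "\<And>i j. i < d1 \<Longrightarrow> j < d2 \<Longrightarrow>
      frob_norm (orth_proj (tangent_space U V) (basis_mat d1 d2 i j))
        \<le> sqrt (\<mu>0 * real r * (real (d1 + d2) / (real d1 * real d2)))"
  defines "q \<equiv> real (min d1 d2) * ln (real (max d1 d2)) / (100 * \<mu>0 * real r)"
  shows "measure_pmf.prob (uniform_sampling d1 d2 m) {\<Omega>. \<not> K.null_space_bound q (set \<Omega>)}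
    \<le> 2 / (real (max d1 d2))\<^sup>2"
proof -
  define D n N where "D = real (max d1 d2)" and "n = real (d1 + d2)" and "N = real d1 * real d2"
  note sz = sample_size_bounds[OF d \<mu>0 r m mC, folded D_def]
  have D: "5000 \<le> D" "1 \<le> ln D" using sz by auto
  have nD: "D \<le> n" and n0: "0 < n" using d by (auto simp: D_def n_def)
  have N: "0 < N" "N \<le> D * D" using d by (auto simp: N_def D_def intro!: mult_mono)
  have cA: "real (card A) = N" by (simp add: N_def card_cartesian_product)
  define w where "w = \<mu>0 * real r"
  have mr1: "1 \<le> w" using mult_mono[of 1 \<mu>0 1 "real r"] \<mu>0 r by (simp add: w_def)
  then have mr: "0 < w" by simp
  have qw: "q = real (min d1 d2) * ln (real (max d1 d2)) / (100 * w)" by (simp add: q_def w_def mult.assoc)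
  \<comment> \<open>Incoherence bounds the diagonal of \<open>kern\<close> by
    \<open>w * n / N\<close>, so this is the step size admissible by that bound, divided by 2000.
    The division makes \<open>q\<close>, which is proportional to \<open>\<eta>\<close>, small; the
    10000 in the sample size pays for it.\<close>
  define \<eta> where "\<eta> = N / (2000 * w * n)"
  have \<eta>0: "0 < \<eta>" using N n0 mr by (simp add: \<eta>_def)
  have \<eta>N: "\<eta> \<le> real (card A)"
  proof -
    have "1 * 1 \<le> 2000 * w * n" using mr1 D nD by (intro mult_mono) auto
    then have "N / (2000 * w * n) \<le> N / 1" using N mr n0 by (intro divide_left_mono mult_pos_pos) auto
    then show ?thesis unfolding cA \<eta>_def by simp
  qed
  have \<eta>p: "\<eta> * kern a a \<le> 1" if "a \<in> A" for a
  proof -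
    obtain i j where a: "a = (i, j)" "i < d1" "j < d2" using \<open>a \<in> A\<close> by auto
    have nn: "0 \<le> w * (n / N)" using mr n0 N by simp
    have "kern a a \<le> (sqrt (w * (n / N)))\<^sup>2"
      unfolding a(1) kern_diag[OF a(2,3)] using inc[OF a(2,3)]
      by (intro power_mono) (auto simp: n_def N_def w_def)
    also have "\<dots> = w * (n / N)" using nn by simp
    finally have "\<eta> * kern a a \<le> \<eta> * (w * (n / N))" using \<eta>0 by (intro mult_left_mono) auto
    also have "\<dots> = 1 / 2000" using mr n0 N by (simp add: \<eta>_def field_simps)
    finally show ?thesis by simp
  qed
  \<comment> \<open>With this \<open>k\<close>, and since \<open>10000 = 5 * 2000\<close>, both
    exponentials are at most multiples of \<open>1 / D ^ 5\<close>, against at most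
    \<open>D ^ 2\<close> positions. It also brings the factor \<open>ln D\<close> into
    \<open>q\<close>.\<close>
  define k where "k = 5 * ln D"
  have k0: "0 \<le> k" using D by (simp add: k_def)
  have q: "4 * \<eta> * k \<le> q"
  proof -
    have "N = real (min d1 d2) * D" by (simp add: N_def D_def min_def max_def)
    then have "N \<le> real (min d1 d2) * n" using nD by (simp add: mult_left_mono)
    then have "N / n \<le> real (min d1 d2)" using n0 by (simp add: pos_divide_le_eq)
    then have "20 * ln D / (2000 * w) * (N / n) \<le> 20 * ln D / (2000 * w) * real (min d1 d2)"
      using D mr by (intro mult_left_mono) auto
    moreover have "4 * \<eta> * k = 20 * ln D / (2000 * w) * (N / n)"
      by (simp add: \<eta>_def k_def mult.commute)
    moreover have "q = 20 * ln D / (2000 * w) * real (min d1 d2)"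
      by (simp add: qw D_def mult.commute)
    ultimately show ?thesis by simp
  qed
  have "measure_pmf.prob (uniform_sampling d1 d2 m) {\<Omega>. \<not> K.null_space_bound q (set \<Omega>)}
     \<le> measure_pmf.prob (uniform_sampling d1 d2 m) {\<Omega>. \<not> K.null_space_bound (4 * \<eta> * k) (set \<Omega>)}"
    using K.null_space_bound_le[OF _ q] by (intro measure_pmf.finite_measure_mono) auto
  also have "\<dots> \<le> 4 * real (card A) * exp (- (\<eta> * real m / real (card A))) + real (card A) * exp (2 - k)"
    unfolding uniform_sampling_def
    by (rule K.prob_null_space_bound[OF _ \<eta>0 \<eta>p \<eta>N k0]) (use m in \<open>auto simp: card_cartesian_product\<close>)
  also have "\<dots> \<le> 4 * N * exp (- k) + N * exp (2 - k)"
  proof -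
    have "ln D \<le> ln n" using D nD by (subst ln_le_cancel_iff) auto
    then have "5 * ln D \<le> 5 * ln n" by simp
    also have "\<dots> = 10000 * w * n * ln n / (2000 * w * n)" using mr n0 by (simp add: field_simps)
    also have "\<dots> \<le> real m / (2000 * w * n)"
    proof (rule divide_right_mono)
      show "10000 * w * n * ln n \<le> real m" using mC by (simp only: n_def w_def mult.assoc)
    qed (use mr n0 in simp)
    also have "\<dots> = \<eta> * real m / N" using N by (simp add: \<eta>_def)
    finally show ?thesis unfolding cA k_def using N by simp
  qed
  also have "\<dots> = N * (4 + exp 2) * exp (- k)" by (simp add: exp_diff exp_minus field_simps)
  also have "exp (- k) = 1 / D ^ 5"
  proof -
    have "exp k = exp (ln D) ^ 5" unfolding k_def by (simp flip: exp_of_nat_mult)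
    then show ?thesis using D by (simp add: exp_minus inverse_eq_divide)
  qed
  also have "N * (4 + exp 2) * (1 / D ^ 5) \<le> (D * D) * 13 * (1 / D ^ 5)"
  proof (intro mult_right_mono mult_mono)
    have "exp 2 = exp 1 * exp (1 :: real)" by (simp flip: exp_add)
    also have "\<dots> \<le> 3 * 3" using exp_le by (intro mult_mono) auto
    finally show "4 + exp 2 \<le> (13 :: real)" by simp
  qed (use N D in auto)
  also have "\<dots> = 13 / D / D\<^sup>2" using D by (simp add: field_simps power_numeral_reduce)
  also have "\<dots> \<le> 2 / D\<^sup>2" using D by (intro divide_right_mono) (auto simp: field_simps)
  finally show ?thesis by (simp add: D_def)
qed

end

subsection \<open>Local convergence\<close>

lemma sqrt_le_self:
  assumes "1 \<le> x"
  shows "sqrt x \<le> x"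
  using real_sqrt_le_mono[of x "x\<^sup>2"] mult_left_mono[of 1 x x] assms by (simp add: power2_eq_square)

text \<open>All that is kept of the random choice is \<open>null_space\<close> and the range of the
  positions; the argument inside is deterministic.\<close>

locale irls_local =
  fixes d1 d2 r :: nat and X0 U0 V0 :: "real mat" and s0 :: "real list"
    and \<Omega> :: "(nat \<times> nat) list" and \<mu>0 :: real
  assumes X0: "orth_svd d1 d2 X0 U0 s0 V0" and s0: "length s0 = r" and r1: "1 \<le> r"
    and \<sigma>_pos: "0 < nth_default 0 s0 (r - 1)" and \<mu>0: "1 \<le> \<mu>0"
    and dim: "5000 * \<mu>0 * real r \<le> real (min d1 d2)" and L1: "1 \<le> ln (real (max d1 d2))"
    and \<Omega>: "set \<Omega> \<subseteq> {..<d1} \<times> {..<d2}"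
    and null_space: "\<And>Z. Z \<in> carrier_mat d1 d2 \<Longrightarrow> (\<And>i j. (i, j) \<in> set \<Omega> \<Longrightarrow> i < d1 \<Longrightarrow> j < d2 \<Longrightarrow> Z $$ (i, j) = 0) \<Longrightarrow>
      (frob_norm Z)\<^sup>2 \<le> (1 + real (min d1 d2) * ln (real (max d1 d2)) / (100 * \<mu>0 * real r)) *
        (frob_norm (co_proj d1 U0 * Z * co_proj d2 V0))\<^sup>2"
begin

definition d where "d = real (min d1 d2)"
definition L where "L = ln (real (max d1 d2))"
definition \<sigma> where "\<sigma> = nth_default 0 s0 (r - 1)"
definition q where "q = d * L / (100 * \<mu>0 * real r)"
text \<open>The quadratic rate proved for one step, which is the bound of the theorem without
  \<open>\<kappa>\<close>. By \<open>qB\<close> it equals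
  \<open>100 * q * r / \<sigma>\<close>.\<close>

definition B where "B = d * L / (\<mu>0 * \<sigma>)"

lemma \<sigma>: "0 < \<sigma>" using \<sigma>_pos by (simp add: \<sigma>_def)

lemma d: "5000 * \<mu>0 * real r \<le> d" "\<mu>0 \<le> d" "0 < d"
proof -
  show 1: "5000 * \<mu>0 * real r \<le> d" using dim by (simp add: d_def)
  have "\<mu>0 * 1 \<le> \<mu>0 * real r" using r1 \<mu>0 by (intro mult_left_mono) auto
  moreover have "5000 * (\<mu>0 * real r) \<le> d" using 1 by (simp add: mult.assoc)
  ultimately show "\<mu>0 \<le> d" using \<mu>0 by linarith
  then show "0 < d" using \<mu>0 by simp
qed

lemma L: "1 \<le> L" using L1 by (simp add: L_def)

lemma r_dim: "r \<le> d1" "r \<le> d2"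
proof -
  have "1 * real r \<le> 5000 * \<mu>0 * real r" using \<mu>0 by (intro mult_right_mono) auto
  then have "real r \<le> d" using d by linarith
  then show "r \<le> d1" "r \<le> d2" by (auto simp: d_def)
qed

lemma X0C: "X0 \<in> carrier_mat d1 d2"
  using X0 by (auto simp: orth_svd_def)

lemma q1: "1 \<le> q"
proof -
  have "100 * \<mu>0 * real r \<le> 5000 * \<mu>0 * real r" using \<mu>0 by (intro mult_right_mono) auto
  also have "\<dots> * 1 \<le> d * L" using d L by (intro mult_mono) auto
  finally show ?thesis using \<mu>0 r1 by (simp add: q_def)
qed

lemma B_pos: "0 < B" using d L \<mu>0 \<sigma> by (simp add: B_def)

lemma qB: "q = B * \<sigma> / (100 * real r)"
  using \<sigma> \<mu>0 by (simp add: q_def B_def)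

definition irls :: "(nat \<Rightarrow> real mat) \<Rightarrow> (nat \<Rightarrow> ereal) \<Rightarrow> (nat \<Rightarrow> real mat \<Rightarrow> real mat) \<Rightarrow> nat \<Rightarrow> bool" where
  "irls = matrix_irls d1 d2 \<Omega> (subsample \<Omega> X0) r"

definition err :: "real mat \<Rightarrow> real" where "err X = spectral_norm (X - X0)"

definition feasible :: "real mat \<Rightarrow> bool" where
  "feasible Z \<longleftrightarrow> Z \<in> carrier_mat d1 d2 \<and> subsample \<Omega> Z = subsample \<Omega> X0"

lemma feasible_index:
  assumes "feasible Z" "p \<in> set \<Omega>"
  shows "Z $$ p = X0 $$ p"
proof -
  obtain l where l: "l < length \<Omega>" "p = \<Omega> ! l" using assms(2) by (auto simp: in_set_conv_nth)
  have "subsample \<Omega> Z $ l = subsample \<Omega> X0 $ l" using assms(1) by (simp add: feasible_def)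
  then show ?thesis using l by (simp add: subsample_def)
qed

lemma null_space_feasible:
  assumes Z: "feasible Z"
  shows "(frob_norm (Z - X0))\<^sup>2 \<le> (1 + q) * (frob_norm (co_proj d1 U0 * (Z - X0) * co_proj d2 V0))\<^sup>2"
  unfolding q_def d_def L_def
proof (rule null_space)
  show "Z - X0 \<in> carrier_mat d1 d2" by (rule minus_carrier_mat[OF X0C])
  show "(Z - X0) $$ (i, j) = 0" if "(i, j) \<in> set \<Omega>" "i < d1" "j < d2" for i j
    using feasible_index[OF Z that(1)] that X0C by simp
qed

lemma feasible_line:
  assumes Z: "Z \<in> carrier_mat d1 d2" "feasible Z"
  shows "feasible (Z + t \<cdot>\<^sub>m (Z - X0))"
proof -
  have "(Z + t \<cdot>\<^sub>m (Z - X0)) $$ p = X0 $$ p" if "p \<in> set \<Omega>" for p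
    using feasible_index[OF Z(2) that] that \<Omega> X0C Z(1) by (cases p) auto
  then have "subsample \<Omega> (Z + t \<cdot>\<^sub>m (Z - X0)) = subsample \<Omega> X0"
    unfolding subsample_def by (intro eq_vecI) (use nth_mem in auto)
  moreover have "Z + t \<cdot>\<^sub>m (Z - X0) \<in> carrier_mat d1 d2"
    using Z(1) minus_carrier_mat[OF X0C] by (intro add_carrier_mat smult_carrier_mat)
  ultimately show ?thesis by (simp add: feasible_def)
qed

text \<open>Running iteration \<open>k + 1\<close> presupposes \<open>eps k > 0\<close>. With the
  assumption on \<open>eps k\<close> this makes the singular value positive, so \<open>W k\<close>
  is the weight operator at exactly that value.\<close>

lemma irls_Suc:
  assumes run: "irls X eps W (Suc k)" and k: "1 \<le> k"
    and eps: "eps k = ereal (singular_value (Suc r) (X k))"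
  shows "\<exists>U s V. full_svd (X k) U s V \<and> W k = weight_operator U s V (singular_value (Suc r) (X k)) \<and>
    0 < singular_value (Suc r) (X k) \<and> feasible (X k) \<and> feasible (X (Suc k)) \<and>
    (\<forall>Z. feasible Z \<longrightarrow> frob_inner (X (Suc k)) (W k (X (Suc k))) \<le> frob_inner Z (W k Z)) \<and>
    eps (Suc k) = min (eps k) (ereal (singular_value (Suc r) (X (Suc k))))"
proof -
  have st: "0 < eps (j - 1) \<and> is_arg_min (\<lambda>Z. frob_inner Z (W (j - 1) Z)) feasible (X j) \<and>
      eps j = min (eps (j - 1)) (ereal (singular_value (r + 1) (X j))) \<and>
      (0 < eps j \<longrightarrow> is_weight_operator (X j) (real_of_ereal (eps j)) (W j))" if "j \<in> {1..Suc k}" for j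
    using run that unfolding irls_def matrix_irls_def feasible_def[abs_def] by blast
  have "k \<in> {1..Suc k}" "Suc k \<in> {1..Suc k}" using k by auto
  note st1 = st[OF this(1), folded Suc_eq_plus1] and st2 = st[OF this(2), unfolded diff_Suc_1, folded Suc_eq_plus1]
  have 1: "0 < eps k" using st2 by blast
  then have wo: "is_weight_operator (X k) (singular_value (Suc r) (X k)) (W k)"
    using st1 unfolding eps real_of_ereal.simps by blast
  have 2: "is_arg_min (\<lambda>Z. frob_inner Z (W k Z)) feasible (X (Suc k))"
    and 4: "eps (Suc k) = min (eps k) (ereal (singular_value (Suc r) (X (Suc k))))" using st2 by blast+
  have 3: "is_arg_min (\<lambda>Z. frob_inner Z (W (k - 1) Z)) feasible (X k)" using st1 by blast
  obtain U s V where svd: "full_svd (X k) U s V"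
    and W: "W k = weight_operator U s V (singular_value (Suc r) (X k))"
    using wo unfolding is_weight_operator_def by blast
  have pos: "0 < singular_value (Suc r) (X k)" using 1 unfolding eps by simp
  have f: "feasible (X k)" "feasible (X (Suc k))" using 2 3 unfolding is_arg_min_def by blast+
  have min: "\<forall>Z. feasible Z \<longrightarrow> frob_inner (X (Suc k)) (W k (X (Suc k))) \<le> frob_inner Z (W k Z)"
    using 2 unfolding is_arg_min_linorder by blast
  show ?thesis
    by (rule exI[of _ U], rule exI[of _ s], rule exI[of _ V]) (intro conjI svd W pos f min 4)
qed

text \<open>The single condition on \<open>B * e\<close> yields all the smallness that a step needs:
  \<open>\<mu>0 \<le> d * L\<close> gives the gap condition, and \<open>q * r * e\<close> is
  \<open>\<sigma> / 100\<close> times \<open>B * e\<close>.\<close>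

lemma err_small:
  assumes e: "0 \<le> e" "B * e \<le> 1 / 2"
  shows "e \<le> \<sigma> / 2" "12 * q * e \<le> \<sigma>" "q * real r * e \<le> \<sigma> / 200"
proof -
  have "\<mu>0 * 1 \<le> d * L" using d L \<mu>0 by (intro mult_mono) auto
  then have "\<mu>0 * e \<le> d * L * e" using e by (intro mult_right_mono) auto
  also have "\<dots> = \<mu>0 * \<sigma> * (B * e)" using \<mu>0 \<sigma> by (simp add: B_def)
  also have "\<dots> \<le> \<mu>0 * \<sigma> * (1 / 2)" using e \<mu>0 \<sigma> by (intro mult_left_mono) auto
  finally show "e \<le> \<sigma> / 2" using \<mu>0 by simp
  have "q * real r * e = \<sigma> / 100 * (B * e)" using r1 by (simp add: qB)
  also have "\<dots> \<le> \<sigma> / 100 * (1 / 2)" using e \<sigma> by (intro mult_left_mono) auto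
  finally show 1: "q * real r * e \<le> \<sigma> / 200" by simp
  have "q * 1 * e \<le> q * real r * e" using q1 r1 e by (intro mult_right_mono mult_left_mono) auto
  then show "12 * q * e \<le> \<sigma>" using 1 \<sigma> by simp
qed

lemma svd_pair_iterate:
  assumes X: "X \<in> carrier_mat d1 d2" and svd: "full_svd X U s V" and e: "B * err X \<le> 1 / 2"
  shows "svd_pair d1 d2 r X0 X U V U0 V0 s s0 (err X)"
proof
  have D: "X - X0 \<in> carrier_mat d1 d2" by (rule minus_carrier_mat[OF X0C])
  show "op_bound (X - X0) (err X)" unfolding err_def by (rule op_bound_spectral_norm[OF D])
  show "err X \<le> nth_default 0 s0 (r - 1) / 2"
    using err_small(1)[OF _ e] spectral_norm_nonneg[OF D] by (simp add: err_def \<sigma>_def)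
qed (use X0 s0 r1 r_dim X svd \<sigma>_pos in auto)

lemma err_nonneg: "0 \<le> err X"
  unfolding err_def by (rule spectral_norm_nonneg[OF minus_carrier_mat[OF X0C]])

text \<open>The step bound has the coefficient \<open>57 * q * sqrt r / \<sigma>\<close>, which is
  at most \<open>57 / 100 * B\<close>: the 100 in \<open>q\<close> makes room for the 57.\<close>

lemma irls_quadratic:
  assumes run: "irls X eps W (Suc k)" and k: "1 \<le> k"
    and eps: "eps k = ereal (singular_value (Suc r) (X k))" and e: "B * err (X k) \<le> 1 / 2"
  shows "err (X (Suc k)) \<le> B * (err (X k))\<^sup>2"
proof -
  obtain U s V where svd: "full_svd (X k) U s V" and W: "W k = weight_operator U s V (singular_value (Suc r) (X k))"
    and pos: "0 < singular_value (Suc r) (X k)" and f: "feasible (X k)" "feasible (X (Suc k))"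
    and min: "\<forall>Z. feasible Z \<longrightarrow> frob_inner (X (Suc k)) (W k (X (Suc k))) \<le> frob_inner Z (W k Z)"
    using irls_Suc[OF run k eps] by (elim exE conjE) (rule that; assumption)
  have XC: "X k \<in> carrier_mat d1 d2" "X (Suc k) \<in> carrier_mat d1 d2" using f by (auto simp: feasible_def)
  interpret P: svd_pair d1 d2 r X0 "X k" U V U0 V0 s s0 "err (X k)"
    by (rule svd_pair_iterate[OF XC(1) svd e])
  have P\<sigma>: "P.\<sigma> = \<sigma>" by (simp add: P.\<sigma>_def \<sigma>_def)
  have P\<epsilon>: "P.\<epsilon> = singular_value (Suc r) (X k)"
    unfolding P.\<epsilon>_def by (rule singular_value_eq[OF full_svd_imp_orth_svd[OF svd XC(1)], symmetric])
  let ?Z = "X (Suc k) - X0"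
  have Z: "?Z \<in> carrier_mat d1 d2" by (rule minus_carrier_mat[OF X0C])
  note small = err_small[OF err_nonneg e]
  have tb: "frob_norm ?Z \<le> 3 * sqrt q * frob_norm (P.tail_block ?Z)"
    using small(2) by (intro P.frob_norm_le_tail_block[OF Z q1 _ null_space_feasible[OF f(2)]]) (simp add: P\<sigma>)
  have opt: "(\<Sum>p\<in>{..<d1} \<times> {..<d2}. P.weight p * (P.coord X0 $$ p + P.coord ?Z $$ p) * P.coord ?Z $$ p) = 0"
    using min[rule_format, OF feasible_line[OF XC(2) f(2)]] unfolding W P\<epsilon>[symmetric]
    by (intro P.weighted_minimizer_orthogonal[OF XC(2)])
  have "err (X (Suc k)) \<le> frob_norm ?Z" unfolding err_def by (rule spectral_norm_le_frob_norm[OF Z])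
  also have "\<dots> \<le> 57 * q * sqrt (real r) * (err (X k))\<^sup>2 / \<sigma>"
    using P.quadratic_step[OF Z _ q1 tb opt] pos unfolding P\<epsilon> P\<sigma> by simp
  also have "\<dots> \<le> 57 * q * real r * (err (X k))\<^sup>2 / \<sigma>"
  proof (intro divide_right_mono mult_right_mono mult_left_mono)
    show "sqrt (real r) \<le> real r" using r1 by (intro sqrt_le_self) simp
  qed (use q1 \<sigma> in auto)
  also have "\<dots> = 57 / 100 * (B * (err (X k))\<^sup>2)" using \<sigma> r1 by (simp add: qB)
  also have "\<dots> \<le> 1 * (B * (err (X k))\<^sup>2)" using B_pos by (intro mult_right_mono) auto
  finally show ?thesis by simp
qed

text \<open>The quadratic remainder in \<open>error_le_smoothing\<close> is at most half of the
  error by \<open>err_small\<close> and is absorbed, which doubles the factor 3.\<close>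

lemma err_le_smoothing:
  assumes svd: "full_svd X U s V" and f: "feasible X" and e: "B * err X \<le> 1 / 2"
  shows "err X \<le> 6 * sqrt q * sqrt d * singular_value (Suc r) X"
proof -
  have XC: "X \<in> carrier_mat d1 d2" using f by (auto simp: feasible_def)
  interpret P: svd_pair d1 d2 r X0 X U V U0 V0 s s0 "err X"
    by (rule svd_pair_iterate[OF XC svd e])
  have P\<sigma>: "P.\<sigma> = \<sigma>" by (simp add: P.\<sigma>_def \<sigma>_def)
  have P\<epsilon>: "P.\<epsilon> = singular_value (Suc r) X"
    unfolding P.\<epsilon>_def by (rule singular_value_eq[OF full_svd_imp_orth_svd[OF svd XC], symmetric])
  have Z: "X - X0 \<in> carrier_mat d1 d2" by (rule minus_carrier_mat[OF X0C])
  note small = err_small[OF err_nonneg e]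
  have tb: "frob_norm (X - X0) \<le> 3 * sqrt q * frob_norm (P.tail_block (X - X0))"
    using small(2) by (intro P.frob_norm_le_tail_block[OF Z q1 _ null_space_feasible[OF f]]) (simp add: P\<sigma>)
  have "err X \<le> frob_norm (X - X0)" unfolding err_def by (rule spectral_norm_le_frob_norm[OF Z])
  also have "\<dots> \<le> 3 * sqrt q * (sqrt d * singular_value (Suc r) X + 4 * sqrt (real r) * (err X)\<^sup>2 / \<sigma>)"
    using P.error_le_smoothing[OF tb] q1 unfolding P\<epsilon> P\<sigma> d_def by simp
  also have "\<dots> = 3 * sqrt q * sqrt d * singular_value (Suc r) X + 12 * (sqrt q * sqrt (real r) * err X) / \<sigma> * err X"
    by (simp add: algebra_simps power2_eq_square)
  also have "12 * (sqrt q * sqrt (real r) * err X) / \<sigma> * err X \<le> 1 / 2 * err X"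
  proof (rule mult_right_mono[OF _ err_nonneg])
    have "sqrt q * sqrt (real r) * err X \<le> q * real r * err X"
    proof (intro mult_right_mono mult_mono err_nonneg)
      show "sqrt (real r) \<le> real r" using r1 by (intro sqrt_le_self) simp
      show "sqrt q \<le> q" using q1 by (rule sqrt_le_self)
    qed (use q1 in auto)
    also have "\<dots> \<le> \<sigma> / 200" by (rule small(3))
    finally show "12 * (sqrt q * sqrt (real r) * err X) / \<sigma> \<le> 1 / 2" using \<sigma> by (simp add: field_simps)
  qed
  finally show ?thesis by simp
qed

lemma singular_value_Suc_r_le_err:
  assumes X: "X \<in> carrier_mat d1 d2"
  shows "singular_value (Suc r) X \<le> err X"
proof -
  have "singular_value (Suc r) X \<le> singular_value (Suc r) X0 + err X"
    unfolding err_def by (rule singular_value_weyl[OF X X0C op_bound_spectral_norm[OF minus_carrier_mat[OF X0C]]])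
  also have "singular_value (Suc r) X0 = 0" using singular_value_eq[OF X0, of r] s0 by (simp add: nth_default_beyond)
  finally show ?thesis by simp
qed

lemma irls_convergence:
  assumes run: "\<And>n. irls X eps W n" and k: "1 \<le> k"
    and eps: "eps k = ereal (singular_value (Suc r) (X k))" and e: "B * err (X k) \<le> 1 / 2"
    and e2: "B * err (X k) * (6 * sqrt q * sqrt d) \<le> 1"
  shows "(\<lambda>l. err (X (k + l))) \<longlonglongrightarrow> 0"
proof -
  \<comment> \<open>The two claims need each other: the error bound makes \<open>eps\<close> follow
    the singular value, and the step estimate that halves the error requires that it does.\<close>
  have ind: "eps (k + l) = ereal (singular_value (Suc r) (X (k + l))) \<and> err (X (k + l)) \<le> (1 / 2) ^ l * err (X k)" for l
  proof (induction l)
    case (Suc l)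
    let ?k = "k + l" and ?c = "6 * sqrt q * sqrt d"
    have k': "1 \<le> ?k" using k by simp
    have eps': "eps ?k = ereal (singular_value (Suc r) (X ?k))" and le: "err (X ?k) \<le> (1 / 2) ^ l * err (X k)"
      using Suc by auto
    have "(1 / 2) ^ l * err (X k) \<le> 1 * err (X k)"
      using err_nonneg by (intro mult_right_mono power_le_one) auto
    then have le1: "err (X ?k) \<le> err (X k)" using le by simp
    have Be: "B * err (X ?k) \<le> B * err (X k)" using le1 B_pos by (intro mult_left_mono) auto
    then have e': "B * err (X ?k) \<le> 1 / 2" using e by linarith
    have c0: "0 \<le> ?c" using q1 d by simp
    have "B * err (X ?k) * ?c \<le> B * err (X k) * ?c" using Be c0 by (rule mult_right_mono)
    then have e2': "B * err (X ?k) * ?c \<le> 1" using e2 by linarith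
    obtain U s V where svd: "full_svd (X ?k) U s V" and pos: "0 < singular_value (Suc r) (X ?k)"
      and f: "feasible (X ?k)" "feasible (X (Suc ?k))"
      and epsS: "eps (Suc ?k) = min (eps ?k) (ereal (singular_value (Suc r) (X (Suc ?k))))"
      using irls_Suc[OF run k' eps'] by (elim exE conjE) (rule that; assumption)
    have quad: "err (X (Suc ?k)) \<le> B * (err (X ?k))\<^sup>2" by (rule irls_quadratic[OF run k' eps' e'])
    \<comment> \<open>One factor of the error is traded for the current singular value. Then the new
      error, and with it the new singular value, is at most the current singular value, and the
      minimum that updates \<open>eps\<close> picks the new one.\<close>
    have "B * (err (X ?k))\<^sup>2 = B * err (X ?k) * err (X ?k)" by (simp add: power2_eq_square)
    also have "\<dots> \<le> B * err (X ?k) * (?c * singular_value (Suc r) (X ?k))"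
      using err_le_smoothing[OF svd f(1) e'] B_pos err_nonneg[of "X ?k"] by (intro mult_left_mono) auto
    also have "\<dots> = B * err (X ?k) * ?c * singular_value (Suc r) (X ?k)" by simp
    also have "\<dots> \<le> 1 * singular_value (Suc r) (X ?k)" using e2' pos by (intro mult_right_mono) auto
    finally have "err (X (Suc ?k)) \<le> singular_value (Suc r) (X ?k)" using quad by simp
    moreover have "singular_value (Suc r) (X (Suc ?k)) \<le> err (X (Suc ?k))"
      using f(2) by (intro singular_value_Suc_r_le_err) (simp add: feasible_def)
    ultimately have "eps (Suc ?k) = ereal (singular_value (Suc r) (X (Suc ?k)))"
      unfolding epsS eps' by simp
    moreover have "err (X (Suc ?k)) \<le> (1 / 2) ^ Suc l * err (X k)"
    proof -
      have "B * (err (X ?k))\<^sup>2 = B * err (X ?k) * err (X ?k)" by (simp add: power2_eq_square)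
      also have "\<dots> \<le> 1 / 2 * err (X ?k)" using e' err_nonneg by (intro mult_right_mono)
      finally show ?thesis using quad le by simp
    qed
    ultimately show ?case by simp
  qed (use eps in auto)
  have "(\<lambda>l. (1 / 2) ^ l) \<longlonglongrightarrow> (0 :: real)" by (rule LIMSEQ_power_zero) simp
  from tendsto_mult_left_zero[OF this] have lim: "(\<lambda>l. (1 / 2) ^ l * err (X k)) \<longlonglongrightarrow> 0" .
  show ?thesis
  proof (rule tendsto_sandwich[OF _ _ tendsto_const lim])
    show "\<forall>\<^sub>F l in sequentially. 0 \<le> err (X (k + l))" by (rule always_eventually) (simp add: err_nonneg)
    show "\<forall>\<^sub>F l in sequentially. err (X (k + l)) \<le> (1 / 2) ^ l * err (X k)"
      by (rule always_eventually) (use ind in blast)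
  qed
qed

end

section \<open>Matching the constants and exponents of the statement\<close>

lemma powr_three_halves:
  fixes x :: real
  assumes "0 < x"
  shows "x powr (3 / 2) = sqrt x ^ 3"
proof -
  have "x powr (3 / 2) = (x powr (1 / 2)) powr 3" by (simp add: powr_powr)
  also have "\<dots> = sqrt x powr 3" using assms by (simp add: powr_half_sqrt)
  finally show ?thesis using assms by (simp add: powr_numeral)
qed

context irls_local
begin

definition \<kappa> where "\<kappa> = singular_value 1 X0 / singular_value r X0"

lemma singular_value_r: "singular_value r X0 = \<sigma>"
  using singular_value_eq[OF X0, of "r - 1"] r1 by (simp add: \<sigma>_def)

lemma \<kappa>: "1 \<le> \<kappa>"
proof -
  have "singular_value 1 X0 = nth_default 0 s0 0"
    using singular_value_eq[OF X0, of 0] by (simp add: One_nat_def)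
  moreover have "\<sigma> \<le> nth_default 0 s0 0"
    unfolding \<sigma>_def using X0 by (intro nth_default_antimono) (auto simp: orth_svd_def)
  ultimately show ?thesis using \<sigma> by (simp add: \<kappa>_def singular_value_r)
qed

lemma irls_local_convergence:
  assumes k: "1 \<le> k" and eps: "eps k = ereal (singular_value (r + 1) (X k))"
    and small: "spectral_norm (X k - X0) \<le> 1 / 2 * min (sqrt (\<mu>0 * real r / d)) (\<mu>0 / (d * L * \<kappa>)) * \<sigma>"
  shows "irls X eps W (k + 1) \<Longrightarrow> \<exists>\<mu> \<le> d * L / (\<mu>0 * \<sigma>) * \<kappa>.
      spectral_norm (X (k + 1) - X0) \<le> min (\<mu> * (spectral_norm (X k - X0))\<^sup>2) (spectral_norm (X k - X0))"
    and "(\<And>n. irls X eps W n) \<Longrightarrow>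
      spectral_norm (X k - X0) \<le> 1 * min (sqrt (\<mu>0 * real r / d))
        (\<mu>0 powr (3/2) * real r powr (1/2) / (d\<^sup>2 * L powr (3/2) * \<kappa>)) * \<sigma> \<Longrightarrow>
      (\<lambda>l. spectral_norm (X (k + l) - X0)) \<longlonglongrightarrow> 0"
proof -
  have d0: "0 < d" and L0: "0 < L" and m0: "0 < \<mu>0" and \<kappa>0: "0 < \<kappa>" using d L \<mu>0 \<kappa> by auto
  have eps': "eps k = ereal (singular_value (Suc r) (X k))" using eps by simp
  \<comment> \<open>Together with the factors \<open>1 / 2\<close> and \<open>\<sigma>\<close> the
    second entry of the minimum is \<open>1 / (2 * B * \<kappa>)\<close>.\<close>
  have "err (X k) \<le> 1 / 2 * (\<mu>0 / (d * L * \<kappa>)) * \<sigma>"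
    unfolding err_def using \<sigma> by (intro order_trans[OF small] mult_right_mono mult_left_mono) auto
  then have "B * err (X k) \<le> B * (1 / 2 * (\<mu>0 / (d * L * \<kappa>)) * \<sigma>)"
    using B_pos by (intro mult_left_mono) auto
  also have "\<dots> = 1 / 2 * (1 / \<kappa>)" using d0 L0 m0 \<kappa>0 \<sigma> by (simp add: B_def field_simps)
  also have "\<dots> \<le> 1 / 2 * 1" using \<kappa> by (intro mult_left_mono) auto
  finally have e: "B * err (X k) \<le> 1 / 2" by simp
  show "\<exists>\<mu> \<le> d * L / (\<mu>0 * \<sigma>) * \<kappa>.
      spectral_norm (X (k + 1) - X0) \<le> min (\<mu> * (spectral_norm (X k - X0))\<^sup>2) (spectral_norm (X k - X0))"
    if run: "irls X eps W (k + 1)"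
  \<comment> \<open>The step gives the rate \<open>B\<close>; the larger \<open>B * \<kappa>\<close>
    is the bound on \<open>\<mu>\<close> in the statement.\<close>
  proof (intro exI[of _ "B * \<kappa>"] conjI)
    show "B * \<kappa> \<le> d * L / (\<mu>0 * \<sigma>) * \<kappa>" by (simp add: B_def)
    have q: "err (X (k + 1)) \<le> B * (err (X k))\<^sup>2"
      using irls_quadratic[of X eps W k, OF _ k eps' e] run by simp
    have "B * (err (X k))\<^sup>2 \<le> B * \<kappa> * (err (X k))\<^sup>2"
      using B_pos \<kappa> by (intro mult_right_mono) auto
    moreover have "B * (err (X k))\<^sup>2 \<le> err (X k)"
    proof -
      have "B * err (X k) * err (X k) \<le> 1 * err (X k)" using e err_nonneg by (intro mult_right_mono) auto
      then show ?thesis by (simp add: power2_eq_square)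
    qed
    ultimately show "spectral_norm (X (k + 1) - X0)
        \<le> min (B * \<kappa> * (spectral_norm (X k - X0))\<^sup>2) (spectral_norm (X k - X0))"
      using q unfolding err_def by linarith
  qed
  show "(\<lambda>l. spectral_norm (X (k + l) - X0)) \<longlonglongrightarrow> 0"
    if run: "\<And>n. irls X eps W n" and
      small2: "spectral_norm (X k - X0) \<le> 1 * min (sqrt (\<mu>0 * real r / d))
        (\<mu>0 powr (3/2) * real r powr (1/2) / (d\<^sup>2 * L powr (3/2) * \<kappa>)) * \<sigma>"
  proof -
    \<comment> \<open>In the square roots of the parameters the estimate below becomes an identity
      between monomials.\<close>
    define a b l where "a = sqrt \<mu>0" and "b = sqrt (real r)" and "l = sqrt L"
    have abl: "0 < a" "0 < b" "0 < l" "\<mu>0 = a\<^sup>2" "real r = b\<^sup>2" "L = l\<^sup>2"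
      using m0 r1 L0 by (simp_all add: a_def b_def l_def)
    have "err (X k) \<le> 1 * (\<mu>0 powr (3/2) * real r powr (1/2) / (d\<^sup>2 * L powr (3/2) * \<kappa>)) * \<sigma>"
      unfolding err_def using \<sigma> by (intro order_trans[OF small2] mult_right_mono mult_left_mono) auto
    also have "\<mu>0 powr (3/2) = a ^ 3" using m0 by (simp add: powr_three_halves a_def)
    also have "L powr (3/2) = l ^ 3" using L0 by (simp add: powr_three_halves l_def)
    also have "real r powr (1/2) = b" by (simp add: powr_half_sqrt b_def)
    finally have el: "err (X k) \<le> a ^ 3 * b / (d\<^sup>2 * l ^ 3 * \<kappa>) * \<sigma>" by simp
    have c: "6 * sqrt q * sqrt d = 6 / 10 * (d * l / (a * b))"
    proof -
      have "sqrt q = sqrt d * l / (10 * a * b)"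
        unfolding q_def by (simp add: real_sqrt_mult real_sqrt_divide a_def b_def l_def mult.assoc)
      then have "6 * sqrt q * sqrt d = 6 * (sqrt d * sqrt d) * l / (10 * a * b)" by simp
      also have "sqrt d * sqrt d = d" using d0 by simp
      finally show ?thesis by simp
    qed
    have "B = d * L / (\<mu>0 * \<sigma>)" by (rule B_def)
    also have "\<dots> = d * l\<^sup>2 / (a\<^sup>2 * \<sigma>)" using abl(4,6) by simp
    finally have Bl: "B = d * l\<^sup>2 / (a\<^sup>2 * \<sigma>)" .
    \<comment> \<open>The exponents of the second assumption are those for which this product
      collapses to \<open>6 / 10 * (1 / \<kappa>)\<close>; hence c2 = 1 is enough.\<close>
    have "B * err (X k) * (6 * sqrt q * sqrt d)
      \<le> B * (a ^ 3 * b / (d\<^sup>2 * l ^ 3 * \<kappa>) * \<sigma>) * (6 * sqrt q * sqrt d)"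
      using el B_pos q1 d0 by (intro mult_right_mono mult_left_mono) auto
    also have "\<dots> = 6 / 10 * (1 / \<kappa>)"
      unfolding c Bl using abl(1-3) \<sigma> d0 \<kappa>0 by (simp add: field_simps power2_eq_square power3_eq_cube)
    also have "\<dots> \<le> 6 / 10 * 1" using \<kappa> by (intro mult_left_mono) auto
    finally have e2: "B * err (X k) * (6 * sqrt q * sqrt d) \<le> 1" by linarith
    show ?thesis using irls_convergence[OF run k eps' e e2] unfolding err_def .
  qed
qed

end

text \<open>An orthonormal column needs at least one row, so \<open>r \<ge> 1\<close> makes both
  dimensions positive.\<close>

lemma tangent_kernelI:
  assumes U: "U \<in> carrier_mat d1 r" "transpose_mat U * U = 1\<^sub>m r"
    and V: "V \<in> carrier_mat d2 r" "transpose_mat V * V = 1\<^sub>m r" and r: "1 \<le> r"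
  shows "tangent_kernel d1 d2 r U V"
proof -
  have pos: "0 < n" if W: "W \<in> carrier_mat n r" "transpose_mat W * W = 1\<^sub>m r" for n and W :: "real mat"
  proof (rule ccontr)
    assume "\<not> 0 < n"
    moreover have "(\<Sum>a<n. W $$ (a, 0) * W $$ (a, 0)) = 1"
      using transpose_mult_one_iff[OF W(1)] W(2) r by auto
    ultimately show False by simp
  qed
  show ?thesis using assms pos[OF U] pos[OF V] by unfold_locales auto
qed

lemma set_pmf_uniform_sampling:
  assumes "m \<le> d1 * d2" "\<Omega> \<in> set_pmf (uniform_sampling d1 d2 m)"
  shows "set \<Omega> \<subseteq> {..<d1} \<times> {..<d2}"
proof -
  let ?A = "{..<d1} \<times> {..<d2}" and ?L = "{\<Omega>. length \<Omega> = m \<and> distinct \<Omega> \<and> set \<Omega> \<subseteq> {..<d1} \<times> {..<d2}}"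
  have "finite ?L" by (rule finite_subset[OF _ finite_lists_length_eq[of ?A m]]) auto
  moreover have "card ?L > 0" using assms(1) by (subst card_lists_distinct_length_eq) (auto simp: card_cartesian_product)
  ultimately have "set_pmf (uniform_sampling d1 d2 m) = ?L"
    unfolding uniform_sampling_def by (intro set_pmf_of_set) (auto simp: card_gt_0_iff)
  then show ?thesis using assms(2) by blast
qed

theorem theorem4p1:
  shows "\<exists>C c1 c2 :: real. C > 0 \<and> c1 > 0 \<and> c2 > 0 \<and>
    (\<forall>(d1 :: nat) (d2 :: nat) (r :: nat) (m :: nat) (\<mu>0 :: real) (X0 :: real mat).
      X0 \<in> carrier_mat d1 d2 \<longrightarrow> vec_space.rank d1 X0 = r \<longrightarrow> r \<ge> 1 \<longrightarrow> incoherent \<mu>0 X0 \<longrightarrow>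
      m \<le> d1 * d2 \<longrightarrow>
      real m \<ge> C * \<mu>0 * real r * real (d1 + d2) * ln (real (d1 + d2)) \<longrightarrow>
      (let d = real (min d1 d2);
           D = real (max d1 d2);
           \<sigma>r = singular_value r X0;
           \<kappa> = singular_value 1 X0 / singular_value r X0
       in measure_pmf.prob (uniform_sampling d1 d2 m)
            {\<Omega>. \<forall>(k :: nat) X eps W.
               k \<ge> 1 \<longrightarrow>
               matrix_irls d1 d2 \<Omega> (subsample \<Omega> X0) r X eps W k \<longrightarrow>
               eps k = ereal (singular_value (r + 1) (X k)) \<longrightarrow>
               spectral_norm (X k - X0)
                 \<le> c1 * min (sqrt (\<mu>0 * real r / d)) (\<mu>0 / (d * ln D * \<kappa>)) * \<sigma>r \<longrightarrow>
               (matrix_irls d1 d2 \<Omega> (subsample \<Omega> X0) r X eps W (k + 1) \<longrightarrow>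
                 (\<exists>\<mu> \<le> d * ln D / (\<mu>0 * \<sigma>r) * \<kappa>.
                    spectral_norm (X (k + 1) - X0)
                      \<le> min (\<mu> * (spectral_norm (X k - X0))\<^sup>2) (spectral_norm (X k - X0)))) \<and>
               ((\<forall>n. matrix_irls d1 d2 \<Omega> (subsample \<Omega> X0) r X eps W n) \<longrightarrow>
                 spectral_norm (X k - X0)
                   \<le> c2 * min (sqrt (\<mu>0 * real r / d))
                         (\<mu>0 powr (3/2) * real r powr (1/2) / (d\<^sup>2 * ln D powr (3/2) * \<kappa>)) * \<sigma>r \<longrightarrow>
                 (\<lambda>l. spectral_norm (X (k + l) - X0)) \<longlonglongrightarrow> 0)}
          \<ge> 1 - 2 / D\<^sup>2))"
proof (rule exI[of _ 10000], rule exI[of _ "1 / 2"], rule exI[of _ 1], intro conjI allI impI, goal_cases)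
  case (4 d1 d2 r m \<mu>0 X0)
  note X0C = 4(1) and rank = 4(2) and r1 = 4(3) and inc = 4(4) and m = 4(5) and mC = 4(6)
  obtain U0 s0 V0 where \<mu>0: "1 \<le> \<mu>0" and svd: "compact_svd X0 U0 s0 V0"
    and incUV: "\<And>i j. i < d1 \<Longrightarrow> j < d2 \<Longrightarrow> frob_norm (orth_proj (tangent_space U0 V0) (basis_mat d1 d2 i j))
        \<le> sqrt (\<mu>0 * real r * (real (d1 + d2) / (real d1 * real d2)))"
    using inc X0C rank unfolding incoherent_def by (auto simp: Let_def)
  have orth: "orth_svd d1 d2 X0 U0 s0 V0" by (rule compact_svd_imp_orth_svd[OF svd X0C])
  have len: "length s0 = r" and s0pos: "\<forall>x\<in>set s0. 0 < x"
    using svd X0C rank unfolding compact_svd_def by (auto simp: Let_def)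
  have \<sigma>: "0 < nth_default 0 s0 (r - 1)" using s0pos len r1 by (simp add: nth_default_nth)
  interpret T: tangent_kernel d1 d2 r U0 V0
    using orth r1 unfolding orth_svd_def len by (intro tangent_kernelI) auto
  note sz = sample_size_bounds[OF T.d \<mu>0 r1 m mC]
  define q where "q = real (min d1 d2) * ln (real (max d1 d2)) / (100 * \<mu>0 * real r)"
  let ?P = "uniform_sampling d1 d2 m"
  \<comment> \<open>Lists with positions outside the matrix have probability zero; excluding them
    provides the assumption of \<open>irls_local\<close> on \<open>\<Omega>\<close>.\<close>
  define good where "good = {\<Omega>. T.K.null_space_bound q (set \<Omega>) \<and> set \<Omega> \<subseteq> {..<d1} \<times> {..<d2}}"
  have "measure_pmf.prob ?P (- good) = measure_pmf.prob ?P (- good \<inter> set_pmf ?P)"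
    by (rule measure_Int_set_pmf[symmetric])
  also have "\<dots> \<le> measure_pmf.prob ?P {\<Omega>. \<not> T.K.null_space_bound q (set \<Omega>)}"
    using set_pmf_uniform_sampling[OF m] by (intro measure_pmf.finite_measure_mono) (auto simp: good_def)
  also have "\<dots> \<le> 2 / (real (max d1 d2))\<^sup>2"
    unfolding q_def by (rule T.prob_null_space_bound_incoherent[OF \<mu>0 r1 m mC incUV])
  finally have "1 - 2 / (real (max d1 d2))\<^sup>2 \<le> measure_pmf.prob ?P good"
    using measure_pmf.prob_compl[of good ?P] by (simp add: Compl_eq_Diff_UNIV)
  \<comment> \<open>The event of the theorem is reached by inclusion alone, so the bound is passed
    on to every \<open>S\<close> that contains \<open>good\<close>.\<close>
  also have "\<dots> \<le> measure_pmf.prob ?P S" if "good \<subseteq> S" for S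
    using that by (intro measure_pmf.finite_measure_mono) auto
  finally have prob: "good \<subseteq> S \<Longrightarrow> 1 - 2 / (real (max d1 d2))\<^sup>2 \<le> measure_pmf.prob ?P S" for S .
  show ?case
    unfolding Let_def
  proof (rule prob, rule subsetI, unfold mem_Collect_eq, intro allI impI)
    fix \<Omega> and k :: nat and X eps W
    assume "\<Omega> \<in> good" and k: "1 \<le> k" and eps: "eps k = ereal (singular_value (r + 1) (X k))"
      and small: "spectral_norm (X k - X0) \<le> 1 / 2 * min (sqrt (\<mu>0 * real r / real (min d1 d2)))
        (\<mu>0 / (real (min d1 d2) * ln (real (max d1 d2)) * (singular_value 1 X0 / singular_value r X0))) * singular_value r X0"
    then have ns: "T.K.null_space_bound q (set \<Omega>)" and \<Omega>: "set \<Omega> \<subseteq> {..<d1} \<times> {..<d2}" by (auto simp: good_def)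
    interpret I: irls_local d1 d2 r X0 U0 V0 s0 \<Omega> \<mu>0
    proof (unfold_locales)
      show "(frob_norm Z)\<^sup>2 \<le> (1 + real (min d1 d2) * ln (real (max d1 d2)) / (100 * \<mu>0 * real r)) *
          (frob_norm (co_proj d1 U0 * Z * co_proj d2 V0))\<^sup>2"
        if "Z \<in> carrier_mat d1 d2" "\<And>i j. (i, j) \<in> set \<Omega> \<Longrightarrow> i < d1 \<Longrightarrow> j < d2 \<Longrightarrow> Z $$ (i, j) = 0" for Z
        using T.null_space_boundD[OF ns that(1)] that(2) unfolding q_def by auto
    qed (use orth len r1 \<sigma> \<mu>0 sz \<Omega> in auto)
    note conv = I.irls_local_convergence[where k = k and eps = eps and X = X and W = W, unfolded I.\<kappa>_def
      I.singular_value_r[symmetric] I.d_def I.L_def I.irls_def, OF k eps small]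
    show "(matrix_irls d1 d2 \<Omega> (subsample \<Omega> X0) r X eps W (k + 1) \<longrightarrow>
       (\<exists>\<mu> \<le> real (min d1 d2) * ln (real (max d1 d2)) / (\<mu>0 * singular_value r X0) *
            (singular_value 1 X0 / singular_value r X0).
          spectral_norm (X (k + 1) - X0)
            \<le> min (\<mu> * (spectral_norm (X k - X0))\<^sup>2) (spectral_norm (X k - X0)))) \<and>
     ((\<forall>n. matrix_irls d1 d2 \<Omega> (subsample \<Omega> X0) r X eps W n) \<longrightarrow>
       spectral_norm (X k - X0) \<le> 1 * min (sqrt (\<mu>0 * real r / real (min d1 d2)))
          (\<mu>0 powr (3/2) * real r powr (1/2) / ((real (min d1 d2))\<^sup>2 * ln (real (max d1 d2)) powr (3/2) *
            (singular_value 1 X0 / singular_value r X0))) * singular_value r X0 \<longrightarrow>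
       (\<lambda>l. spectral_norm (X (k + l) - X0)) \<longlonglongrightarrow> 0)"
      using conv(1) conv(2) by blast
  qed
qed auto

end
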